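(* Let $\mathcal V$ be a distributive, cartesian monoidal category with finite limits, with terminal object $\mathbf 1$. Then $-\ast\mathbf 1\colon\mathcal V\text{-}\mathsf{Mat}\to\mathsf{Span}(\mathcal V)$ is a normal oplax functor of pseudodouble categories.
   Context: Distributive: $\mathcal V$ has small coproducts, and $\times$ preserves them in each variable. $X\ast\mathbf 1=\sum_{x\in X}\mathbf 1$ for a set $X$. A pseudodouble category has a category $\mathbb D_0$ of 0-cells and vertical 1-cells, a category $\mathbb D_1$ of horizontal 1-cells and 2-cells, functors $\mathrm{dom},\mathrm{cod}$, unit $1$ and horizontal composition $\cdot$, and globular (dom and cod identities) natural isomorphisms $\lambda\colon1\cdot r\to r$, $\rho\colon r\cdot1\to r$, $\alpha\colon(t\cdot s)\cdot r\to t\cdot(s\cdot r)$ satisfying triangle and pentagon. An oplax functor $F$ consists of functors $F_0,F_1$ compatible with dom, cod, and globular natural 2-cells $\mathsf e^F_x\colon F1_x\to1_{Fx}$, $\mathsf m^F\colon F(s\cdot r)\to Fs\cdot Fr$ satisfying the usual unit and associativity coherence; it is normal if $\mathsf e^F$ is invertible. $\mathsf{Span}(\mathcal V)$: 0-cells and vertical 1-cells are those of $\mathcal V$; horizontal 1-cells are spans $X\xleftarrow{l_p}M_p\xrightarrow{r_p}Y$, 2-cells are morphisms of spans, composition by pullback. $\mathcal V\text{-}\mathsf{Mat}$: 0-cells sets, vertical 1-cells functions, horizontal 1-cells $p\colon X\nrightarrow Y$ families $p(x,y)\in\mathcal V$, 2-cells over $(f,g)$ families $p(x,y)\to q(fx,gy)$,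 units $1_X(x,x')=[x=x']\ast\mathbf 1$ (where $[x=x']$ is a singleton if $x=x'$ and empty otherwise), composition $(q\cdot p)(x,z)=\sum_yq(y,z)\times p(x,y)$. $-\ast\mathbf 1$ is $X\mapsto X\ast\mathbf 1$ on 0-cells and sends a matrix $p$ to the span $X\ast\mathbf 1\leftarrow M_{p\ast\mathbf 1}=\sum_{x,y}p(x,y)\to Y\ast\mathbf 1$ whose legs restrict on $p(x,y)$ to $p(x,y)\to\mathbf 1\xrightarrow{x}X\ast\mathbf 1$ and $p(x,y)\to\mathbf 1\xrightarrow{y}Y\ast\mathbf 1$, acting on 2-cells by coproducts. Its unit comparison is the canonical map $\sum_{x,x'}[x=x']\ast\mathbf 1\to X\ast\mathbf 1$; its composition comparison $M_{(q\cdot p)\ast\mathbf 1}=\sum_{x,y,z}q(y,z)\times p(x,y)\to M_{p\ast\mathbf 1}\times_{Y\ast\mathbf 1}M_{q\ast\mathbf 1}$ is induced by the coproducts of the product projections. *)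

theory Defs
  imports "HOL-Library.FuncSet" "HOL-Library.Equipollence"
begin

section \<open>Categories and functors\<close>

record ('o, 'a) category =
  Ob :: "'o set"
  Ar :: "'a set"
  Dom :: "'a \<Rightarrow> 'o"
  Cod :: "'a \<Rightarrow> 'o"
  Ident :: "'o \<Rightarrow> 'a"
  Comp :: "'a \<Rightarrow> 'a \<Rightarrow> 'a"  (infixr "\<cdot>\<index>" 70)

definition hom :: "('o, 'a, 'z) category_scheme \<Rightarrow> 'o \<Rightarrow> 'o \<Rightarrow> 'a set" where
  "hom C x y = {f \<in> Ar C. Dom C f = x \<and> Cod C f = y}"

locale category =
  fixes C :: "('o, 'a, 'z) category_scheme"
  assumes Dom_Ob: "f \<in> Ar C \<Longrightarrow> Dom C f \<in> Ob C"
    and Cod_Ob: "f \<in> Ar C \<Longrightarrow> Cod C f \<in> Ob C"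
    and Ident_hom: "x \<in> Ob C \<Longrightarrow> Ident C x \<in> hom C x x"
    and Comp_hom: "\<lbrakk>f \<in> hom C x y; g \<in> hom C y z\<rbrakk> \<Longrightarrow> g \<cdot>\<^bsub>C\<^esub> f \<in> hom C x z"
    and Comp_Ident: "f \<in> hom C x y \<Longrightarrow> f \<cdot>\<^bsub>C\<^esub> Ident C x = f"
    and Ident_Comp: "f \<in> hom C x y \<Longrightarrow> Ident C y \<cdot>\<^bsub>C\<^esub> f = f"
    and Comp_assoc: "\<lbrakk>f \<in> hom C w x; g \<in> hom C x y; h \<in> hom C y z\<rbrakk>
      \<Longrightarrow> (h \<cdot>\<^bsub>C\<^esub> g) \<cdot>\<^bsub>C\<^esub> f = h \<cdot>\<^bsub>C\<^esub> (g \<cdot>\<^bsub>C\<^esub> f)"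

definition iso :: "('o, 'a, 'z) category_scheme \<Rightarrow> 'a \<Rightarrow> bool" where
  "iso C f \<longleftrightarrow> f \<in> Ar C \<and> (\<exists>g \<in> hom C (Cod C f) (Dom C f).
     g \<cdot>\<^bsub>C\<^esub> f = Ident C (Dom C f) \<and> f \<cdot>\<^bsub>C\<^esub> g = Ident C (Cod C f))"

record ('o, 'a, 'p, 'b) cfunctor =
  onOb :: "'o \<Rightarrow> 'p"
  onAr :: "'a \<Rightarrow> 'b"

locale cfunctor = A: category A + B: category B
  for A :: "('o, 'a, 'y) category_scheme" and B :: "('p, 'b, 'z) category_scheme" +
  fixes F :: "('o, 'a, 'p, 'b) cfunctor"
  assumes onOb: "x \<in> Ob A \<Longrightarrow> onOb F x \<in> Ob B"
    and onAr: "f \<in> hom A x y \<Longrightarrow> onAr F f \<in> hom B (onOb F x) (onOb F y)"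
    and onAr_Ident: "x \<in> Ob A \<Longrightarrow> onAr F (Ident A x) = Ident B (onOb F x)"
    and onAr_Comp: "\<lbrakk>f \<in> hom A x y; g \<in> hom A y z\<rbrakk>
      \<Longrightarrow> onAr F (g \<cdot>\<^bsub>A\<^esub> f) = onAr F g \<cdot>\<^bsub>B\<^esub> onAr F f"


section \<open>Limits and coproducts\<close>

definition is_terminal :: "('o, 'a, 'z) category_scheme \<Rightarrow> 'o \<Rightarrow> bool" where
  "is_terminal C t \<longleftrightarrow> t \<in> Ob C \<and> (\<forall>x \<in> Ob C. \<exists>!f. f \<in> hom C x t)"

definition is_product ::
    "('o, 'a, 'z) category_scheme \<Rightarrow> 'o \<Rightarrow> 'o \<Rightarrow> 'o \<Rightarrow> 'a \<Rightarrow> 'a \<Rightarrow> bool" where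
  "is_product C a b p u v \<longleftrightarrow> u \<in> hom C p a \<and> v \<in> hom C p b \<and>
     (\<forall>x f g. f \<in> hom C x a \<and> g \<in> hom C x b \<longrightarrow>
        (\<exists>!h. h \<in> hom C x p \<and> u \<cdot>\<^bsub>C\<^esub> h = f \<and> v \<cdot>\<^bsub>C\<^esub> h = g))"

definition is_pullback ::
    "('o, 'a, 'z) category_scheme \<Rightarrow> 'a \<Rightarrow> 'a \<Rightarrow> 'o \<Rightarrow> 'a \<Rightarrow> 'a \<Rightarrow> bool" where
  "is_pullback C f g p u v \<longleftrightarrow>
     u \<in> hom C p (Dom C f) \<and> v \<in> hom C p (Dom C g) \<and> f \<cdot>\<^bsub>C\<^esub> u = g \<cdot>\<^bsub>C\<^esub> v \<and>
     (\<forall>x k l. k \<in> hom C x (Dom C f) \<and> l \<in> hom C x (Dom C g) \<and> f \<cdot>\<^bsub>C\<^esub> k = g \<cdot>\<^bsub>C\<^esub> l \<longrightarrow>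
        (\<exists>!h. h \<in> hom C x p \<and> u \<cdot>\<^bsub>C\<^esub> h = k \<and> v \<cdot>\<^bsub>C\<^esub> h = l))"

definition is_coproduct ::
    "('o, 'a, 'z) category_scheme \<Rightarrow> 'i set \<Rightarrow> ('i \<Rightarrow> 'o) \<Rightarrow> 'o \<Rightarrow> ('i \<Rightarrow> 'a) \<Rightarrow> bool" where
  "is_coproduct C I F c \<iota> \<longleftrightarrow> c \<in> Ob C \<and> (\<forall>i \<in> I. \<iota> i \<in> hom C (F i) c) \<and>
     (\<forall>x \<in> Ob C. \<forall>f. (\<forall>i \<in> I. f i \<in> hom C (F i) x) \<longrightarrow>
        (\<exists>!h. h \<in> hom C c x \<and> (\<forall>i \<in> I. h \<cdot>\<^bsub>C\<^esub> \<iota> i = f i)))"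

definition is_cone ::
    "('j, 'k, 'y) category_scheme \<Rightarrow> ('o, 'a, 'z) category_scheme \<Rightarrow> ('j, 'k, 'o, 'a) cfunctor
     \<Rightarrow> 'o \<Rightarrow> ('j \<Rightarrow> 'a) \<Rightarrow> bool" where
  "is_cone J C F l \<pi> \<longleftrightarrow> l \<in> Ob C \<and> (\<forall>j \<in> Ob J. \<pi> j \<in> hom C l (onOb F j)) \<and>
     (\<forall>a \<in> Ar J. onAr F a \<cdot>\<^bsub>C\<^esub> \<pi> (Dom J a) = \<pi> (Cod J a))"

definition is_limit ::
    "('j, 'k, 'y) category_scheme \<Rightarrow> ('o, 'a, 'z) category_scheme \<Rightarrow> ('j, 'k, 'o, 'a) cfunctor
     \<Rightarrow> 'o \<Rightarrow> ('j \<Rightarrow> 'a) \<Rightarrow> bool" where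
  "is_limit J C F l \<pi> \<longleftrightarrow> is_cone J C F l \<pi> \<and>
     (\<forall>x \<xi>. is_cone J C F x \<xi> \<longrightarrow>
        (\<exists>!h. h \<in> hom C x l \<and> (\<forall>j \<in> Ob J. \<pi> j \<cdot>\<^bsub>C\<^esub> h = \<xi> j)))"

text \<open>Every finite category is isomorphic to one whose objects and arrows are natural
  numbers, so nothing is lost by taking diagram shapes of this type.\<close>

definition has_finite_limits :: "('o, 'a, 'z) category_scheme \<Rightarrow> bool" where
  "has_finite_limits C \<longleftrightarrow>
     (\<forall>(J :: (nat, nat) category) F. finite (Ob J) \<and> finite (Ar J) \<and> cfunctor J C F \<longrightarrow>
        (\<exists>l \<pi>. is_limit J C F l \<pi>))"

text \<open>The chosen coproduct depends on the values of the family inside \<open>I\<close> only;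
  this is what \<open>restrict\<close> is for.\<close>

definition coproduct_of ::
    "('o, 'a, 'z) category_scheme \<Rightarrow> 'i set \<Rightarrow> ('i \<Rightarrow> 'o) \<Rightarrow> 'o \<times> ('i \<Rightarrow> 'a)" where
  "coproduct_of C I F = (SOME k. is_coproduct C I (restrict F I) (fst k) (snd k))"

definition coprod :: "('o, 'a, 'z) category_scheme \<Rightarrow> 'i set \<Rightarrow> ('i \<Rightarrow> 'o) \<Rightarrow> 'o" where
  "coprod C I F = fst (coproduct_of C I F)"

definition inj_at :: "('o, 'a, 'z) category_scheme \<Rightarrow> 'i set \<Rightarrow> ('i \<Rightarrow> 'o) \<Rightarrow> 'i \<Rightarrow> 'a" where
  "inj_at C I F = snd (coproduct_of C I F)"

definition copair ::
    "('o, 'a, 'z) category_scheme \<Rightarrow> 'i set \<Rightarrow> ('i \<Rightarrow> 'o) \<Rightarrow> 'o \<Rightarrow> ('i \<Rightarrow> 'a) \<Rightarrow> 'a" where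
  "copair C I F x f =
     (THE h. h \<in> hom C (coprod C I F) x \<and> (\<forall>i \<in> I. h \<cdot>\<^bsub>C\<^esub> inj_at C I F i = f i))"

definition pullback_of :: "('o, 'a, 'z) category_scheme \<Rightarrow> 'a \<Rightarrow> 'a \<Rightarrow> 'o \<times> 'a \<times> 'a" where
  "pullback_of C f g = (SOME k. is_pullback C f g (fst k) (fst (snd k)) (snd (snd k)))"

definition pb :: "('o, 'a, 'z) category_scheme \<Rightarrow> 'a \<Rightarrow> 'a \<Rightarrow> 'o" where
  "pb C f g = fst (pullback_of C f g)"

definition pb1 :: "('o, 'a, 'z) category_scheme \<Rightarrow> 'a \<Rightarrow> 'a \<Rightarrow> 'a" where
  "pb1 C f g = fst (snd (pullback_of C f g))"

definition pb2 :: "('o, 'a, 'z) category_scheme \<Rightarrow> 'a \<Rightarrow> 'a \<Rightarrow> 'a" where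
  "pb2 C f g = snd (snd (pullback_of C f g))"

definition pb_pair :: "('o, 'a, 'z) category_scheme \<Rightarrow> 'a \<Rightarrow> 'a \<Rightarrow> 'a \<Rightarrow> 'a \<Rightarrow> 'a" where
  "pb_pair C f g k l =
     (THE h. h \<in> hom C (Dom C k) (pb C f g) \<and> pb1 C f g \<cdot>\<^bsub>C\<^esub> h = k \<and> pb2 C f g \<cdot>\<^bsub>C\<^esub> h = l)"


section \<open>Distributive cartesian monoidal categories\<close>

text \<open>The monoidal structure is given by specified finite products: a terminal object and,
  for each pair of objects, a product cone.\<close>

record ('o, 'a) cartesian_category = "('o, 'a) category" +
  One :: 'o
  Prod :: "'o \<Rightarrow> 'o \<Rightarrow> 'o"
  Pr1 :: "'o \<Rightarrow> 'o \<Rightarrow> 'a"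
  Pr2 :: "'o \<Rightarrow> 'o \<Rightarrow> 'a"

locale cartesian_monoidal_category = category V
  for V :: "('o, 'a, 'z) cartesian_category_scheme" +
  assumes One_terminal: "is_terminal V (One V)"
    and Prod_product: "\<lbrakk>a \<in> Ob V; b \<in> Ob V\<rbrakk>
      \<Longrightarrow> is_product V a b (Prod V a b) (Pr1 V a b) (Pr2 V a b)"

definition to_one :: "('o, 'a, 'z) cartesian_category_scheme \<Rightarrow> 'o \<Rightarrow> 'a" where
  "to_one V x = (THE f. f \<in> hom V x (One V))"

definition pair :: "('o, 'a, 'z) cartesian_category_scheme \<Rightarrow> 'a \<Rightarrow> 'a \<Rightarrow> 'a" where
  "pair V f g = (THE h. h \<in> hom V (Dom V f) (Prod V (Cod V f) (Cod V g)) \<and>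
     Pr1 V (Cod V f) (Cod V g) \<cdot>\<^bsub>V\<^esub> h = f \<and> Pr2 V (Cod V f) (Cod V g) \<cdot>\<^bsub>V\<^esub> h = g)"

definition prod_map :: "('o, 'a, 'z) cartesian_category_scheme \<Rightarrow> 'a \<Rightarrow> 'a \<Rightarrow> 'a" where
  "prod_map V f g = pair V (f \<cdot>\<^bsub>V\<^esub> Pr1 V (Dom V f) (Dom V g)) (g \<cdot>\<^bsub>V\<^esub> Pr2 V (Dom V f) (Dom V g))"

definition prod_assoc :: "('o, 'a, 'z) cartesian_category_scheme \<Rightarrow> 'o \<Rightarrow> 'o \<Rightarrow> 'o \<Rightarrow> 'a" where
  "prod_assoc V a b c =
     pair V (Pr1 V a b \<cdot>\<^bsub>V\<^esub> Pr1 V (Prod V a b) c)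
       (pair V (Pr2 V a b \<cdot>\<^bsub>V\<^esub> Pr1 V (Prod V a b) c) (Pr2 V (Prod V a b) c))"

text \<open>The small sets are a class \<open>U\<close> of subsets of a type of potential elements. Only the
  cardinality of a set matters for its being small, and the class is closed under small
  disjoint unions (in particular under binary products). Examples, over an infinite type:
  all subsets, the subsets of cardinality below a given infinite regular cardinal, and, over a
  type of sets, those subsets that are in bijection with an element of a Grothendieck universe.\<close>

definition small_universe :: "'u set set \<Rightarrow> bool" where
  "small_universe U \<longleftrightarrow>
     (\<forall>X. finite X \<longrightarrow> X \<in> U) \<and>
     (\<forall>X \<in> U. \<forall>Y. Y \<lesssim> X \<longrightarrow> Y \<in> U) \<and>
     (\<forall>X \<in> U. \<forall>F. (\<forall>x \<in> X. F x \<in> U) \<longrightarrow> (\<exists>Z \<in> U. Z \<approx> Sigma X F))"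

definition has_small_coproducts :: "'u set set \<Rightarrow> ('o, 'a, 'z) category_scheme \<Rightarrow> bool" where
  "has_small_coproducts U C \<longleftrightarrow>
     (\<forall>I \<in> U. \<forall>F. F ` I \<subseteq> Ob C \<longrightarrow> (\<exists>c \<iota>. is_coproduct C I F c \<iota>))"

definition distributive :: "'u set set \<Rightarrow> ('o, 'a, 'z) cartesian_category_scheme \<Rightarrow> bool" where
  "distributive U V \<longleftrightarrow> has_small_coproducts U V \<and>
     (\<forall>I \<in> U. \<forall>F c \<iota>. \<forall>a \<in> Ob V. is_coproduct V I F c \<iota> \<longrightarrow>
        is_coproduct V I (\<lambda>i. Prod V a (F i)) (Prod V a c) (\<lambda>i. prod_map V (Ident V a) (\<iota> i)) \<and>
        is_coproduct V I (\<lambda>i. Prod V (F i) a) (Prod V c a) (\<lambda>i. prod_map V (\<iota> i) (Ident V a)))"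


section \<open>Pseudodouble categories\<close>

definition fibre_product ::
    "('h, 'c, 'x) category_scheme \<Rightarrow> ('k, 'd, 'y) category_scheme
     \<Rightarrow> ('h, 'c, 'o, 'v) cfunctor \<Rightarrow> ('k, 'd, 'o, 'v) cfunctor \<Rightarrow> ('h \<times> 'k, 'c \<times> 'd) category" where
  "fibre_product A B F G =
     \<lparr>Ob = {(s, r). s \<in> Ob A \<and> r \<in> Ob B \<and> onOb F s = onOb G r},
      Ar = {(\<psi>, \<phi>). \<psi> \<in> Ar A \<and> \<phi> \<in> Ar B \<and> onAr F \<psi> = onAr G \<phi>},
      Dom = (\<lambda>(\<psi>, \<phi>). (Dom A \<psi>, Dom B \<phi>)),
      Cod = (\<lambda>(\<psi>, \<phi>). (Cod A \<psi>, Cod B \<phi>)),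
      Ident = (\<lambda>(s, r). (Ident A s, Ident B r)),
      Comp = (\<lambda>(\<psi>', \<phi>') (\<psi>, \<phi>). (\<psi>' \<cdot>\<^bsub>A\<^esub> \<psi>, \<phi>' \<cdot>\<^bsub>B\<^esub> \<phi>))\<rparr>"

record ('o, 'v, 'h, 'c) double =
  D0 :: "('o, 'v) category"
  D1 :: "('h, 'c) category"
  hDom :: "('h, 'c, 'o, 'v) cfunctor"
  hCod :: "('h, 'c, 'o, 'v) cfunctor"
  hUnit :: "('o, 'v, 'h, 'c) cfunctor"
  hComp :: "('h \<times> 'h, 'c \<times> 'c, 'h, 'c) cfunctor"
  lam :: "'h \<Rightarrow> 'c"
  rho :: "'h \<Rightarrow> 'c"
  alpha :: "'h \<Rightarrow> 'h \<Rightarrow> 'h \<Rightarrow> 'c"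

text \<open>Horizontal composites are written in applicative order: \<open>(s, r)\<close> is composable
  if \<open>dom s = cod r\<close>.\<close>

definition composables :: "('o, 'v, 'h, 'c) double \<Rightarrow> ('h \<times> 'h, 'c \<times> 'c) category" where
  "composables D = fibre_product (D1 D) (D1 D) (hDom D) (hCod D)"

abbreviation hc0 :: "('o, 'v, 'h, 'c) double \<Rightarrow> 'h \<Rightarrow> 'h \<Rightarrow> 'h"  (infixr "\<bullet>\<^sub>0\<index>" 75) where
  "s \<bullet>\<^sub>0\<^bsub>D\<^esub> r \<equiv> onOb (hComp D) (s, r)"

abbreviation hc1 :: "('o, 'v, 'h, 'c) double \<Rightarrow> 'c \<Rightarrow> 'c \<Rightarrow> 'c"  (infixr "\<bullet>\<^sub>1\<index>" 75) where
  "\<psi> \<bullet>\<^sub>1\<^bsub>D\<^esub> \<phi> \<equiv> onAr (hComp D) (\<psi>, \<phi>)"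

definition globular :: "('o, 'v, 'h, 'c) double \<Rightarrow> 'c \<Rightarrow> bool" where
  "globular D \<phi> \<longleftrightarrow>
     onAr (hDom D) \<phi> = Ident (D0 D) (onOb (hDom D) (Dom (D1 D) \<phi>)) \<and>
     onAr (hCod D) \<phi> = Ident (D0 D) (onOb (hCod D) (Dom (D1 D) \<phi>))"

locale pseudodouble_category =
  fixes D :: "('o, 'v, 'h, 'c) double"
  assumes hDom_functor: "cfunctor (D1 D) (D0 D) (hDom D)"
    and hCod_functor: "cfunctor (D1 D) (D0 D) (hCod D)"
    and hUnit_functor: "cfunctor (D0 D) (D1 D) (hUnit D)"
    and hComp_functor: "cfunctor (composables D) (D1 D) (hComp D)"
    and hDom_hUnit: "x \<in> Ob (D0 D) \<Longrightarrow> onOb (hDom D) (onOb (hUnit D) x) = x"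
      "f \<in> Ar (D0 D) \<Longrightarrow> onAr (hDom D) (onAr (hUnit D) f) = f"
    and hCod_hUnit: "x \<in> Ob (D0 D) \<Longrightarrow> onOb (hCod D) (onOb (hUnit D) x) = x"
      "f \<in> Ar (D0 D) \<Longrightarrow> onAr (hCod D) (onAr (hUnit D) f) = f"
    and hDom_hComp: "(s, r) \<in> Ob (composables D) \<Longrightarrow> onOb (hDom D) (s \<bullet>\<^sub>0\<^bsub>D\<^esub> r) = onOb (hDom D) r"
      "(\<psi>, \<phi>) \<in> Ar (composables D) \<Longrightarrow> onAr (hDom D) (\<psi> \<bullet>\<^sub>1\<^bsub>D\<^esub> \<phi>) = onAr (hDom D) \<phi>"
    and hCod_hComp: "(s, r) \<in> Ob (composables D) \<Longrightarrow> onOb (hCod D) (s \<bullet>\<^sub>0\<^bsub>D\<^esub> r) = onOb (hCod D) s"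
      "(\<psi>, \<phi>) \<in> Ar (composables D) \<Longrightarrow> onAr (hCod D) (\<psi> \<bullet>\<^sub>1\<^bsub>D\<^esub> \<phi>) = onAr (hCod D) \<psi>"
    and lam: "r \<in> Ob (D1 D) \<Longrightarrow>
      lam D r \<in> hom (D1 D) (onOb (hUnit D) (onOb (hCod D) r) \<bullet>\<^sub>0\<^bsub>D\<^esub> r) r \<and>
      iso (D1 D) (lam D r) \<and> globular D (lam D r)"
    and lam_natural: "\<phi> \<in> hom (D1 D) r r' \<Longrightarrow>
      lam D r' \<cdot>\<^bsub>D1 D\<^esub> (onAr (hUnit D) (onAr (hCod D) \<phi>) \<bullet>\<^sub>1\<^bsub>D\<^esub> \<phi>) = \<phi> \<cdot>\<^bsub>D1 D\<^esub> lam D r"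
    and rho: "r \<in> Ob (D1 D) \<Longrightarrow>
      rho D r \<in> hom (D1 D) (r \<bullet>\<^sub>0\<^bsub>D\<^esub> onOb (hUnit D) (onOb (hDom D) r)) r \<and>
      iso (D1 D) (rho D r) \<and> globular D (rho D r)"
    and rho_natural: "\<phi> \<in> hom (D1 D) r r' \<Longrightarrow>
      rho D r' \<cdot>\<^bsub>D1 D\<^esub> (\<phi> \<bullet>\<^sub>1\<^bsub>D\<^esub> onAr (hUnit D) (onAr (hDom D) \<phi>)) = \<phi> \<cdot>\<^bsub>D1 D\<^esub> rho D r"
    and alpha: "\<lbrakk>(t, s) \<in> Ob (composables D); (s, r) \<in> Ob (composables D)\<rbrakk> \<Longrightarrow>
      alpha D t s r \<in> hom (D1 D) ((t \<bullet>\<^sub>0\<^bsub>D\<^esub> s) \<bullet>\<^sub>0\<^bsub>D\<^esub> r) (t \<bullet>\<^sub>0\<^bsub>D\<^esub> (s \<bullet>\<^sub>0\<^bsub>D\<^esub> r)) \<and>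
      iso (D1 D) (alpha D t s r) \<and> globular D (alpha D t s r)"
    and alpha_natural: "\<lbrakk>(\<tau>, \<sigma>) \<in> Ar (composables D); (\<sigma>, \<phi>) \<in> Ar (composables D);
        \<tau> \<in> hom (D1 D) t t'; \<sigma> \<in> hom (D1 D) s s'; \<phi> \<in> hom (D1 D) r r'\<rbrakk> \<Longrightarrow>
      alpha D t' s' r' \<cdot>\<^bsub>D1 D\<^esub> ((\<tau> \<bullet>\<^sub>1\<^bsub>D\<^esub> \<sigma>) \<bullet>\<^sub>1\<^bsub>D\<^esub> \<phi>) =
      (\<tau> \<bullet>\<^sub>1\<^bsub>D\<^esub> (\<sigma> \<bullet>\<^sub>1\<^bsub>D\<^esub> \<phi>)) \<cdot>\<^bsub>D1 D\<^esub> alpha D t s r"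
    and triangle: "(s, r) \<in> Ob (composables D) \<Longrightarrow>
      (Ident (D1 D) s \<bullet>\<^sub>1\<^bsub>D\<^esub> lam D r) \<cdot>\<^bsub>D1 D\<^esub> alpha D s (onOb (hUnit D) (onOb (hCod D) r)) r =
      rho D s \<bullet>\<^sub>1\<^bsub>D\<^esub> Ident (D1 D) r"
    and pentagon: "\<lbrakk>(u, t) \<in> Ob (composables D); (t, s) \<in> Ob (composables D);
        (s, r) \<in> Ob (composables D)\<rbrakk> \<Longrightarrow>
      alpha D u t (s \<bullet>\<^sub>0\<^bsub>D\<^esub> r) \<cdot>\<^bsub>D1 D\<^esub> alpha D (u \<bullet>\<^sub>0\<^bsub>D\<^esub> t) s r =
      (Ident (D1 D) u \<bullet>\<^sub>1\<^bsub>D\<^esub> alpha D t s r) \<cdot>\<^bsub>D1 D\<^esub>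
        alpha D u (t \<bullet>\<^sub>0\<^bsub>D\<^esub> s) r \<cdot>\<^bsub>D1 D\<^esub> (alpha D u t s \<bullet>\<^sub>1\<^bsub>D\<^esub> Ident (D1 D) r)"

record ('o, 'v, 'h, 'c, 'p, 'w, 'k, 'd) double_map =
  F0 :: "('o, 'v, 'p, 'w) cfunctor"
  F1 :: "('h, 'c, 'k, 'd) cfunctor"
  unit_cmp :: "'o \<Rightarrow> 'd"
  comp_cmp :: "'h \<Rightarrow> 'h \<Rightarrow> 'd"

locale oplax_functor = D: pseudodouble_category D + E: pseudodouble_category E
  for D :: "('o, 'v, 'h, 'c) double" and E :: "('p, 'w, 'k, 'd) double" +
  fixes F :: "('o, 'v, 'h, 'c, 'p, 'w, 'k, 'd) double_map"
  assumes F0_functor: "cfunctor (D0 D) (D0 E) (F0 F)"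
    and F1_functor: "cfunctor (D1 D) (D1 E) (F1 F)"
    and F_hDom: "r \<in> Ob (D1 D) \<Longrightarrow> onOb (hDom E) (onOb (F1 F) r) = onOb (F0 F) (onOb (hDom D) r)"
      "\<phi> \<in> Ar (D1 D) \<Longrightarrow> onAr (hDom E) (onAr (F1 F) \<phi>) = onAr (F0 F) (onAr (hDom D) \<phi>)"
    and F_hCod: "r \<in> Ob (D1 D) \<Longrightarrow> onOb (hCod E) (onOb (F1 F) r) = onOb (F0 F) (onOb (hCod D) r)"
      "\<phi> \<in> Ar (D1 D) \<Longrightarrow> onAr (hCod E) (onAr (F1 F) \<phi>) = onAr (F0 F) (onAr (hCod D) \<phi>)"
    and unit_cmp: "x \<in> Ob (D0 D) \<Longrightarrow>
      unit_cmp F x \<in> hom (D1 E) (onOb (F1 F) (onOb (hUnit D) x)) (onOb (hUnit E) (onOb (F0 F) x)) \<and>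
      globular E (unit_cmp F x)"
    and unit_cmp_natural: "f \<in> hom (D0 D) x y \<Longrightarrow>
      unit_cmp F y \<cdot>\<^bsub>D1 E\<^esub> onAr (F1 F) (onAr (hUnit D) f) =
      onAr (hUnit E) (onAr (F0 F) f) \<cdot>\<^bsub>D1 E\<^esub> unit_cmp F x"
    and comp_cmp: "(s, r) \<in> Ob (composables D) \<Longrightarrow>
      comp_cmp F s r \<in> hom (D1 E) (onOb (F1 F) (s \<bullet>\<^sub>0\<^bsub>D\<^esub> r)) (onOb (F1 F) s \<bullet>\<^sub>0\<^bsub>E\<^esub> onOb (F1 F) r) \<and>
      globular E (comp_cmp F s r)"
    and comp_cmp_natural: "\<lbrakk>(\<psi>, \<phi>) \<in> Ar (composables D);
        \<psi> \<in> hom (D1 D) s s'; \<phi> \<in> hom (D1 D) r r'\<rbrakk> \<Longrightarrow>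
      comp_cmp F s' r' \<cdot>\<^bsub>D1 E\<^esub> onAr (F1 F) (\<psi> \<bullet>\<^sub>1\<^bsub>D\<^esub> \<phi>) =
      (onAr (F1 F) \<psi> \<bullet>\<^sub>1\<^bsub>E\<^esub> onAr (F1 F) \<phi>) \<cdot>\<^bsub>D1 E\<^esub> comp_cmp F s r"
    and lam_coherence: "r \<in> Ob (D1 D) \<Longrightarrow>
      lam E (onOb (F1 F) r) \<cdot>\<^bsub>D1 E\<^esub>
        (unit_cmp F (onOb (hCod D) r) \<bullet>\<^sub>1\<^bsub>E\<^esub> Ident (D1 E) (onOb (F1 F) r)) \<cdot>\<^bsub>D1 E\<^esub>
        comp_cmp F (onOb (hUnit D) (onOb (hCod D) r)) r =
      onAr (F1 F) (lam D r)"
    and rho_coherence: "r \<in> Ob (D1 D) \<Longrightarrow>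
      rho E (onOb (F1 F) r) \<cdot>\<^bsub>D1 E\<^esub>
        (Ident (D1 E) (onOb (F1 F) r) \<bullet>\<^sub>1\<^bsub>E\<^esub> unit_cmp F (onOb (hDom D) r)) \<cdot>\<^bsub>D1 E\<^esub>
        comp_cmp F r (onOb (hUnit D) (onOb (hDom D) r)) =
      onAr (F1 F) (rho D r)"
    and alpha_coherence: "\<lbrakk>(t, s) \<in> Ob (composables D); (s, r) \<in> Ob (composables D)\<rbrakk> \<Longrightarrow>
      alpha E (onOb (F1 F) t) (onOb (F1 F) s) (onOb (F1 F) r) \<cdot>\<^bsub>D1 E\<^esub>
        (comp_cmp F t s \<bullet>\<^sub>1\<^bsub>E\<^esub> Ident (D1 E) (onOb (F1 F) r)) \<cdot>\<^bsub>D1 E\<^esub>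
        comp_cmp F (t \<bullet>\<^sub>0\<^bsub>D\<^esub> s) r =
      (Ident (D1 E) (onOb (F1 F) t) \<bullet>\<^sub>1\<^bsub>E\<^esub> comp_cmp F s r) \<cdot>\<^bsub>D1 E\<^esub>
        comp_cmp F t (s \<bullet>\<^sub>0\<^bsub>D\<^esub> r) \<cdot>\<^bsub>D1 E\<^esub> onAr (F1 F) (alpha D t s r)"

locale normal_oplax_functor = oplax_functor +
  assumes unit_cmp_iso: "x \<in> Ob (D0 D) \<Longrightarrow> iso (D1 E) (unit_cmp F x)"


section \<open>Spans\<close>

datatype ('o, 'a) span = MkSpan (apex: 'o) (lleg: 'a) (rleg: 'a)

datatype ('o, 'a) span_cell =
  SpanCell (sc_src: "('o, 'a) span") (sc_tgt: "('o, 'a) span")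
    (sc_left: 'a) (sc_right: 'a) (sc_mid: 'a)

definition span_cells ::
    "('o, 'a, 'z) category_scheme \<Rightarrow> (('o, 'a) span, ('o, 'a) span_cell) category" where
  "span_cells V =
     \<lparr>Ob = {MkSpan m l r | m l r. l \<in> Ar V \<and> r \<in> Ar V \<and> Dom V l = m \<and> Dom V r = m},
      Ar = {SpanCell (MkSpan m l r) (MkSpan m' l' r') f g k | m l r m' l' r' f g k.
              l \<in> Ar V \<and> r \<in> Ar V \<and> Dom V l = m \<and> Dom V r = m \<and>
              l' \<in> Ar V \<and> r' \<in> Ar V \<and> Dom V l' = m' \<and> Dom V r' = m' \<and>
              f \<in> hom V (Cod V l) (Cod V l') \<and> g \<in> hom V (Cod V r) (Cod V r') \<and> k \<in> hom V m m' \<and>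
              l' \<cdot>\<^bsub>V\<^esub> k = f \<cdot>\<^bsub>V\<^esub> l \<and> r' \<cdot>\<^bsub>V\<^esub> k = g \<cdot>\<^bsub>V\<^esub> r},
      Dom = sc_src,
      Cod = sc_tgt,
      Ident = (\<lambda>s. SpanCell s s (Ident V (Cod V (lleg s))) (Ident V (Cod V (rleg s)))
                 (Ident V (apex s))),
      Comp = (\<lambda>\<psi> \<phi>. SpanCell (sc_src \<phi>) (sc_tgt \<psi>) (sc_left \<psi> \<cdot>\<^bsub>V\<^esub> sc_left \<phi>)
                (sc_right \<psi> \<cdot>\<^bsub>V\<^esub> sc_right \<phi>) (sc_mid \<psi> \<cdot>\<^bsub>V\<^esub> sc_mid \<phi>))\<rparr>"

definition span_unit :: "('o, 'a, 'z) category_scheme \<Rightarrow> 'o \<Rightarrow> ('o, 'a) span" where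
  "span_unit V x = MkSpan x (Ident V x) (Ident V x)"

definition span_comp ::
    "('o, 'a, 'z) category_scheme \<Rightarrow> ('o, 'a) span \<Rightarrow> ('o, 'a) span \<Rightarrow> ('o, 'a) span" where
  "span_comp V s r = MkSpan (pb V (rleg r) (lleg s))
     (lleg r \<cdot>\<^bsub>V\<^esub> pb1 V (rleg r) (lleg s)) (rleg s \<cdot>\<^bsub>V\<^esub> pb2 V (rleg r) (lleg s))"

definition span_comp_cell ::
    "('o, 'a, 'z) category_scheme \<Rightarrow> ('o, 'a) span_cell \<Rightarrow> ('o, 'a) span_cell
     \<Rightarrow> ('o, 'a) span_cell" where
  "span_comp_cell V \<psi> \<phi> =
     (let r = sc_src \<phi>; s = sc_src \<psi>; r' = sc_tgt \<phi>; s' = sc_tgt \<psi> in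
      SpanCell (span_comp V s r) (span_comp V s' r') (sc_left \<phi>) (sc_right \<psi>)
        (pb_pair V (rleg r') (lleg s')
          (sc_mid \<phi> \<cdot>\<^bsub>V\<^esub> pb1 V (rleg r) (lleg s)) (sc_mid \<psi> \<cdot>\<^bsub>V\<^esub> pb2 V (rleg r) (lleg s))))"

definition span_globular ::
    "('o, 'a, 'z) category_scheme \<Rightarrow> ('o, 'a) span \<Rightarrow> ('o, 'a) span \<Rightarrow> 'a \<Rightarrow> ('o, 'a) span_cell" where
  "span_globular V s t k =
     SpanCell s t (Ident V (Cod V (lleg s))) (Ident V (Cod V (rleg s))) k"

definition Span :: "('o, 'a, 'z) category_scheme
    \<Rightarrow> ('o, 'a, ('o, 'a) span, ('o, 'a) span_cell) double" where
  "Span V =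
     \<lparr>D0 = category.truncate V,
      D1 = span_cells V,
      hDom = \<lparr>onOb = (\<lambda>s. Cod V (lleg s)), onAr = sc_left\<rparr>,
      hCod = \<lparr>onOb = (\<lambda>s. Cod V (rleg s)), onAr = sc_right\<rparr>,
      hUnit = \<lparr>onOb = span_unit V,
               onAr = (\<lambda>f. SpanCell (span_unit V (Dom V f)) (span_unit V (Cod V f)) f f f)\<rparr>,
      hComp = \<lparr>onOb = (\<lambda>(s, r). span_comp V s r), onAr = (\<lambda>(\<psi>, \<phi>). span_comp_cell V \<psi> \<phi>)\<rparr>,
      lam = (\<lambda>r. let i = span_unit V (Cod V (rleg r)) in
               span_globular V (span_comp V i r) r (pb1 V (rleg r) (lleg i))),
      rho = (\<lambda>r. let i = span_unit V (Cod V (lleg r)) in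
               span_globular V (span_comp V r i) r (pb2 V (rleg i) (lleg r))),
      alpha = (\<lambda>t s r. let ts = span_comp V t s; sr = span_comp V s r;
                   to_r = pb1 V (rleg r) (lleg ts);
                   to_s = pb1 V (rleg s) (lleg t) \<cdot>\<^bsub>V\<^esub> pb2 V (rleg r) (lleg ts);
                   to_t = pb2 V (rleg s) (lleg t) \<cdot>\<^bsub>V\<^esub> pb2 V (rleg r) (lleg ts)
                 in span_globular V (span_comp V ts r) (span_comp V t sr)
                      (pb_pair V (rleg sr) (lleg t) (pb_pair V (rleg r) (lleg s) to_r to_s) to_t))\<rparr>"


section \<open>Copowers of the terminal object\<close>

definition star :: "('o, 'a, 'z) cartesian_category_scheme \<Rightarrow> 'i set \<Rightarrow> 'o" where
  "star V X = coprod V X (\<lambda>_. One V)"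

definition star_inj :: "('o, 'a, 'z) cartesian_category_scheme \<Rightarrow> 'i set \<Rightarrow> 'i \<Rightarrow> 'a" where
  "star_inj V X = inj_at V X (\<lambda>_. One V)"

definition star_copair ::
    "('o, 'a, 'z) cartesian_category_scheme \<Rightarrow> 'i set \<Rightarrow> 'o \<Rightarrow> ('i \<Rightarrow> 'a) \<Rightarrow> 'a" where
  "star_copair V X = copair V X (\<lambda>_. One V)"

definition star_map ::
    "('o, 'a, 'z) cartesian_category_scheme \<Rightarrow> 'i set \<Rightarrow> 'j set \<Rightarrow> ('i \<Rightarrow> 'j) \<Rightarrow> 'a" where
  "star_map V X Y f = star_copair V X (star V Y) (\<lambda>x. star_inj V Y (f x))"


section \<open>Matrices\<close>

text \<open>Functions and families are extensional, so that cells with the same values are equal.\<close>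

datatype 'u fn = Fn (fn_dom: "'u set") (fn_cod: "'u set") (fn_app: "'u \<Rightarrow> 'u")

definition set_cat :: "'u set set \<Rightarrow> ('u set, 'u fn) category" where
  "set_cat U =
     \<lparr>Ob = U,
      Ar = {Fn X Y f | X Y f. X \<in> U \<and> Y \<in> U \<and> f \<in> X \<rightarrow>\<^sub>E Y},
      Dom = fn_dom,
      Cod = fn_cod,
      Ident = (\<lambda>X. Fn X X (\<lambda>x\<in>X. x)),
      Comp = (\<lambda>g f. Fn (fn_dom f) (fn_cod g) (compose (fn_dom f) (fn_app g) (fn_app f)))\<rparr>"

datatype ('u, 'o) matrix =
  Matrix (m_dom: "'u set") (m_cod: "'u set") (entry: "'u \<times> 'u \<Rightarrow> 'o")

datatype ('u, 'o, 'a) matrix_cell =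
  MatrixCell (mc_src: "('u, 'o) matrix") (mc_tgt: "('u, 'o) matrix")
    (mc_left: "'u \<Rightarrow> 'u") (mc_right: "'u \<Rightarrow> 'u") (mc_entry: "'u \<times> 'u \<Rightarrow> 'a")

definition matrix_cells :: "'u set set \<Rightarrow> ('o, 'a, 'z) category_scheme
    \<Rightarrow> (('u, 'o) matrix, ('u, 'o, 'a) matrix_cell) category" where
  "matrix_cells U V =
     \<lparr>Ob = {Matrix X Y p | X Y p. X \<in> U \<and> Y \<in> U \<and> p \<in> X \<times> Y \<rightarrow>\<^sub>E Ob V},
      Ar = {MatrixCell (Matrix X Y p) (Matrix X' Y' q) f g \<phi> | X Y p X' Y' q f g \<phi>.
              X \<in> U \<and> Y \<in> U \<and> p \<in> X \<times> Y \<rightarrow>\<^sub>E Ob V \<and>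
              X' \<in> U \<and> Y' \<in> U \<and> q \<in> X' \<times> Y' \<rightarrow>\<^sub>E Ob V \<and>
              f \<in> X \<rightarrow>\<^sub>E X' \<and> g \<in> Y \<rightarrow>\<^sub>E Y' \<and>
              \<phi> \<in> (\<Pi>\<^sub>E (x, y) \<in> X \<times> Y. hom V (p (x, y)) (q (f x, g y)))},
      Dom = mc_src,
      Cod = mc_tgt,
      Ident = (\<lambda>p. MatrixCell p p (\<lambda>x\<in>m_dom p. x) (\<lambda>y\<in>m_cod p. y)
                 (\<lambda>(x, y)\<in>m_dom p \<times> m_cod p. Ident V (entry p (x, y)))),
      Comp = (\<lambda>\<psi> \<phi>. let X = m_dom (mc_src \<phi>); Y = m_cod (mc_src \<phi>) in
                MatrixCell (mc_src \<phi>) (mc_tgt \<psi>)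
                  (compose X (mc_left \<psi>) (mc_left \<phi>)) (compose Y (mc_right \<psi>) (mc_right \<phi>))
                  (\<lambda>(x, y)\<in>X \<times> Y.
                     mc_entry \<psi> (mc_left \<phi> x, mc_right \<phi> y) \<cdot>\<^bsub>V\<^esub> mc_entry \<phi> (x, y)))\<rparr>"

definition bracket :: "bool \<Rightarrow> unit set" where
  "bracket P = (if P then {()} else {})"

definition mat_unit ::
    "('o, 'a, 'z) cartesian_category_scheme \<Rightarrow> 'u set \<Rightarrow> ('u, 'o) matrix" where
  "mat_unit V X = Matrix X X (\<lambda>(x, x')\<in>X \<times> X. star V (bracket (x = x')))"

definition mat_unit_cell ::
    "('o, 'a, 'z) cartesian_category_scheme \<Rightarrow> 'u fn \<Rightarrow> ('u, 'o, 'a) matrix_cell" where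
  "mat_unit_cell V h =
     (let X = fn_dom h; Y = fn_cod h; f = fn_app h in
      MatrixCell (mat_unit V X) (mat_unit V Y) f f
        (\<lambda>(x, x')\<in>X \<times> X. star_map V (bracket (x = x')) (bracket (f x = f x')) (\<lambda>u. u)))"

text \<open>The summands of \<open>(q \<cdot> p)(x, z)\<close>.\<close>

definition comp_family :: "('o, 'a, 'z) cartesian_category_scheme
    \<Rightarrow> ('u, 'o) matrix \<Rightarrow> ('u, 'o) matrix \<Rightarrow> 'u \<Rightarrow> 'u \<Rightarrow> 'u \<Rightarrow> 'o" where
  "comp_family V q p x z = (\<lambda>y. Prod V (entry q (y, z)) (entry p (x, y)))"

definition comp_inj :: "('o, 'a, 'z) cartesian_category_scheme
    \<Rightarrow> ('u, 'o) matrix \<Rightarrow> ('u, 'o) matrix \<Rightarrow> 'u \<Rightarrow> 'u \<Rightarrow> 'u \<Rightarrow> 'a" where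
  "comp_inj V q p x z = inj_at V (m_cod p) (comp_family V q p x z)"

definition comp_copair :: "('o, 'a, 'z) cartesian_category_scheme
    \<Rightarrow> ('u, 'o) matrix \<Rightarrow> ('u, 'o) matrix \<Rightarrow> 'u \<Rightarrow> 'u \<Rightarrow> 'o \<Rightarrow> ('u \<Rightarrow> 'a) \<Rightarrow> 'a" where
  "comp_copair V q p x z = copair V (m_cod p) (comp_family V q p x z)"

definition mat_comp :: "('o, 'a, 'z) cartesian_category_scheme
    \<Rightarrow> ('u, 'o) matrix \<Rightarrow> ('u, 'o) matrix \<Rightarrow> ('u, 'o) matrix" where
  "mat_comp V q p = Matrix (m_dom p) (m_cod q)
     (\<lambda>(x, z)\<in>m_dom p \<times> m_cod q. coprod V (m_cod p) (comp_family V q p x z))"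

definition mat_comp_cell :: "('o, 'a, 'z) cartesian_category_scheme
    \<Rightarrow> ('u, 'o, 'a) matrix_cell \<Rightarrow> ('u, 'o, 'a) matrix_cell \<Rightarrow> ('u, 'o, 'a) matrix_cell" where
  "mat_comp_cell V \<psi> \<phi> =
     (let p = mc_src \<phi>; q = mc_src \<psi>; p' = mc_tgt \<phi>; q' = mc_tgt \<psi>;
          f = mc_left \<phi>; g = mc_right \<phi>; h = mc_right \<psi> in
      MatrixCell (mat_comp V q p) (mat_comp V q' p') f h
        (\<lambda>(x, z)\<in>m_dom p \<times> m_cod q.
           comp_copair V q p x z (entry (mat_comp V q' p') (f x, h z))
             (\<lambda>y. comp_inj V q' p' (f x) (h z) (g y) \<cdot>\<^bsub>V\<^esub>
                   prod_map V (mc_entry \<psi> (y, z)) (mc_entry \<phi> (x, y)))))"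

definition mat_globular ::
    "('u, 'o) matrix \<Rightarrow> ('u, 'o) matrix \<Rightarrow> ('u \<times> 'u \<Rightarrow> 'a) \<Rightarrow> ('u, 'o, 'a) matrix_cell" where
  "mat_globular p q \<phi> = MatrixCell p q (\<lambda>x\<in>m_dom p. x) (\<lambda>y\<in>m_cod p. y)
     (restrict \<phi> (m_dom p \<times> m_cod p))"

text \<open>In the unitors the summands off the diagonal have an empty copower of \<open>1\<close> as a factor, hence
  initial by distributivity, and the only arrow out of them is taken. The associator is the
  arrow that acts on the summand \<open>(t(y,z) \<times> s(x,y)) \<times> r(w,x)\<close> as the associator of the product;
  by distributivity these summands are jointly epimorphic.\<close>

definition mat_lam ::
    "('o, 'a, 'z) cartesian_category_scheme \<Rightarrow> ('u, 'o) matrix \<Rightarrow> ('u, 'o, 'a) matrix_cell" where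
  "mat_lam V p =
     (let i = mat_unit V (m_cod p) in
      mat_globular (mat_comp V i p) p
        (\<lambda>(x, y). comp_copair V i p x y (entry p (x, y))
           (\<lambda>y'. if y' = y then Pr2 V (entry i (y', y)) (entry p (x, y'))
                 else (THE f. f \<in> hom V (comp_family V i p x y y') (entry p (x, y))))))"

definition mat_rho ::
    "('o, 'a, 'z) cartesian_category_scheme \<Rightarrow> ('u, 'o) matrix \<Rightarrow> ('u, 'o, 'a) matrix_cell" where
  "mat_rho V p =
     (let i = mat_unit V (m_dom p) in
      mat_globular (mat_comp V p i) p
        (\<lambda>(x, y). comp_copair V p i x y (entry p (x, y))
           (\<lambda>x'. if x' = x then Pr1 V (entry p (x', y)) (entry i (x, x'))
                 else (THE f. f \<in> hom V (comp_family V p i x y x') (entry p (x, y))))))"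

definition mat_alpha :: "('o, 'a, 'z) cartesian_category_scheme
    \<Rightarrow> ('u, 'o) matrix \<Rightarrow> ('u, 'o) matrix \<Rightarrow> ('u, 'o) matrix \<Rightarrow> ('u, 'o, 'a) matrix_cell" where
  "mat_alpha V t s r =
     (let ts = mat_comp V t s; sr = mat_comp V s r in
      mat_globular (mat_comp V ts r) (mat_comp V t sr)
        (\<lambda>(w, z). THE h.
           h \<in> hom V (entry (mat_comp V ts r) (w, z)) (entry (mat_comp V t sr) (w, z)) \<and>
           (\<forall>x \<in> m_cod r. \<forall>y \<in> m_cod s.
              h \<cdot>\<^bsub>V\<^esub> comp_inj V ts r w z x \<cdot>\<^bsub>V\<^esub>
                prod_map V (comp_inj V t s x z y) (Ident V (entry r (w, x))) =
              comp_inj V t sr w z y \<cdot>\<^bsub>V\<^esub>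
                prod_map V (Ident V (entry t (y, z))) (comp_inj V s r w y x) \<cdot>\<^bsub>V\<^esub>
                prod_assoc V (entry t (y, z)) (entry s (x, y)) (entry r (w, x)))))"

definition Mat :: "'u set set \<Rightarrow> ('o, 'a, 'z) cartesian_category_scheme
    \<Rightarrow> ('u set, 'u fn, ('u, 'o) matrix, ('u, 'o, 'a) matrix_cell) double" where
  "Mat U V =
     \<lparr>D0 = set_cat U,
      D1 = matrix_cells U V,
      hDom = \<lparr>onOb = m_dom,
              onAr = (\<lambda>\<phi>. Fn (m_dom (mc_src \<phi>)) (m_dom (mc_tgt \<phi>)) (mc_left \<phi>))\<rparr>,
      hCod = \<lparr>onOb = m_cod,
              onAr = (\<lambda>\<phi>. Fn (m_cod (mc_src \<phi>)) (m_cod (mc_tgt \<phi>)) (mc_right \<phi>))\<rparr>,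
      hUnit = \<lparr>onOb = mat_unit V, onAr = mat_unit_cell V\<rparr>,
      hComp = \<lparr>onOb = (\<lambda>(q, p). mat_comp V q p), onAr = (\<lambda>(\<psi>, \<phi>). mat_comp_cell V \<psi> \<phi>)\<rparr>,
      lam = mat_lam V,
      rho = mat_rho V,
      alpha = mat_alpha V\<rparr>"


section \<open>From matrices to spans\<close>

definition total :: "('o, 'a, 'z) category_scheme \<Rightarrow> ('u, 'o) matrix \<Rightarrow> 'o" where
  "total V p = coprod V (m_dom p \<times> m_cod p) (entry p)"

definition total_inj :: "('o, 'a, 'z) category_scheme \<Rightarrow> ('u, 'o) matrix \<Rightarrow> 'u \<times> 'u \<Rightarrow> 'a" where
  "total_inj V p = inj_at V (m_dom p \<times> m_cod p) (entry p)"

definition total_copair ::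
    "('o, 'a, 'z) category_scheme \<Rightarrow> ('u, 'o) matrix \<Rightarrow> 'o \<Rightarrow> ('u \<times> 'u \<Rightarrow> 'a) \<Rightarrow> 'a" where
  "total_copair V p = copair V (m_dom p \<times> m_cod p) (entry p)"

definition star_span ::
    "('o, 'a, 'z) cartesian_category_scheme \<Rightarrow> ('u, 'o) matrix \<Rightarrow> ('o, 'a) span" where
  "star_span V p = MkSpan (total V p)
     (total_copair V p (star V (m_dom p))
        (\<lambda>(x, y). star_inj V (m_dom p) x \<cdot>\<^bsub>V\<^esub> to_one V (entry p (x, y))))
     (total_copair V p (star V (m_cod p))
        (\<lambda>(x, y). star_inj V (m_cod p) y \<cdot>\<^bsub>V\<^esub> to_one V (entry p (x, y))))"

definition star_span_cell ::
    "('o, 'a, 'z) cartesian_category_scheme \<Rightarrow> ('u, 'o, 'a) matrix_cell \<Rightarrow> ('o, 'a) span_cell" where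
  "star_span_cell V \<phi> =
     (let p = mc_src \<phi>; q = mc_tgt \<phi>; f = mc_left \<phi>; g = mc_right \<phi> in
      SpanCell (star_span V p) (star_span V q)
        (star_map V (m_dom p) (m_dom q) f) (star_map V (m_cod p) (m_cod q) g)
        (total_copair V p (total V q)
           (\<lambda>(x, y). total_inj V q (f x, g y) \<cdot>\<^bsub>V\<^esub> mc_entry \<phi> (x, y))))"

definition star_unit_cmp ::
    "('o, 'a, 'z) cartesian_category_scheme \<Rightarrow> 'u set \<Rightarrow> ('o, 'a) span_cell" where
  "star_unit_cmp V X =
     span_globular V (star_span V (mat_unit V X)) (span_unit V (star V X))
       (total_copair V (mat_unit V X) (star V X)
          (\<lambda>(x, x'). star_copair V (bracket (x = x')) (star V X) (\<lambda>_. star_inj V X x)))"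

definition star_comp_cmp :: "('o, 'a, 'z) cartesian_category_scheme
    \<Rightarrow> ('u, 'o) matrix \<Rightarrow> ('u, 'o) matrix \<Rightarrow> ('o, 'a) span_cell" where
  "star_comp_cmp V q p =
     span_globular V (star_span V (mat_comp V q p)) (span_comp V (star_span V q) (star_span V p))
       (pb_pair V (rleg (star_span V p)) (lleg (star_span V q))
          (total_copair V (mat_comp V q p) (total V p)
             (\<lambda>(x, z). comp_copair V q p x z (total V p)
                (\<lambda>y. total_inj V p (x, y) \<cdot>\<^bsub>V\<^esub> Pr2 V (entry q (y, z)) (entry p (x, y)))))
          (total_copair V (mat_comp V q p) (total V q)
             (\<lambda>(x, z). comp_copair V q p x z (total V q)
                (\<lambda>y. total_inj V q (y, z) \<cdot>\<^bsub>V\<^esub> Pr1 V (entry q (y, z)) (entry p (x, y))))))"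

definition star_functor :: "('o, 'a, 'z) cartesian_category_scheme
    \<Rightarrow> ('u set, 'u fn, ('u, 'o) matrix, ('u, 'o, 'a) matrix_cell,
        'o, 'a, ('o, 'a) span, ('o, 'a) span_cell) double_map" where
  "star_functor V =
     \<lparr>F0 = \<lparr>onOb = star V, onAr = (\<lambda>h. star_map V (fn_dom h) (fn_cod h) (fn_app h))\<rparr>,
      F1 = \<lparr>onOb = star_span V, onAr = star_span_cell V\<rparr>,
      unit_cmp = star_unit_cmp V,
      comp_cmp = star_comp_cmp V\<rparr>"

end

theory Submission
  imports Defs
begin

text \<open>All equations between 2-cells are checked on generalized elements. An arrow into a pullback is a
  compatible pair of arrows, so in spans the coherence cells just rebracket such tuples. In matrices, a
  pair \<open>b\<close> of \<open>q(y,z)\<close> and \<open>a\<close> of \<open>p(x,y)\<close> gives an element \<open>[b,a]\<close> of \<open>(q \<cdot> p)(x,z)\<close>, and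
  distributivity says precisely that iterated elements such as \<open>[[c,b],a]\<close> are jointly epimorphic out of
  an iterated composite. On them the associator is \<open>[[c,b],a] \<mapsto> [c,[b,a]]\<close> and the unitors are the
  projections, the summands off the diagonal being strictly initial. The comparison cell of \<open>-\<ast>1\<close> sends
  \<open>[b,a]\<close> to the pair \<open>(a,b)\<close> in the pullback, which makes all naturality and coherence conditions
  evident.\<close>

section \<open>Categories\<close>

text \<open>Chosen pullbacks and coproducts are known only through their universal properties, and
  the sums in play are indexed not only by members of \<open>U\<close> but also by pairs and by
  \<open>unit\<close>, so nothing can be computed on representatives. This dictates a normal form:
  composites associate to the right, an arrow into a product or a pullback is a pairing, and a
  composite entry of matrices is probed by \<open>elt\<close> with freely chosen components.
  Precomposition preserves this form, so an element can be pushed through a chain of 2-cells by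
  rewriting alone, and a coherence law becomes one extensionality lemma followed by simplification.
  Thought is needed in three places only: the extensionality lemmas for iterated composites, where a
  side factor has to be carried along; the associator of matrices, which is a definite description
  and has to be shown to denote; and the summands off the diagonal of a unit, where no rewrite rule
  applies and equality comes from strictness.\<close>

lemma mem_hom [simp]: "f \<in> hom C x y \<longleftrightarrow> f \<in> Ar C \<and> Dom C f = x \<and> Cod C f = y"
  by (simp add: hom_def)

context category
begin

declare Dom_Ob [simp] Cod_Ob [simp]

lemma Ident_simps [simp]:
  assumes "x \<in> Ob C"
  shows "Ident C x \<in> Ar C" "Dom C (Ident C x) = x" "Cod C (Ident C x) = x"
  using Ident_hom[OF assms] by simp_all

lemma Comp_simps [simp]:
  assumes "f \<in> Ar C" "g \<in> Ar C" "Dom C g = Cod C f"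
  shows "g \<cdot>\<^bsub>C\<^esub> f \<in> Ar C" "Dom C (g \<cdot>\<^bsub>C\<^esub> f) = Dom C f" "Cod C (g \<cdot>\<^bsub>C\<^esub> f) = Cod C g"
  using Comp_hom[of f "Dom C f" "Cod C f" g "Cod C g"] assms by simp_all

lemma Comp_Ident_simps [simp]:
  assumes "f \<in> Ar C"
  shows "Dom C f = x \<Longrightarrow> f \<cdot>\<^bsub>C\<^esub> Ident C x = f" "Cod C f = x \<Longrightarrow> Ident C x \<cdot>\<^bsub>C\<^esub> f = f"
  using assms Comp_Ident[of f] Ident_Comp[of f] by simp_all

text \<open>The typing premises are equations between \<open>Dom\<close> and \<open>Cod\<close>
  rather than memberships in \<open>hom\<close>: no intermediate objects have to be guessed, and the
  rule works as a rewrite towards right-nested composites.\<close>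

lemma Comp_assoc_simp [simp]:
  "\<lbrakk>f \<in> Ar C; g \<in> Ar C; h \<in> Ar C; Dom C g = Cod C f; Dom C h = Cod C g\<rbrakk>
    \<Longrightarrow> (h \<cdot>\<^bsub>C\<^esub> g) \<cdot>\<^bsub>C\<^esub> f = h \<cdot>\<^bsub>C\<^esub> (g \<cdot>\<^bsub>C\<^esub> f)"
  using Comp_assoc[of f "Dom C f" "Cod C f" g "Cod C g" h "Cod C h"] by simp

text \<open>Right-nesting hides a known composite of \<open>g\<close> and \<open>f\<close> inside
  \<open>g \<cdot> (f \<cdot> h)\<close>; this brings it back to the surface. Rules about injections
  or projections become rules about elements in this way.\<close>

lemma Comp_reassoc:
  assumes "g \<cdot>\<^bsub>C\<^esub> f = k" "f \<in> Ar C" "g \<in> Ar C" "Dom C g = Cod C f" "h \<in> Ar C" "Cod C h = Dom C f"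
  shows "g \<cdot>\<^bsub>C\<^esub> (f \<cdot>\<^bsub>C\<^esub> h) = k \<cdot>\<^bsub>C\<^esub> h"
  using Comp_assoc_simp[of h f g] assms by simp

lemma isoI:
  "\<lbrakk>f \<in> hom C x y; g \<in> hom C y x; g \<cdot>\<^bsub>C\<^esub> f = Ident C x; f \<cdot>\<^bsub>C\<^esub> g = Ident C y\<rbrakk> \<Longrightarrow> iso C f"
  unfolding iso_def by auto

end

lemma truncate_simps [simp]:
  "Ob (category.truncate V) = Ob V" "Ar (category.truncate V) = Ar V"
  "Dom (category.truncate V) = Dom V" "Cod (category.truncate V) = Cod V"
  "Ident (category.truncate V) = Ident V" "Comp (category.truncate V) = Comp V"
  by (simp_all add: category.defs)

lemma fibre_product_simps [simp]:
  "(s, r) \<in> Ob (fibre_product A B F G) \<longleftrightarrow> s \<in> Ob A \<and> r \<in> Ob B \<and> onOb F s = onOb G r"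
  "(\<psi>, \<phi>) \<in> Ar (fibre_product A B F G) \<longleftrightarrow> \<psi> \<in> Ar A \<and> \<phi> \<in> Ar B \<and> onAr F \<psi> = onAr G \<phi>"
  "Dom (fibre_product A B F G) (\<psi>, \<phi>) = (Dom A \<psi>, Dom B \<phi>)"
  "Cod (fibre_product A B F G) (\<psi>, \<phi>) = (Cod A \<psi>, Cod B \<phi>)"
  "Ident (fibre_product A B F G) (s, r) = (Ident A s, Ident B r)"
  "Comp (fibre_product A B F G) (\<psi>', \<phi>') (\<psi>, \<phi>) = (\<psi>' \<cdot>\<^bsub>A\<^esub> \<psi>, \<phi>' \<cdot>\<^bsub>B\<^esub> \<phi>)"
  by (auto simp: fibre_product_def)

lemma cfunctorI:
  assumes "category A" "category B"
    and "\<And>x. x \<in> Ob A \<Longrightarrow> onOb F x \<in> Ob B"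
    and "\<And>f. f \<in> Ar A \<Longrightarrow>
      onAr F f \<in> Ar B \<and> Dom B (onAr F f) = onOb F (Dom A f) \<and> Cod B (onAr F f) = onOb F (Cod A f)"
    and "\<And>x. x \<in> Ob A \<Longrightarrow> onAr F (Ident A x) = Ident B (onOb F x)"
    and "\<And>f g. \<lbrakk>f \<in> Ar A; g \<in> Ar A; Dom A g = Cod A f\<rbrakk>
      \<Longrightarrow> onAr F (g \<cdot>\<^bsub>A\<^esub> f) = onAr F g \<cdot>\<^bsub>B\<^esub> onAr F f"
  shows "cfunctor A B F"
  using assms by (auto intro!: cfunctor.intro cfunctor_axioms.intro)

lemma (in cfunctor) onAr_simps:
  assumes "f \<in> Ar A"
  shows "onAr F f \<in> Ar B" "Dom B (onAr F f) = onOb F (Dom A f)" "Cod B (onAr F f) = onOb F (Cod A f)"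
  using onAr[of f "Dom A f" "Cod A f"] assms by simp_all

text \<open>Composable pairs form such a fibre product, for spans as for matrices. Functoriality of
  \<open>F\<close> and \<open>G\<close> is what makes the matching condition stable under
  boundaries, identities and composition.\<close>

lemma category_fibre_product:
  assumes "cfunctor A C F" "cfunctor B C G"
  shows "category (fibre_product A B F G)"
proof -
  interpret F: cfunctor A C F by fact
  interpret G: cfunctor B C G by fact
  let ?P = "fibre_product A B F G"
  show ?thesis
  proof
    fix f assume "f \<in> Ar ?P"
    then show "Dom ?P f \<in> Ob ?P" "Cod ?P f \<in> Ob ?P"
      by (cases f; simp; metis F.onAr_simps G.onAr_simps)+
  next
    fix x assume "x \<in> Ob ?P"
    then show "Ident ?P x \<in> hom ?P x x"
      by (cases x) (simp add: F.onAr_Ident G.onAr_Ident)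
  next
    fix f g x y z assume "f \<in> hom ?P x y" "g \<in> hom ?P y z"
    then show "g \<cdot>\<^bsub>?P\<^esub> f \<in> hom ?P x z"
      by (cases f; cases g) (auto simp: F.onAr_Comp G.onAr_Comp)
  next
    fix f x y assume "f \<in> hom ?P x y"
    then show "f \<cdot>\<^bsub>?P\<^esub> Ident ?P x = f" "Ident ?P y \<cdot>\<^bsub>?P\<^esub> f = f"
      by (cases f; auto)+
  next
    fix f g h w x y z assume "f \<in> hom ?P w x" "g \<in> hom ?P x y" "h \<in> hom ?P y z"
    then show "(h \<cdot>\<^bsub>?P\<^esub> g) \<cdot>\<^bsub>?P\<^esub> f = h \<cdot>\<^bsub>?P\<^esub> (g \<cdot>\<^bsub>?P\<^esub> f)"
      by (cases f; cases g; cases h) auto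
  qed
qed


section \<open>Spans\<close>

locale category_with_pullbacks = category C
  for C :: "('o, 'a, 'z) category_scheme" (structure) +
  assumes ex_pullback: "\<lbrakk>f \<in> Ar C; g \<in> Ar C; Cod C f = Cod C g\<rbrakk> \<Longrightarrow> \<exists>p u v. is_pullback C f g p u v"
begin

lemma is_pullback_pb:
  assumes "f \<in> Ar C" "g \<in> Ar C" "Cod C f = Cod C g"
  shows "is_pullback C f g (pb C f g) (pb1 C f g) (pb2 C f g)"
proof -
  have "\<exists>k. is_pullback C f g (fst k) (fst (snd k)) (snd (snd k))"
    using ex_pullback[OF assms] by auto
  then show ?thesis
    unfolding pb_def pb1_def pb2_def pullback_of_def by (rule someI_ex)
qed

lemma pb_simps [simp]:
  assumes "f \<in> Ar C" "g \<in> Ar C" "Cod C f = Cod C g"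
  shows "pb1 C f g \<in> Ar C" "Dom C (pb1 C f g) = pb C f g" "Cod C (pb1 C f g) = Dom C f"
    "pb2 C f g \<in> Ar C" "Dom C (pb2 C f g) = pb C f g" "Cod C (pb2 C f g) = Dom C g"
    "pb C f g \<in> Ob C"
  using is_pullback_pb[OF assms] Dom_Ob[of "pb1 C f g"] by (auto simp: is_pullback_def)

lemma pb_commutes:
  assumes "f \<in> Ar C" "g \<in> Ar C" "Cod C f = Cod C g"
  shows "f \<cdot> pb1 C f g = g \<cdot> pb2 C f g"
  using is_pullback_pb[OF assms] by (auto simp: is_pullback_def)

lemma pb_pair_simps [simp]:
  assumes "f \<in> Ar C" "g \<in> Ar C" "Cod C f = Cod C g"
    and "k \<in> Ar C" "l \<in> Ar C" "Cod C k = Dom C f" "Cod C l = Dom C g" "Dom C l = Dom C k"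
    and "f \<cdot> k = g \<cdot> l"
  shows "pb_pair C f g k l \<in> Ar C" "Dom C (pb_pair C f g k l) = Dom C k" (is ?T1)
    "Cod C (pb_pair C f g k l) = pb C f g" (is ?T2)
    "pb1 C f g \<cdot> pb_pair C f g k l = k" (is ?T3) "pb2 C f g \<cdot> pb_pair C f g k l = l" (is ?T4)
proof -
  have "\<exists>!h. h \<in> hom C (Dom C k) (pb C f g) \<and> pb1 C f g \<cdot> h = k \<and> pb2 C f g \<cdot> h = l"
    using is_pullback_pb[OF assms(1-3)] assms(4-) unfolding is_pullback_def by simp
  from theI'[OF this] show "pb_pair C f g k l \<in> Ar C" ?T1 ?T2 ?T3 ?T4
    unfolding pb_pair_def by simp_all
qed

text \<open>Both \<open>h\<close> and \<open>h'\<close> mediate the cone formed by the projections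
  of \<open>h\<close>, and this cone commutes because the pullback square does.\<close>

lemma pb_eqI:
  assumes "f \<in> Ar C" "g \<in> Ar C" "Cod C f = Cod C g"
    and "h \<in> hom C x (pb C f g)" "h' \<in> hom C x (pb C f g)"
    and "pb1 C f g \<cdot> h = pb1 C f g \<cdot> h'" "pb2 C f g \<cdot> h = pb2 C f g \<cdot> h'"
  shows "h = h'"
proof -
  have "f \<cdot> pb1 C f g \<cdot> h = g \<cdot> pb2 C f g \<cdot> h"
    using Comp_reassoc[OF pb_commutes, of f g h] assms(1-4) by simp
  moreover have "\<exists>!h. h \<in> hom C x (pb C f g) \<and> pb1 C f g \<cdot> h = k \<and> pb2 C f g \<cdot> h = l"
    if "k \<in> hom C x (Dom C f)" "l \<in> hom C x (Dom C g)" "f \<cdot> k = g \<cdot> l" for k l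
    using is_pullback_pb[OF assms(1-3)] that unfolding is_pullback_def by blast
  ultimately have "\<exists>!k. k \<in> hom C x (pb C f g) \<and> pb1 C f g \<cdot> k = pb1 C f g \<cdot> h \<and>
      pb2 C f g \<cdot> k = pb2 C f g \<cdot> h"
    using assms(1-4) by simp
  then show ?thesis using assms(4-) by metis
qed

text \<open>The projections are jointly monic. As a rewrite rule this moves a generalized element
  into the components, so that an arrow into a pullback keeps the form of a pair.\<close>

lemma pb_pair_Comp [simp]:
  assumes "f \<in> Ar C" "g \<in> Ar C" "Cod C f = Cod C g"
    and "k \<in> Ar C" "l \<in> Ar C" "Cod C k = Dom C f" "Cod C l = Dom C g" "Dom C l = Dom C k"
    and "f \<cdot> k = g \<cdot> l" and "h \<in> Ar C" "Cod C h = Dom C k"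
  shows "pb_pair C f g k l \<cdot> h = pb_pair C f g (k \<cdot> h) (l \<cdot> h)"
proof (rule pb_eqI[OF assms(1-3), where x = "Dom C h"])
  have *: "f \<cdot> k \<cdot> h = g \<cdot> l \<cdot> h"
    using Comp_reassoc[OF assms(9), of h] assms by simp
  then show "pb_pair C f g (k \<cdot> h) (l \<cdot> h) \<in> hom C (Dom C h) (pb C f g)"
    using assms by simp
  show "pb1 C f g \<cdot> pb_pair C f g k l \<cdot> h = pb1 C f g \<cdot> pb_pair C f g (k \<cdot> h) (l \<cdot> h)"
    "pb2 C f g \<cdot> pb_pair C f g k l \<cdot> h = pb2 C f g \<cdot> pb_pair C f g (k \<cdot> h) (l \<cdot> h)"
    using assms * Comp_reassoc[OF pb_pair_simps(4), of f g k l h]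
      Comp_reassoc[OF pb_pair_simps(5), of f g k l h] by simp_all
qed (use assms in simp)

lemma pb_pair_Ident:
  assumes "f \<in> Ar C" "g \<in> Ar C" "Cod C f = Cod C g"
  shows "pb_pair C f g (pb1 C f g) (pb2 C f g) = Ident C (pb C f g)"
  by (rule pb_eqI[OF assms, where x = "pb C f g"]) (simp_all add: assms pb_commutes)

text \<open>The pair of the two projections is the identity, so it is the one test that matters. The
  premise speaks of all pairs because the rules for 2-cells are stated for arbitrary pairs.\<close>

lemma pb_ext:
  assumes "f \<in> Ar C" "g \<in> Ar C" "Cod C f = Cod C g"
    and "m \<in> hom C (pb C f g) y" "n \<in> hom C (pb C f g) y"
    and "\<And>k l. \<lbrakk>k \<in> Ar C; l \<in> Ar C; Cod C k = Dom C f; Cod C l = Dom C g; Dom C l = Dom C k;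
      f \<cdot> k = g \<cdot> l\<rbrakk> \<Longrightarrow> m \<cdot> pb_pair C f g k l = n \<cdot> pb_pair C f g k l"
  shows "m = n"
  using assms(6)[of "pb1 C f g" "pb2 C f g"] assms(1-5)
  by (simp add: pb_commutes pb_pair_Ident)

end

section \<open>Spans and their 2-cells\<close>

lemma span_cells_simps [simp]:
  "Dom (span_cells V) = sc_src" "Cod (span_cells V) = sc_tgt"
  "Ident (span_cells V) s = SpanCell s s (Ident V (Cod V (lleg s))) (Ident V (Cod V (rleg s)))
                 (Ident V (apex s))"
  "Comp (span_cells V) \<psi> \<phi> = SpanCell (sc_src \<phi>) (sc_tgt \<psi>) (sc_left \<psi> \<cdot>\<^bsub>V\<^esub> sc_left \<phi>)
                (sc_right \<psi> \<cdot>\<^bsub>V\<^esub> sc_right \<phi>) (sc_mid \<psi> \<cdot>\<^bsub>V\<^esub> sc_mid \<phi>)"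
  by (auto simp: span_cells_def)

lemma span_cells_Ob_iff:
  "s \<in> Ob (span_cells V) \<longleftrightarrow>
    lleg s \<in> Ar V \<and> rleg s \<in> Ar V \<and> Dom V (lleg s) = apex s \<and> Dom V (rleg s) = apex s"
  by (cases s) (auto simp: span_cells_def)

lemma span_cells_Ar_iff:
  "\<phi> \<in> Ar (span_cells V) \<longleftrightarrow> sc_src \<phi> \<in> Ob (span_cells V) \<and> sc_tgt \<phi> \<in> Ob (span_cells V) \<and>
     sc_left \<phi> \<in> hom V (Cod V (lleg (sc_src \<phi>))) (Cod V (lleg (sc_tgt \<phi>))) \<and>
     sc_right \<phi> \<in> hom V (Cod V (rleg (sc_src \<phi>))) (Cod V (rleg (sc_tgt \<phi>))) \<and>
     sc_mid \<phi> \<in> hom V (apex (sc_src \<phi>)) (apex (sc_tgt \<phi>)) \<and>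
     lleg (sc_tgt \<phi>) \<cdot>\<^bsub>V\<^esub> sc_mid \<phi> = sc_left \<phi> \<cdot>\<^bsub>V\<^esub> lleg (sc_src \<phi>) \<and>
     rleg (sc_tgt \<phi>) \<cdot>\<^bsub>V\<^esub> sc_mid \<phi> = sc_right \<phi> \<cdot>\<^bsub>V\<^esub> rleg (sc_src \<phi>)"
proof (cases \<phi>)
  case (SpanCell s t f g k)
  show ?thesis by (cases s; cases t) (auto simp: SpanCell span_cells_def)
qed

lemma span_cells_ObD [simp]:
  assumes "s \<in> Ob (span_cells V)"
  shows "lleg s \<in> Ar V" "rleg s \<in> Ar V" "Dom V (lleg s) = apex s" "Dom V (rleg s) = apex s"
  using assms by (simp_all add: span_cells_Ob_iff)

text \<open>The last two rules receive the target through an equation with \<open>t\<close>: when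
  they are wanted, \<open>sc_tgt \<phi>\<close> has usually been rewritten to another term, and a
  literal left-hand side would no longer match.\<close>

lemma span_cells_ArD [simp]:
  assumes "\<phi> \<in> Ar (span_cells V)"
  shows "sc_src \<phi> \<in> Ob (span_cells V)" "sc_tgt \<phi> \<in> Ob (span_cells V)"
    "sc_left \<phi> \<in> Ar V" "Dom V (sc_left \<phi>) = Cod V (lleg (sc_src \<phi>))"
    "Cod V (sc_left \<phi>) = Cod V (lleg (sc_tgt \<phi>))"
    "sc_right \<phi> \<in> Ar V" "Dom V (sc_right \<phi>) = Cod V (rleg (sc_src \<phi>))"
    "Cod V (sc_right \<phi>) = Cod V (rleg (sc_tgt \<phi>))"
    "sc_mid \<phi> \<in> Ar V" "Dom V (sc_mid \<phi>) = apex (sc_src \<phi>)" "Cod V (sc_mid \<phi>) = apex (sc_tgt \<phi>)"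
    "sc_tgt \<phi> = t \<Longrightarrow> lleg t \<cdot>\<^bsub>V\<^esub> sc_mid \<phi> = sc_left \<phi> \<cdot>\<^bsub>V\<^esub> lleg (sc_src \<phi>)"
    "sc_tgt \<phi> = t \<Longrightarrow> rleg t \<cdot>\<^bsub>V\<^esub> sc_mid \<phi> = sc_right \<phi> \<cdot>\<^bsub>V\<^esub> rleg (sc_src \<phi>)"
  using assms by (auto simp: span_cells_Ar_iff)

lemma span_cell_eqI:
  "\<lbrakk>sc_src \<phi> = sc_src \<psi>; sc_tgt \<phi> = sc_tgt \<psi>; sc_left \<phi> = sc_left \<psi>; sc_right \<phi> = sc_right \<psi>;
    sc_mid \<phi> = sc_mid \<psi>\<rbrakk> \<Longrightarrow> \<phi> = \<psi>"
  by (rule span_cell.expand) simp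

lemma span_globular_simps [simp]:
  "sc_src (span_globular V s t k) = s" "sc_tgt (span_globular V s t k) = t"
  "sc_left (span_globular V s t k) = Ident V (Cod V (lleg s))"
  "sc_right (span_globular V s t k) = Ident V (Cod V (rleg s))"
  "sc_mid (span_globular V s t k) = k"
  by (simp_all add: span_globular_def)

lemma span_comp_simps [simp]:
  "apex (span_comp V s r) = pb V (rleg r) (lleg s)"
  "lleg (span_comp V s r) = lleg r \<cdot>\<^bsub>V\<^esub> pb1 V (rleg r) (lleg s)"
  "rleg (span_comp V s r) = rleg s \<cdot>\<^bsub>V\<^esub> pb2 V (rleg r) (lleg s)"
  by (simp_all add: span_comp_def)

lemma span_unit_simps [simp]:
  "apex (span_unit V x) = x" "lleg (span_unit V x) = Ident V x" "rleg (span_unit V x) = Ident V x"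
  by (simp_all add: span_unit_def)

lemma span_comp_cell_simps [simp]:
  "sc_src (span_comp_cell V \<psi> \<phi>) = span_comp V (sc_src \<psi>) (sc_src \<phi>)"
  "sc_tgt (span_comp_cell V \<psi> \<phi>) = span_comp V (sc_tgt \<psi>) (sc_tgt \<phi>)"
  "sc_left (span_comp_cell V \<psi> \<phi>) = sc_left \<phi>" "sc_right (span_comp_cell V \<psi> \<phi>) = sc_right \<psi>"
  by (simp_all add: span_comp_cell_def Let_def)

lemma Span_simps [simp]:
  "D0 (Span V) = category.truncate V" "D1 (Span V) = span_cells V"
  "onOb (hDom (Span V)) s = Cod V (lleg s)" "onAr (hDom (Span V)) = sc_left"
  "onOb (hCod (Span V)) s = Cod V (rleg s)" "onAr (hCod (Span V)) = sc_right"
  "onOb (hUnit (Span V)) = span_unit V"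
  "onAr (hUnit (Span V)) f = SpanCell (span_unit V (Dom V f)) (span_unit V (Cod V f)) f f f"
  "onOb (hComp (Span V)) (s, r) = span_comp V s r"
  "onAr (hComp (Span V)) (\<psi>, \<phi>) = span_comp_cell V \<psi> \<phi>"
  by (simp_all add: Span_def)

context category
begin

abbreviation "spans \<equiv> span_cells C"

lemma category_truncate: "category (category.truncate C)"
  by unfold_locales auto

lemma apex_Ob [simp]: "s \<in> Ob spans \<Longrightarrow> apex s \<in> Ob C"
  using Dom_Ob[of "lleg s"] by simp

lemma span_cell_legs [simp]:
  assumes "\<phi> \<in> Ar spans" "k \<in> Ar C" "Cod C k = apex (sc_src \<phi>)" "sc_tgt \<phi> = t"
  shows "lleg t \<cdot>\<^bsub>C\<^esub> sc_mid \<phi> \<cdot>\<^bsub>C\<^esub> k = sc_left \<phi> \<cdot>\<^bsub>C\<^esub> lleg (sc_src \<phi>) \<cdot>\<^bsub>C\<^esub> k"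
    "rleg t \<cdot>\<^bsub>C\<^esub> sc_mid \<phi> \<cdot>\<^bsub>C\<^esub> k = sc_right \<phi> \<cdot>\<^bsub>C\<^esub> rleg (sc_src \<phi>) \<cdot>\<^bsub>C\<^esub> k"
  using assms Comp_reassoc[OF span_cells_ArD(12), of \<phi> t k] Comp_reassoc[OF span_cells_ArD(13), of \<phi> t k]
  by auto

lemma span_cells_ArI:
  assumes "s \<in> Ob spans" "t \<in> Ob spans"
    and "f \<in> hom C (Cod C (lleg s)) (Cod C (lleg t))" "g \<in> hom C (Cod C (rleg s)) (Cod C (rleg t))"
    and "k \<in> hom C (apex s) (apex t)"
    and "lleg t \<cdot>\<^bsub>C\<^esub> k = f \<cdot>\<^bsub>C\<^esub> lleg s" "rleg t \<cdot>\<^bsub>C\<^esub> k = g \<cdot>\<^bsub>C\<^esub> rleg s"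
  shows "SpanCell s t f g k \<in> Ar spans"
  using assms by (simp add: span_cells_Ar_iff)

text \<open>The two leg equations force the feet of \<open>s\<close> and \<open>t\<close> to
  coincide, which makes the identities of \<open>span_globular\<close> legitimate boundary
  arrows.\<close>

lemma span_globular_Ar:
  assumes "s \<in> Ob spans" "t \<in> Ob spans"
    and "k \<in> hom C (apex s) (apex t)" "lleg t \<cdot>\<^bsub>C\<^esub> k = lleg s" "rleg t \<cdot>\<^bsub>C\<^esub> k = rleg s"
  shows "span_globular C s t k \<in> Ar spans"
proof -
  have "Cod C (lleg t) = Cod C (lleg s)" "Cod C (rleg t) = Cod C (rleg s)"
    using assms Comp_simps(3)[of k "lleg t"] Comp_simps(3)[of k "rleg t"] by auto
  then show ?thesis
    unfolding span_globular_def using assms by (intro span_cells_ArI) simp_all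
qed

lemma category_span_cells: "category spans"
proof
  fix f g x y z assume "f \<in> hom spans x y" "g \<in> hom spans y z"
  then show "g \<cdot>\<^bsub>spans\<^esub> f \<in> hom spans x z"
    by (auto intro!: span_cells_ArI)
next
  fix x assume "x \<in> Ob spans"
  then show "Ident spans x \<in> hom spans x x"
    by (auto intro!: span_cells_ArI)
qed (auto intro!: span_cell_eqI)

end

context category_with_pullbacks
begin

lemma pb_commutes_Comp:
  assumes "f \<in> Ar C" "g \<in> Ar C" "Cod C f = Cod C g" "h \<in> Ar C" "Cod C h = pb C f g"
  shows "f \<cdot> pb1 C f g \<cdot> h = g \<cdot> pb2 C f g \<cdot> h"
  using Comp_reassoc[OF pb_commutes, of f g h] assms by simp

lemma span_comp_Ob [simp]:
  assumes "s \<in> Ob spans" "r \<in> Ob spans" "Cod C (lleg s) = Cod C (rleg r)"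
  shows "span_comp C s r \<in> Ob spans"
  using assms by (simp add: span_cells_Ob_iff[of "span_comp C s r"])

lemma span_unit_Ob [simp]: "x \<in> Ob C \<Longrightarrow> span_unit C x \<in> Ob spans"
  by (simp add: span_cells_Ob_iff)

lemma composable_cells:
  assumes "\<psi> \<in> Ar spans" "\<phi> \<in> Ar spans" "sc_left \<psi> = sc_right \<phi>"
  shows "Cod C (lleg (sc_src \<psi>)) = Cod C (rleg (sc_src \<phi>))"
    "Cod C (lleg (sc_tgt \<psi>)) = Cod C (rleg (sc_tgt \<phi>))"
  using span_cells_ArD(4,5)[OF assms(1)] span_cells_ArD(7,8)[OF assms(2)] assms(3) by simp_all

text \<open>The horizontal composite acts componentwise on a pair. The result is again compatible
  because the middle arrows commute with the legs and the two cells share the vertical arrow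
  \<open>sc_left \<psi> = sc_right \<phi>\<close>. The legs enter as variables with equations, so
  that the rules still match after the boundary spans have been simplified.\<close>

lemma span_comp_cell_mid:
  assumes "\<psi> \<in> Ar spans" "\<phi> \<in> Ar spans" "sc_left \<psi> = sc_right \<phi>"
  shows "sc_mid (span_comp_cell C \<psi> \<phi>) \<in> Ar C" (is ?T1)
    "Dom C (sc_mid (span_comp_cell C \<psi> \<phi>)) = pb C (rleg (sc_src \<phi>)) (lleg (sc_src \<psi>))"
    "Cod C (sc_mid (span_comp_cell C \<psi> \<phi>)) = pb C (rleg (sc_tgt \<phi>)) (lleg (sc_tgt \<psi>))"
    "\<lbrakk>f' = rleg (sc_tgt \<phi>); g' = lleg (sc_tgt \<psi>)\<rbrakk> \<Longrightarrow>
      pb1 C f' g' \<cdot> sc_mid (span_comp_cell C \<psi> \<phi>) =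
        sc_mid \<phi> \<cdot> pb1 C (rleg (sc_src \<phi>)) (lleg (sc_src \<psi>))"
    "\<lbrakk>f' = rleg (sc_tgt \<phi>); g' = lleg (sc_tgt \<psi>)\<rbrakk> \<Longrightarrow>
      pb2 C f' g' \<cdot> sc_mid (span_comp_cell C \<psi> \<phi>) =
        sc_mid \<psi> \<cdot> pb2 C (rleg (sc_src \<phi>)) (lleg (sc_src \<psi>))"
    "\<lbrakk>f = rleg (sc_src \<phi>); g = lleg (sc_src \<psi>); k \<in> Ar C; l \<in> Ar C; Cod C k = Dom C f;
        Cod C l = Dom C g; Dom C l = Dom C k; f \<cdot> k = g \<cdot> l\<rbrakk>
      \<Longrightarrow> sc_mid (span_comp_cell C \<psi> \<phi>) \<cdot> pb_pair C f g k l =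
         pb_pair C (rleg (sc_tgt \<phi>)) (lleg (sc_tgt \<psi>)) (sc_mid \<phi> \<cdot> k) (sc_mid \<psi> \<cdot> l)"
proof -
  note [simp] = assms(1-3) composable_cells[OF assms(1-3)]
  let ?f = "rleg (sc_src \<phi>)" and ?g = "lleg (sc_src \<psi>)"
    and ?f' = "rleg (sc_tgt \<phi>)" and ?g' = "lleg (sc_tgt \<psi>)"
  have *: "sc_mid (span_comp_cell C \<psi> \<phi>) =
      pb_pair C ?f' ?g' (sc_mid \<phi> \<cdot> pb1 C ?f ?g) (sc_mid \<psi> \<cdot> pb2 C ?f ?g)"
    by (simp add: span_comp_cell_def Let_def)
  show ?T1
    "Dom C (sc_mid (span_comp_cell C \<psi> \<phi>)) = pb C ?f ?g"
    "Cod C (sc_mid (span_comp_cell C \<psi> \<phi>)) = pb C ?f' ?g'"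
    unfolding * by (simp_all add: pb_commutes)
  show "pb1 C f' g' \<cdot> sc_mid (span_comp_cell C \<psi> \<phi>) = sc_mid \<phi> \<cdot> pb1 C ?f ?g"
    "pb2 C f' g' \<cdot> sc_mid (span_comp_cell C \<psi> \<phi>) = sc_mid \<psi> \<cdot> pb2 C ?f ?g"
    if "f' = ?f'" "g' = ?g'"
    unfolding * that by (simp_all add: pb_commutes)
  show "sc_mid (span_comp_cell C \<psi> \<phi>) \<cdot> pb_pair C f g k l =
         pb_pair C ?f' ?g' (sc_mid \<phi> \<cdot> k) (sc_mid \<psi> \<cdot> l)"
    if "f = ?f" "g = ?g" "k \<in> Ar C" "l \<in> Ar C" "Cod C k = Dom C f"
        "Cod C l = Dom C g" "Dom C l = Dom C k" "f \<cdot> k = g \<cdot> l"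
    unfolding * using that by (simp add: pb_commutes)
qed

end

text \<open>Keeps the apex arrow of the associator opaque. Unfolding \<open>alpha\<close> would
  expose nested pullback pairs, while the proofs want only its typing, its legs and its action on
  triples.\<close>

definition span_assoc ::
    "('o, 'a, 'z) category_scheme \<Rightarrow> ('o, 'a) span \<Rightarrow> ('o, 'a) span \<Rightarrow> ('o, 'a) span \<Rightarrow> 'a" where
  "span_assoc V t s r = sc_mid (alpha (Span V) t s r)"

lemma Span_constraints [simp]:
  "lam (Span V) r = span_globular V (span_comp V (span_unit V (Cod V (rleg r))) r) r
     (pb1 V (rleg r) (Ident V (Cod V (rleg r))))"
  "rho (Span V) r = span_globular V (span_comp V r (span_unit V (Cod V (lleg r)))) r
     (pb2 V (Ident V (Cod V (lleg r))) (lleg r))"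
  "alpha (Span V) t s r = span_globular V (span_comp V (span_comp V t s) r)
     (span_comp V t (span_comp V s r)) (span_assoc V t s r)"
  by (simp_all add: Span_def Let_def span_assoc_def)

context category_with_pullbacks
begin

lemma span_comp_cell_Ar [simp]:
  assumes "\<psi> \<in> Ar spans" "\<phi> \<in> Ar spans" "sc_left \<psi> = sc_right \<phi>"
  shows "span_comp_cell C \<psi> \<phi> \<in> Ar spans"
proof -
  note [simp] = assms composable_cells[OF assms] span_comp_cell_mid[OF assms]
  show ?thesis
    by (simp add: span_cells_Ar_iff[of "span_comp_cell C \<psi> \<phi>"])
qed

lemma pb_pair_eta:
  assumes "f \<in> Ar C" "g \<in> Ar C" "Cod C f = Cod C g" "h \<in> Ar C" "Cod C h = pb C f g"
  shows "pb_pair C f g (pb1 C f g \<cdot> h) (pb2 C f g \<cdot> h) = h"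
  using assms by (simp flip: pb_pair_Comp add: pb_commutes pb_pair_Ident)

text \<open>An inverse of the apex arrow respects the legs by itself:
  \<open>lleg s \<cdot> k' = (lleg t \<cdot> k) \<cdot> k' = lleg t\<close>, and likewise on the
  right.\<close>

lemma span_globular_iso:
  assumes "span_globular C s t k \<in> Ar spans"
    and k': "k' \<in> hom C (apex t) (apex s)" "k' \<cdot> k = Ident C (apex s)" "k \<cdot> k' = Ident C (apex t)"
  shows "iso spans (span_globular C s t k)"
proof -
  let ?\<phi> = "span_globular C s t k"
  note [simp] = span_cells_ArD[OF assms(1), simplified]
  have Cods [simp]: "Cod C (lleg s) = Cod C (lleg t)" "Cod C (rleg s) = Cod C (rleg t)"
    using span_cells_ArD(5,8)[OF assms(1)] by simp_all
  have legs: "lleg s \<cdot> k' = lleg t" "rleg s \<cdot> k' = rleg t"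
    using k' Comp_assoc_simp[of k' k "lleg t"] Comp_assoc_simp[of k' k "rleg t"] by simp_all
  show ?thesis
  proof (rule category.isoI[OF category_span_cells, where g = "span_globular C t s k'"])
    show "span_globular C t s k' \<in> hom spans t s"
      using k' legs by (simp add: span_globular_Ar)
  qed (use assms in \<open>auto intro!: span_cell_eqI\<close>)
qed

text \<open>The last clause is the one that drives all later computations: \<open>(a,(b,c))\<close>
  is sent to \<open>((a,b),c)\<close>. Composites are written in applicative order, but pullback
  pairs list the component in \<open>r\<close> first; hence the brackets of the elements run
  opposite to those of the composites.\<close>

lemma span_assoc_simps:
  assumes [simp]: "t \<in> Ob spans" "s \<in> Ob spans" "r \<in> Ob spans"
    and [simp]: "Cod C (lleg t) = Cod C (rleg s)" "Cod C (lleg s) = Cod C (rleg r)"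
  shows "span_assoc C t s r \<in> Ar C"
    "Dom C (span_assoc C t s r) = apex (span_comp C (span_comp C t s) r)" (is ?T1)
    "Cod C (span_assoc C t s r) = apex (span_comp C t (span_comp C s r))" (is ?T2)
    "lleg r \<cdot> pb1 C (rleg r) (lleg s) \<cdot> pb1 C (rleg s \<cdot> pb2 C (rleg r) (lleg s)) (lleg t) \<cdot>
      span_assoc C t s r = lleg r \<cdot> pb1 C (rleg r) (lleg s \<cdot> pb1 C (rleg s) (lleg t))" (is ?T3)
    "rleg t \<cdot> pb2 C (rleg s \<cdot> pb2 C (rleg r) (lleg s)) (lleg t) \<cdot> span_assoc C t s r =
      rleg t \<cdot> pb2 C (rleg s) (lleg t) \<cdot> pb2 C (rleg r) (lleg s \<cdot> pb1 C (rleg s) (lleg t))" (is ?T4)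
    "\<lbrakk>f = rleg r; g = lleg s \<cdot> pb1 C (rleg s) (lleg t); f' = rleg s; g' = lleg t;
      a \<in> Ar C; b \<in> Ar C; c \<in> Ar C; Cod C a = apex r; Cod C b = apex s; Cod C c = apex t;
      Dom C b = Dom C a; Dom C c = Dom C a; rleg r \<cdot> a = lleg s \<cdot> b; rleg s \<cdot> b = lleg t \<cdot> c\<rbrakk> \<Longrightarrow>
     span_assoc C t s r \<cdot> pb_pair C f g a (pb_pair C f' g' b c) =
       pb_pair C (rleg s \<cdot> pb2 C (rleg r) (lleg s)) (lleg t) (pb_pair C (rleg r) (lleg s) a b) c"
proof -
  define ts where "ts = lleg s \<cdot> pb1 C (rleg s) (lleg t)"
  define sr where "sr = rleg s \<cdot> pb2 C (rleg r) (lleg s)"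
  \<comment> \<open>\<open>x\<close>, \<open>y\<close>, \<open>z\<close> are the projections of the
    iterated pullback to the apexes of \<open>r\<close>, \<open>s\<close>, \<open>t\<close>, that
    is, its universal triple.\<close>
  define x where "x = pb1 C (rleg r) ts"
  define y where "y = pb1 C (rleg s) (lleg t) \<cdot> pb2 C (rleg r) ts"
  define z where "z = pb2 C (rleg s) (lleg t) \<cdot> pb2 C (rleg r) ts"
  have ts: "ts \<in> Ar C" "Dom C ts = pb C (rleg s) (lleg t)" "Cod C ts = Cod C (rleg r)"
    and sr: "sr \<in> Ar C" "Dom C sr = pb C (rleg r) (lleg s)" "Cod C sr = Cod C (rleg s)"
    by (simp_all add: ts_def sr_def)
  have xyz: "x \<in> Ar C" "Dom C x = pb C (rleg r) ts" "Cod C x = apex r"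
    "y \<in> Ar C" "Dom C y = pb C (rleg r) ts" "Cod C y = apex s"
    "z \<in> Ar C" "Dom C z = pb C (rleg r) ts" "Cod C z = apex t"
    by (simp_all add: x_def y_def z_def ts)
  have eq1: "rleg r \<cdot> x = lleg s \<cdot> y"
    \<comment> \<open>The pullback square has \<open>ts\<close> as a single arrow; unfolding
      \<open>ts\<close> afterwards moves its second factor into \<open>y\<close>.\<close>
    using pb_commutes[of "rleg r" ts] by (simp add: x_def y_def ts) (simp add: ts_def)
  have eq2: "rleg s \<cdot> y = lleg t \<cdot> z"
    by (simp add: y_def z_def ts pb_commutes_Comp)
  define w where "w = pb_pair C (rleg r) (lleg s) x y"
  have w: "w \<in> Ar C" "Dom C w = pb C (rleg r) ts" "Cod C w = pb C (rleg r) (lleg s)" "sr \<cdot> w = lleg t \<cdot> z"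
    unfolding w_def by (simp_all add: xyz eq1) (simp add: sr_def xyz eq1 eq2)
  have *: "span_assoc C t s r = pb_pair C sr (lleg t) w z"
    by (simp add: span_assoc_def Span_def Let_def ts_def sr_def w_def x_def y_def z_def)
  show "span_assoc C t s r \<in> Ar C"
    ?T1 ?T2
    by (simp_all add: * w xyz sr) (simp_all add: ts_def sr_def)
  have "pb1 C sr (lleg t) \<cdot> span_assoc C t s r = w"
    "pb2 C sr (lleg t) \<cdot> span_assoc C t s r = z"
    by (simp_all add: * w xyz sr)
  show ?T3 ?T4
    unfolding ts_def[symmetric] sr_def[symmetric]
    by (simp_all add: * w xyz sr) (simp_all add: w_def xyz eq1, simp_all add: x_def z_def ts)
  show "span_assoc C t s r \<cdot> pb_pair C f g a (pb_pair C f' g' b c) =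
       pb_pair C (rleg s \<cdot> pb2 C (rleg r) (lleg s)) (lleg t) (pb_pair C (rleg r) (lleg s) a b) c"
    if fg: "f = rleg r" "g = lleg s \<cdot> pb1 C (rleg s) (lleg t)" "f' = rleg s" "g' = lleg t"
      and [simp]: "a \<in> Ar C" "b \<in> Ar C" "c \<in> Ar C" "Cod C a = apex r" "Cod C b = apex s"
      "Cod C c = apex t" "Dom C b = Dom C a" "Dom C c = Dom C a" "rleg r \<cdot> a = lleg s \<cdot> b"
      "rleg s \<cdot> b = lleg t \<cdot> c"
  proof -
    define m where "m = pb_pair C (rleg s) (lleg t) b c"
    have m: "m \<in> Ar C" "Dom C m = Dom C a" "Cod C m = pb C (rleg s) (lleg t)" "ts \<cdot> m = lleg s \<cdot> b"
      unfolding m_def ts_def by simp_all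
    define n where "n = pb_pair C (rleg r) ts a m"
    have n: "n \<in> Ar C" "Dom C n = Dom C a" "Cod C n = pb C (rleg r) ts"
      "x \<cdot> n = a" "y \<cdot> n = b" "z \<cdot> n = c"
      unfolding n_def x_def y_def z_def by (simp_all add: ts m) (simp_all add: m_def)
    have "w \<cdot> n = pb_pair C (rleg r) (lleg s) a b"
      unfolding w_def by (simp add: xyz eq1 n)
    then have "span_assoc C t s r \<cdot> n = pb_pair C sr (lleg t) (pb_pair C (rleg r) (lleg s) a b) c"
      unfolding * by (simp add: w xyz n sr)
    then show ?thesis by (simp add: fg n_def m_def ts_def sr_def)
  qed
qed


lemma span_assoc_Ar [simp]:
  assumes "t \<in> Ob spans" "s \<in> Ob spans" "r \<in> Ob spans"
    and "Cod C (lleg t) = Cod C (rleg s)" "Cod C (lleg s) = Cod C (rleg r)"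
  shows "span_globular C (span_comp C (span_comp C t s) r) (span_comp C t (span_comp C s r))
      (span_assoc C t s r) \<in> Ar spans"
  by (rule span_globular_Ar) (use assms in \<open>simp_all add: span_assoc_simps\<close>)

text \<open>Pullback extensionality applied once leaves an arbitrary arrow \<open>l\<close> into the
  inner pullback; by \<open>pb_pair_eta\<close> it is the pair of its own projections, so testing on
  triples is enough.\<close>

lemma span_comp3_ext:
  assumes [simp]: "t \<in> Ob spans" "s \<in> Ob spans" "r \<in> Ob spans"
    and [simp]: "Cod C (lleg t) = Cod C (rleg s)" "Cod C (lleg s) = Cod C (rleg r)"
    and m: "m \<in> hom C (apex (span_comp C (span_comp C t s) r)) x"
    and n: "n \<in> hom C (apex (span_comp C (span_comp C t s) r)) x"
    and eq: "\<And>a b c. \<lbrakk>a \<in> Ar C; b \<in> Ar C; c \<in> Ar C; Cod C a = apex r; Cod C b = apex s; Cod C c = apex t;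
      Dom C b = Dom C a; Dom C c = Dom C a; rleg r \<cdot> a = lleg s \<cdot> b; rleg s \<cdot> b = lleg t \<cdot> c\<rbrakk> \<Longrightarrow>
        m \<cdot> pb_pair C (rleg r) (lleg s \<cdot> pb1 C (rleg s) (lleg t)) a (pb_pair C (rleg s) (lleg t) b c) =
        n \<cdot> pb_pair C (rleg r) (lleg s \<cdot> pb1 C (rleg s) (lleg t)) a (pb_pair C (rleg s) (lleg t) b c)"
  shows "m = n"
proof (rule pb_ext[where f = "rleg r" and g = "lleg s \<cdot> pb1 C (rleg s) (lleg t)"])
  fix a l
  assume a: "a \<in> Ar C" "l \<in> Ar C" "Cod C a = Dom C (rleg r)"
      "Cod C l = Dom C (lleg s \<cdot> pb1 C (rleg s) (lleg t))" "Dom C l = Dom C a"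
      "rleg r \<cdot> a = (lleg s \<cdot> pb1 C (rleg s) (lleg t)) \<cdot> l"
  show "m \<cdot> pb_pair C (rleg r) (lleg s \<cdot> pb1 C (rleg s) (lleg t)) a l =
        n \<cdot> pb_pair C (rleg r) (lleg s \<cdot> pb1 C (rleg s) (lleg t)) a l"
    using eq[of a "pb1 C (rleg s) (lleg t) \<cdot> l" "pb2 C (rleg s) (lleg t) \<cdot> l"] a
    by (simp add: pb_pair_eta pb_commutes_Comp)
qed (use m n in simp_all)

lemma span_assoc_iso:
  assumes [simp]: "t \<in> Ob spans" "s \<in> Ob spans" "r \<in> Ob spans"
    and [simp]: "Cod C (lleg t) = Cod C (rleg s)" "Cod C (lleg s) = Cod C (rleg r)"
  shows "iso spans (span_globular C (span_comp C (span_comp C t s) r)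
      (span_comp C t (span_comp C s r)) (span_assoc C t s r))"
proof -
  define ts where "ts = lleg s \<cdot> pb1 C (rleg s) (lleg t)"
  define sr where "sr = rleg s \<cdot> pb2 C (rleg r) (lleg s)"
  \<comment> \<open>Now \<open>a\<close>, \<open>b\<close>, \<open>c\<close> are the projections of
    the target of the associator, bracketed as \<open>((a,b),c)\<close>. The inverse
    \<open>k\<close> is the same triple with the other bracketing.\<close>
  define a where "a = pb1 C (rleg r) (lleg s) \<cdot> pb1 C sr (lleg t)"
  define b where "b = pb2 C (rleg r) (lleg s) \<cdot> pb1 C sr (lleg t)"
  define c where "c = pb2 C sr (lleg t)"
  define k where "k = pb_pair C (rleg r) ts a (pb_pair C (rleg s) (lleg t) b c)"
  have sr: "sr \<in> Ar C" "Dom C sr = pb C (rleg r) (lleg s)" "Cod C sr = Cod C (rleg s)"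
    by (simp_all add: sr_def)
  have abc: "a \<in> Ar C" "b \<in> Ar C" "c \<in> Ar C" "Cod C a = apex r" "Cod C b = apex s" "Cod C c = apex t"
    "Dom C a = pb C sr (lleg t)" "Dom C b = pb C sr (lleg t)" "Dom C c = pb C sr (lleg t)"
    by (simp_all add: a_def b_def c_def sr)
  have eqs: "rleg r \<cdot> a = lleg s \<cdot> b" "rleg s \<cdot> b = lleg t \<cdot> c"
    using pb_commutes[of sr "lleg t"]
    by (simp_all add: a_def b_def c_def sr pb_commutes_Comp) (simp add: sr_def)
  note [simp] = abc eqs span_assoc_simps
  have k: "k \<in> Ar C" "Dom C k = pb C sr (lleg t)" "Cod C k = pb C (rleg r) ts"
    by (simp_all add: k_def ts_def)
  have ab: "pb_pair C (rleg r) (lleg s) a b = pb1 C sr (lleg t)"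
    by (simp add: a_def b_def sr pb_pair_eta)
  show ?thesis
  proof (rule span_globular_iso[where k' = k])
    show "k \<cdot> span_assoc C t s r = Ident C (apex (span_comp C (span_comp C t s) r))"
    proof (rule span_comp3_ext[of t s r])
      fix x y z
      assume [simp]: "x \<in> Ar C" "y \<in> Ar C" "z \<in> Ar C" "Cod C x = apex r" "Cod C y = apex s"
        "Cod C z = apex t" "Dom C y = Dom C x" "Dom C z = Dom C x"
        "rleg r \<cdot> x = lleg s \<cdot> y" "rleg s \<cdot> y = lleg t \<cdot> z"
      define w where "w = pb_pair C sr (lleg t) (pb_pair C (rleg r) (lleg s) x y) z"
      have "w \<in> Ar C" "Cod C w = pb C sr (lleg t)" "a \<cdot> w = x" "b \<cdot> w = y" "c \<cdot> w = z"
        by (simp_all add: w_def sr a_def b_def c_def) (simp_all add: sr_def)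
      then show "(k \<cdot> span_assoc C t s r) \<cdot> pb_pair C (rleg r) (lleg s \<cdot> pb1 C (rleg s) (lleg t)) x
             (pb_pair C (rleg s) (lleg t) y z) =
          Ident C (apex (span_comp C (span_comp C t s) r)) \<cdot>
          pb_pair C (rleg r) (lleg s \<cdot> pb1 C (rleg s) (lleg t)) x (pb_pair C (rleg s) (lleg t) y z)"
        using k by (simp add: ts_def sr_def[symmetric] w_def[symmetric]) (simp add: k_def ts_def)
    qed (use k in \<open>simp_all add: ts_def sr_def\<close>)
    show "span_assoc C t s r \<cdot> k = Ident C (apex (span_comp C t (span_comp C s r)))"
      by (simp add: k_def ts_def sr_def[symmetric] ab) (simp add: c_def sr pb_pair_Ident)
  qed (use k in \<open>simp_all add: ts_def sr_def\<close>)
qed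


section \<open>The pseudodouble category of spans\<close>

lemma hDom_Span_functor: "cfunctor spans (category.truncate C) (hDom (Span C))"
  by (rule cfunctorI[OF category_span_cells category_truncate]) simp_all

lemma hCod_Span_functor: "cfunctor spans (category.truncate C) (hCod (Span C))"
  by (rule cfunctorI[OF category_span_cells category_truncate]) simp_all

lemma hUnit_Span_functor: "cfunctor (category.truncate C) spans (hUnit (Span C))"
  by (rule cfunctorI[OF category_truncate category_span_cells])
    (auto intro!: span_cells_ArI span_cell_eqI)

lemma hUnit_Span_Ar [simp]:
  "\<lbrakk>f \<in> Ar C; x = Dom C f; y = Cod C f\<rbrakk>
    \<Longrightarrow> SpanCell (span_unit C x) (span_unit C y) f f f \<in> Ar spans"
  by (rule span_cells_ArI) simp_all

lemma span_Ident_Ar [simp]: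
  "\<lbrakk>s \<in> Ob spans; x = Cod C (lleg s); y = Cod C (rleg s); m = apex s\<rbrakk>
    \<Longrightarrow> SpanCell s s (Ident C x) (Ident C y) (Ident C m) \<in> Ar spans"
  by (rule span_cells_ArI) simp_all

lemma composables_Span [simp]:
  "(s, r) \<in> Ob (composables (Span C)) \<longleftrightarrow> s \<in> Ob spans \<and> r \<in> Ob spans \<and>
     Cod C (lleg s) = Cod C (rleg r)"
  "(\<psi>, \<phi>) \<in> Ar (composables (Span C)) \<longleftrightarrow> \<psi> \<in> Ar spans \<and> \<phi> \<in> Ar spans \<and>
     sc_left \<psi> = sc_right \<phi>"
  "Dom (composables (Span C)) (\<psi>, \<phi>) = (sc_src \<psi>, sc_src \<phi>)"
  "Cod (composables (Span C)) (\<psi>, \<phi>) = (sc_tgt \<psi>, sc_tgt \<phi>)"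
  by (simp_all add: composables_def)

text \<open>Interchange holds because both sides apply the middle arrows to the two components of a
  pair separately; the identity law is the fact that the pair of projections is an identity.\<close>

lemma hComp_Span_functor: "cfunctor (composables (Span C)) spans (hComp (Span C))" (is "cfunctor ?P _ ?F")
proof (rule cfunctorI)
  show "category ?P"
    unfolding composables_def
    by (rule category_fibre_product[where C = "category.truncate C"])
      (simp_all add: hDom_Span_functor hCod_Span_functor)
  show "category spans" by (rule category_span_cells)
next
  fix x assume "x \<in> Ob ?P"
  then show "onOb ?F x \<in> Ob spans" by (cases x) simp
next
  fix f assume "f \<in> Ar ?P"
  then show "onAr ?F f \<in> Ar spans \<and>
         Dom spans (onAr ?F f) = onOb ?F (Dom ?P f) \<and>
         Cod spans (onAr ?F f) = onOb ?F (Cod ?P f)"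
    by (cases f) simp
next
  fix x assume "x \<in> Ob ?P"
  then show "onAr ?F (Ident ?P x) =
      Ident spans (onOb ?F x)"
    by (cases x) (auto intro!: span_cell_eqI simp: composables_def span_comp_cell_def pb_pair_Ident)
next
  fix f g
  assume fg: "f \<in> Ar ?P" "g \<in> Ar ?P"
    "Dom ?P g = Cod ?P f"
  obtain f1 f2 g1 g2 where f: "f = (f1, f2)" and g: "g = (g1, g2)" by (cases f; cases g)
  have [simp]: "f1 \<in> Ar spans" "f2 \<in> Ar spans" "sc_left f1 = sc_right f2"
    "g1 \<in> Ar spans" "g2 \<in> Ar spans" "sc_left g1 = sc_right g2"
    "sc_src g1 = sc_tgt f1" "sc_src g2 = sc_tgt f2"
    using fg by (simp_all add: f g)
  let ?h1 = "g1 \<cdot>\<^bsub>spans\<^esub> f1" and ?h2 = "g2 \<cdot>\<^bsub>spans\<^esub> f2"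
  note [simp] = composable_cells(1)[of f1 f2] composable_cells(2)[of f1 f2]
    composable_cells(2)[of g1 g2]
  have h: "?h1 \<in> Ar spans" "?h2 \<in> Ar spans" "sc_left ?h1 = sc_right ?h2"
    by (auto intro!: span_cells_ArI)
  have "sc_mid (span_comp_cell C ?h1 ?h2) =
      sc_mid (span_comp_cell C g1 g2) \<cdot> sc_mid (span_comp_cell C f1 f2)"
  proof (rule pb_ext[where f = "rleg (sc_src f2)" and g = "lleg (sc_src f1)"])
    show "sc_mid (span_comp_cell C ?h1 ?h2) \<in> hom C (pb C (rleg (sc_src f2)) (lleg (sc_src f1)))
        (apex (span_comp C (sc_tgt g1) (sc_tgt g2)))"
      using span_comp_cell_mid[OF h] by simp
    fix k l
    assume [simp]: "k \<in> Ar C" "l \<in> Ar C" "Cod C k = Dom C (rleg (sc_src f2))"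
      "Cod C l = Dom C (lleg (sc_src f1))" "Dom C l = Dom C k"
      "rleg (sc_src f2) \<cdot> k = lleg (sc_src f1) \<cdot> l"
    show "sc_mid (span_comp_cell C ?h1 ?h2) \<cdot> pb_pair C (rleg (sc_src f2)) (lleg (sc_src f1)) k l =
      (sc_mid (span_comp_cell C g1 g2) \<cdot> sc_mid (span_comp_cell C f1 f2)) \<cdot>
        pb_pair C (rleg (sc_src f2)) (lleg (sc_src f1)) k l"
      using span_comp_cell_mid(6)[OF h, of "rleg (sc_src f2)" "lleg (sc_src f1)" k l]
      by (simp add: span_comp_cell_mid)
  qed (simp_all add: span_comp_cell_mid)
  then show "onAr ?F (g \<cdot>\<^bsub>?P\<^esub> f) =
      onAr ?F g \<cdot>\<^bsub>spans\<^esub> onAr ?F f"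
    by (intro span_cell_eqI) (simp_all add: f g composables_def)
qed

text \<open>A unitor projects away the component in the identity span. One leg condition is
  immediate, the other is the pullback square along an identity.\<close>

lemma span_unitors_Ar [simp]:
  assumes [simp]: "r \<in> Ob spans"
  shows "y = Cod C (rleg r) \<Longrightarrow>
      span_globular C (span_comp C (span_unit C y) r) r (pb1 C (rleg r) (Ident C y)) \<in> Ar spans"
    "x = Cod C (lleg r) \<Longrightarrow>
      span_globular C (span_comp C r (span_unit C x)) r (pb2 C (Ident C x) (lleg r)) \<in> Ar spans"
proof -
  show "span_globular C (span_comp C (span_unit C y) r) r (pb1 C (rleg r) (Ident C y)) \<in> Ar spans"
    if [simp]: "y = Cod C (rleg r)"
    by (rule span_globular_Ar) (simp_all add: pb_commutes)
  show "span_globular C (span_comp C r (span_unit C x)) r (pb2 C (Ident C x) (lleg r)) \<in> Ar spans"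
    if [simp]: "x = Cod C (lleg r)"
    by (rule span_globular_Ar) (simp_all flip: pb_commutes)
qed

theorem pseudodouble_Span: "pseudodouble_category (Span C)" (is "pseudodouble_category ?D")
proof (rule pseudodouble_category.intro)
  show "cfunctor (D1 ?D) (D0 ?D) (hDom ?D)"
    "cfunctor (D1 ?D) (D0 ?D) (hCod ?D)"
    "cfunctor (D0 ?D) (D1 ?D) (hUnit ?D)"
    "cfunctor (composables ?D) (D1 ?D) (hComp ?D)"
    by (simp_all add: hDom_Span_functor hCod_Span_functor hUnit_Span_functor hComp_Span_functor)
next
  fix r assume "r \<in> Ob (D1 ?D)"
  then have [simp]: "r \<in> Ob spans" by simp
  let ?y = "Cod C (rleg r)" and ?x = "Cod C (lleg r)"
  have l: "span_globular C (span_comp C (span_unit C ?y) r) r (pb1 C (rleg r) (Ident C ?y))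
      \<in> Ar spans"
    by simp
  have "iso spans
      (span_globular C (span_comp C (span_unit C ?y) r) r (pb1 C (rleg r) (Ident C ?y)))"
  \<comment> \<open>In a pullback along an identity the second component is determined by the first
    as its image under the leg; the inverse restores it.\<close>
  proof (rule span_globular_iso[OF l, where k' = "pb_pair C (rleg r) (Ident C ?y) (Ident C (apex r)) (rleg r)"])
    show "pb_pair C (rleg r) (Ident C ?y) (Ident C (apex r)) (rleg r) \<cdot> pb1 C (rleg r) (Ident C ?y) =
        Ident C (apex (span_comp C (span_unit C ?y) r))"
      by (simp add: pb_commutes pb_pair_Ident)
  qed simp_all
  with l show "lam ?D r \<in> hom (D1 ?D) (onOb (hUnit ?D) (onOb (hCod ?D) r) \<bullet>\<^sub>0\<^bsub>?D\<^esub> r) r \<and>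
      iso (D1 ?D) (lam ?D r) \<and> globular ?D (lam ?D r)"
    by (simp add: globular_def)
  have l: "span_globular C (span_comp C r (span_unit C ?x)) r (pb2 C (Ident C ?x) (lleg r))
      \<in> Ar spans"
    by simp
  have "iso spans
      (span_globular C (span_comp C r (span_unit C ?x)) r (pb2 C (Ident C ?x) (lleg r)))"
  \<comment> \<open>Here the identity is the first leg, so the first component is the one to be
    restored.\<close>
  proof (rule span_globular_iso[OF l, where k' = "pb_pair C (Ident C ?x) (lleg r) (lleg r) (Ident C (apex r))"])
    show "pb_pair C (Ident C ?x) (lleg r) (lleg r) (Ident C (apex r)) \<cdot> pb2 C (Ident C ?x) (lleg r) =
        Ident C (apex (span_comp C r (span_unit C ?x)))"
      using pb_commutes[of "Ident C ?x" "lleg r"] pb_pair_Ident[of "Ident C ?x" "lleg r"] by simp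
  qed simp_all
  with l show "rho ?D r \<in> hom (D1 ?D) (r \<bullet>\<^sub>0\<^bsub>?D\<^esub> onOb (hUnit ?D) (onOb (hDom ?D) r)) r \<and>
      iso (D1 ?D) (rho ?D r) \<and> globular ?D (rho ?D r)"
    by (simp add: globular_def)
next
  fix \<phi> r r' assume "\<phi> \<in> hom (D1 ?D) r r'"
  then have [simp]: "\<phi> \<in> Ar spans" "sc_src \<phi> = r" "sc_tgt \<phi> = r'" by simp_all
  have [simp]: "r \<in> Ob spans" "r' \<in> Ob spans"
    using span_cells_ArD(1,2)[of \<phi> C] by simp_all
  show "lam ?D r' \<cdot>\<^bsub>D1 ?D\<^esub>
      (onAr (hUnit ?D) (onAr (hCod ?D) \<phi>) \<bullet>\<^sub>1\<^bsub>?D\<^esub> \<phi>) = \<phi> \<cdot>\<^bsub>D1 ?D\<^esub> lam ?D r"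
    by (rule span_cell_eqI) (simp_all add: span_comp_cell_mid)
  show "rho ?D r' \<cdot>\<^bsub>D1 ?D\<^esub>
      (\<phi> \<bullet>\<^sub>1\<^bsub>?D\<^esub> onAr (hUnit ?D) (onAr (hDom ?D) \<phi>)) = \<phi> \<cdot>\<^bsub>D1 ?D\<^esub> rho ?D r"
    by (rule span_cell_eqI) (simp_all add: span_comp_cell_mid)
next
  fix t s r assume "(t, s) \<in> Ob (composables ?D)" "(s, r) \<in> Ob (composables ?D)"
  then have *: "t \<in> Ob spans" "s \<in> Ob spans" "r \<in> Ob spans"
    "Cod C (lleg t) = Cod C (rleg s)" "Cod C (lleg s) = Cod C (rleg r)" by simp_all
  then show "alpha ?D t s r
       \<in> hom (D1 ?D) ((t \<bullet>\<^sub>0\<^bsub>?D\<^esub> s) \<bullet>\<^sub>0\<^bsub>?D\<^esub> r) (t \<bullet>\<^sub>0\<^bsub>?D\<^esub> s \<bullet>\<^sub>0\<^bsub>?D\<^esub> r) \<and>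
       iso (D1 ?D) (alpha ?D t s r) \<and> globular ?D (alpha ?D t s r)"
    using span_assoc_iso[OF *] by (simp add: globular_def)
next
  fix \<tau> \<sigma> \<phi> t t' s s' r r'
  assume "(\<tau>, \<sigma>) \<in> Ar (composables ?D)" "(\<sigma>, \<phi>) \<in> Ar (composables ?D)"
    and "\<tau> \<in> hom (D1 ?D) t t'" "\<sigma> \<in> hom (D1 ?D) s s'" "\<phi> \<in> hom (D1 ?D) r r'"
  then have [simp]: "\<tau> \<in> Ar spans" "\<sigma> \<in> Ar spans" "\<phi> \<in> Ar spans"
    "sc_src \<tau> = t" "sc_src \<sigma> = s" "sc_src \<phi> = r" "sc_tgt \<tau> = t'" "sc_tgt \<sigma> = s'" "sc_tgt \<phi> = r'"
    "sc_left \<tau> = sc_right \<sigma>" "sc_left \<sigma> = sc_right \<phi>"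
    by simp_all
  have [simp]: "t \<in> Ob spans" "s \<in> Ob spans" "r \<in> Ob spans"
    "t' \<in> Ob spans" "s' \<in> Ob spans" "r' \<in> Ob spans"
    using span_cells_ArD(1,2)[of \<tau> C] span_cells_ArD(1,2)[of \<sigma> C] span_cells_ArD(1,2)[of \<phi> C] by simp_all
  have [simp]: "Cod C (lleg t) = Cod C (rleg s)" "Cod C (lleg s) = Cod C (rleg r)"
    "Cod C (lleg t') = Cod C (rleg s')" "Cod C (lleg s') = Cod C (rleg r')"
    using composable_cells[of \<tau> \<sigma>] composable_cells[of \<sigma> \<phi>] by simp_all
  let ?l = "span_comp_cell C (span_comp_cell C \<tau> \<sigma>) \<phi>" and ?r = "span_comp_cell C \<tau> (span_comp_cell C \<sigma> \<phi>)"
  note [simp] = span_comp_cell_mid span_assoc_simps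
  have "span_assoc C t' s' r' \<cdot> sc_mid ?l = sc_mid ?r \<cdot> span_assoc C t s r"
    by (rule span_comp3_ext[of t s r]) simp_all
  then show "alpha ?D t' s' r' \<cdot>\<^bsub>D1 ?D\<^esub> ((\<tau> \<bullet>\<^sub>1\<^bsub>?D\<^esub> \<sigma>) \<bullet>\<^sub>1\<^bsub>?D\<^esub> \<phi>) =
      (\<tau> \<bullet>\<^sub>1\<^bsub>?D\<^esub> \<sigma> \<bullet>\<^sub>1\<^bsub>?D\<^esub> \<phi>) \<cdot>\<^bsub>D1 ?D\<^esub> alpha ?D t s r"
    by (intro span_cell_eqI) simp_all
next
  fix s r assume "(s, r) \<in> Ob (composables ?D)"
  then have [simp]: "s \<in> Ob spans" "r \<in> Ob spans" "Cod C (lleg s) = Cod C (rleg r)"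
    by simp_all
  let ?i = "span_unit C (Cod C (rleg r))"
  let ?is = "Ident spans s" and ?ir = "Ident spans r"
  note [simp] = span_comp_cell_mid span_assoc_simps
  have "sc_mid (span_comp_cell C ?is (lam ?D r)) \<cdot> span_assoc C s ?i r =
      sc_mid (span_comp_cell C (rho ?D s) ?ir)"
    by (rule span_comp3_ext[of s ?i r]) simp_all
  then show "(Ident (D1 ?D) s \<bullet>\<^sub>1\<^bsub>?D\<^esub> lam ?D r) \<cdot>\<^bsub>D1 ?D\<^esub>
        alpha ?D s (onOb (hUnit ?D) (onOb (hCod ?D) r)) r =
      rho ?D s \<bullet>\<^sub>1\<^bsub>?D\<^esub> Ident (D1 ?D) r"
    by (intro span_cell_eqI) simp_all
next
  fix u t s r
  assume "(u, t) \<in> Ob (composables ?D)" "(t, s) \<in> Ob (composables ?D)"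
    "(s, r) \<in> Ob (composables ?D)"
  then have [simp]: "u \<in> Ob spans" "t \<in> Ob spans" "s \<in> Ob spans"
    "r \<in> Ob spans" "Cod C (lleg u) = Cod C (rleg t)" "Cod C (lleg t) = Cod C (rleg s)"
    "Cod C (lleg s) = Cod C (rleg r)" by simp_all
  let ?iu = "Ident spans u" and ?ir = "Ident spans r"
  note [simp] = span_comp_cell_mid span_assoc_simps
  have "span_assoc C u t (span_comp C s r) \<cdot> span_assoc C (span_comp C u t) s r =
      sc_mid (span_comp_cell C ?iu (alpha ?D t s r)) \<cdot> span_assoc C u (span_comp C t s) r \<cdot>
      sc_mid (span_comp_cell C (alpha ?D u t s) ?ir)" (is "?m = ?n")
  proof (rule span_comp3_ext[of "span_comp C u t" s r])
    fix a b k
    assume [simp]: "a \<in> Ar C" "b \<in> Ar C" "k \<in> Ar C" "Cod C a = apex r" "Cod C b = apex s"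
      and k: "Cod C k = apex (span_comp C u t)"
      and [simp]: "Dom C b = Dom C a" "Dom C k = Dom C a" "rleg r \<cdot> a = lleg s \<cdot> b"
      and b: "rleg s \<cdot> b = lleg (span_comp C u t) \<cdot> k"
    \<comment> \<open>\<open>span_comp3_ext\<close> separates three factors only. The component
      \<open>k\<close> in the composite of \<open>u\<close> and \<open>t\<close> is split once more
      into \<open>c\<close> and \<open>d\<close>, which yields a quadruple that all the associators
      can rebracket.\<close>
    define c where "c = pb1 C (rleg t) (lleg u) \<cdot> k"
    define d where "d = pb2 C (rleg t) (lleg u) \<cdot> k"
    have [simp]: "c \<in> Ar C" "d \<in> Ar C" "Dom C c = Dom C a" "Dom C d = Dom C a" "Cod C c = apex t"
      "Cod C d = apex u" "rleg t \<cdot> c = lleg u \<cdot> d" "rleg s \<cdot> b = lleg t \<cdot> c"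
      using k b by (simp_all add: c_def d_def pb_commutes_Comp)
    have k_eq: "k = pb_pair C (rleg t) (lleg u) c d"
      using k by (simp add: c_def d_def pb_pair_eta)
    show "?m \<cdot> pb_pair C (rleg r) (lleg s \<cdot> pb1 C (rleg s) (lleg (span_comp C u t))) a
        (pb_pair C (rleg s) (lleg (span_comp C u t)) b k) =
      ?n \<cdot> pb_pair C (rleg r) (lleg s \<cdot> pb1 C (rleg s) (lleg (span_comp C u t))) a
        (pb_pair C (rleg s) (lleg (span_comp C u t)) b k)"
      unfolding k_eq by simp
  qed simp_all
  then show "alpha ?D u t (s \<bullet>\<^sub>0\<^bsub>?D\<^esub> r) \<cdot>\<^bsub>D1 ?D\<^esub> alpha ?D (u \<bullet>\<^sub>0\<^bsub>?D\<^esub> t) s r =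
      (Ident (D1 ?D) u \<bullet>\<^sub>1\<^bsub>?D\<^esub> alpha ?D t s r) \<cdot>\<^bsub>D1 ?D\<^esub>
      alpha ?D u (t \<bullet>\<^sub>0\<^bsub>?D\<^esub> s) r \<cdot>\<^bsub>D1 ?D\<^esub>
      (alpha ?D u t s \<bullet>\<^sub>1\<^bsub>?D\<^esub> Ident (D1 ?D) r)"
    by (intro span_cell_eqI) simp_all
qed auto

end

text \<open>The arrows \<open>0\<close>, \<open>1\<close>, \<open>2\<close> are the identities; the others are \<open>3 : 0 \<rightarrow> 2\<close> and \<open>4 : 1 \<rightarrow> 2\<close>.\<close>

definition cospan_shape :: "(nat, nat) category" where
  "cospan_shape =
     \<lparr>Ob = {0, 1, 2}, Ar = {0, 1, 2, 3, 4},
      Dom = (\<lambda>a. if a = 3 then 0 else if a = 4 then 1 else a),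
      Cod = (\<lambda>a. if a = 3 \<or> a = 4 then 2 else a),
      Ident = (\<lambda>x. x), Comp = (\<lambda>b a. if a = 3 \<or> a = 4 then a else b)\<rparr>"

definition cospan_diagram ::
    "('o, 'a, 'z) category_scheme \<Rightarrow> 'a \<Rightarrow> 'a \<Rightarrow> (nat, nat, 'o, 'a) cfunctor" where
  "cospan_diagram C f g =
     (let ob = (\<lambda>j. if j = 0 then Dom C f else if j = 1 then Dom C g else Cod C f) in
      \<lparr>onOb = ob, onAr = (\<lambda>a. if a = 3 then f else if a = 4 then g else Ident C (ob a))\<rparr>)"

lemma category_cospan_shape: "category cospan_shape"
  by unfold_locales (auto simp: cospan_shape_def)

lemma cospan_simps:
  "Ob cospan_shape = {0, 1, 2}" "Ar cospan_shape = {0, 1, 2, 3, 4}"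
  "Dom cospan_shape 0 = 0" "Dom cospan_shape 1 = 1" "Dom cospan_shape 2 = 2"
  "Dom cospan_shape 3 = 0" "Dom cospan_shape 4 = 1"
  "Cod cospan_shape 0 = 0" "Cod cospan_shape 1 = 1" "Cod cospan_shape 2 = 2"
  "Cod cospan_shape 3 = 2" "Cod cospan_shape 4 = 2"
  "Ident cospan_shape x = x"
  "Comp cospan_shape b 0 = b" "Comp cospan_shape b 1 = b" "Comp cospan_shape b 2 = b"
  "Comp cospan_shape b 3 = 3" "Comp cospan_shape b 4 = 4"
  "onOb (cospan_diagram C f g) 0 = Dom C f" "onOb (cospan_diagram C f g) 1 = Dom C g"
  "onOb (cospan_diagram C f g) 2 = Cod C f"
  "onAr (cospan_diagram C f g) 0 = Ident C (Dom C f)" "onAr (cospan_diagram C f g) 1 = Ident C (Dom C g)"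
  "onAr (cospan_diagram C f g) 2 = Ident C (Cod C f)"
  "onAr (cospan_diagram C f g) 3 = f" "onAr (cospan_diagram C f g) 4 = g"
  by (simp_all add: cospan_shape_def cospan_diagram_def Let_def)

text \<open>A cone over the cospan diagram amounts to a commuting square, since its component at the
  vertex \<open>2\<close> is determined by either of the others. A limit cone thus restricts to a
  pullback.\<close>

lemma (in category) has_finite_limits_imp_pullbacks:
  assumes "has_finite_limits C"
  shows "category_with_pullbacks C"
proof
  fix f g assume fg: "f \<in> Ar C" "g \<in> Ar C" "Cod C f = Cod C g"
  let ?J = cospan_shape and ?F = "cospan_diagram C f g"
  \<comment> \<open>Keeps the object \<open>1\<close> of the shape a numeral; as
    \<open>Suc 0\<close> it would not match \<open>cospan_simps\<close>.\<close>
  note [simp del] = One_nat_def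
  have F: "cfunctor ?J C ?F"
    by (rule cfunctorI[OF category_cospan_shape category_axioms])
      (use fg in \<open>auto simp: cospan_simps\<close>)
  have "finite (Ob ?J)" "finite (Ar ?J)" by (simp_all add: cospan_simps)
  with F obtain l \<pi> where lim: "is_limit ?J C ?F l \<pi>"
    using assms unfolding has_finite_limits_def by blast
  have cone: "is_cone ?J C ?F x \<xi> \<longleftrightarrow> x \<in> Ob C \<and> \<xi> 0 \<in> hom C x (Dom C f) \<and>
      \<xi> 1 \<in> hom C x (Dom C g) \<and> \<xi> 2 \<in> hom C x (Cod C f) \<and> f \<cdot>\<^bsub>C\<^esub> \<xi> 0 = \<xi> 2 \<and> g \<cdot>\<^bsub>C\<^esub> \<xi> 1 = \<xi> 2" for x \<xi>
    using fg by (auto simp: is_cone_def cospan_simps)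
  have "is_pullback C f g l (\<pi> 0) (\<pi> 1)"
    unfolding is_pullback_def
  proof (intro conjI allI impI)
    have l: "is_cone ?J C ?F l \<pi>" using lim by (simp add: is_limit_def)
    then show "\<pi> 0 \<in> hom C l (Dom C f)" "\<pi> 1 \<in> hom C l (Dom C g)" "f \<cdot>\<^bsub>C\<^esub> \<pi> 0 = g \<cdot>\<^bsub>C\<^esub> \<pi> 1"
      by (simp_all add: cone)
    fix x h k assume hk: "h \<in> hom C x (Dom C f) \<and> k \<in> hom C x (Dom C g) \<and> f \<cdot>\<^bsub>C\<^esub> h = g \<cdot>\<^bsub>C\<^esub> k"
    let ?\<xi> = "\<lambda>j::nat. if j = 0 then h else if j = 1 then k else f \<cdot>\<^bsub>C\<^esub> h"
    have "is_cone ?J C ?F x ?\<xi>" using hk fg by (auto simp: cone)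
    then have ex: "\<exists>!m. m \<in> hom C x l \<and> (\<forall>j \<in> Ob ?J. \<pi> j \<cdot>\<^bsub>C\<^esub> m = ?\<xi> j)"
      using lim unfolding is_limit_def by blast
    \<comment> \<open>The condition at the vertex \<open>2\<close> follows from the one at
      \<open>0\<close>, so the unique existence given by the limit is the one demanded of the
      pullback.\<close>
    have "\<pi> 2 \<cdot>\<^bsub>C\<^esub> m = f \<cdot>\<^bsub>C\<^esub> h" if "m \<in> hom C x l" "\<pi> 0 \<cdot>\<^bsub>C\<^esub> m = h" for m
      using that l fg Comp_reassoc[of f "\<pi> 0" "\<pi> 2" m] by (auto simp: cone)
    then have "(m \<in> hom C x l \<and> (\<forall>j \<in> Ob ?J. \<pi> j \<cdot>\<^bsub>C\<^esub> m = ?\<xi> j)) \<longleftrightarrow>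
        (m \<in> hom C x l \<and> \<pi> 0 \<cdot>\<^bsub>C\<^esub> m = h \<and> \<pi> 1 \<cdot>\<^bsub>C\<^esub> m = k)" for m
      by (auto simp: cospan_simps)
    with ex show "\<exists>!m. m \<in> hom C x l \<and> \<pi> 0 \<cdot>\<^bsub>C\<^esub> m = h \<and> \<pi> 1 \<cdot>\<^bsub>C\<^esub> m = k" by simp
  qed
  then show "\<exists>p u v. is_pullback C f g p u v" by blast
qed


section \<open>Products and coproducts\<close>

context cartesian_monoidal_category
begin

lemma One_Ob [simp]: "One V \<in> Ob V"
  using One_terminal by (simp add: is_terminal_def)

lemma to_one_simps [simp]:
  assumes "x \<in> Ob V"
  shows "to_one V x \<in> Ar V" "Dom V (to_one V x) = x" "Cod V (to_one V x) = One V"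
proof -
  have "\<exists>!f. f \<in> hom V x (One V)" using One_terminal assms by (simp add: is_terminal_def)
  from theI'[OF this] show "to_one V x \<in> Ar V" "Dom V (to_one V x) = x" "Cod V (to_one V x) = One V"
    by (simp_all add: to_one_def)
qed

lemma to_one_unique: "f \<in> Ar V \<Longrightarrow> Cod V f = One V \<Longrightarrow> f = to_one V (Dom V f)"
  using One_terminal to_one_simps[of "Dom V f"] Dom_Ob[of f]
  unfolding is_terminal_def by (metis mem_hom)

lemma to_one_Comp [simp]: "f \<in> Ar V \<Longrightarrow> Cod V f = x \<Longrightarrow> to_one V x \<cdot>\<^bsub>V\<^esub> f = to_one V (Dom V f)"
  using to_one_unique[of "to_one V x \<cdot>\<^bsub>V\<^esub> f"] by auto

lemma to_one_One [simp]: "to_one V (One V) = Ident V (One V)"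
  using to_one_unique[of "Ident V (One V)"] by simp

lemma Prod_simps [simp]:
  assumes "a \<in> Ob V" "b \<in> Ob V"
  shows "Pr1 V a b \<in> Ar V" "Dom V (Pr1 V a b) = Prod V a b" "Cod V (Pr1 V a b) = a"
    "Pr2 V a b \<in> Ar V" "Dom V (Pr2 V a b) = Prod V a b" "Cod V (Pr2 V a b) = b"
    "Prod V a b \<in> Ob V"
  using Prod_product[OF assms] Dom_Ob[of "Pr1 V a b"] by (auto simp: is_product_def)

lemma pair_simps [simp]:
  assumes "f \<in> Ar V" "g \<in> Ar V" "Dom V g = Dom V f"
  shows "pair V f g \<in> Ar V" "Dom V (pair V f g) = Dom V f"
    "Cod V (pair V f g) = Prod V (Cod V f) (Cod V g)" (is ?T1)
    "a = Cod V f \<Longrightarrow> b = Cod V g \<Longrightarrow> Pr1 V a b \<cdot>\<^bsub>V\<^esub> pair V f g = f" (is "PROP ?T2")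
    "a = Cod V f \<Longrightarrow> b = Cod V g \<Longrightarrow> Pr2 V a b \<cdot>\<^bsub>V\<^esub> pair V f g = g" (is "PROP ?T3")
proof -
  have "\<exists>!h. h \<in> hom V (Dom V f) (Prod V (Cod V f) (Cod V g)) \<and>
     Pr1 V (Cod V f) (Cod V g) \<cdot>\<^bsub>V\<^esub> h = f \<and> Pr2 V (Cod V f) (Cod V g) \<cdot>\<^bsub>V\<^esub> h = g"
    using Prod_product[of "Cod V f" "Cod V g"] assms unfolding is_product_def by simp
  from theI'[OF this] show "pair V f g \<in> Ar V" "Dom V (pair V f g) = Dom V f"
    ?T1 "PROP ?T2" "PROP ?T3"
    unfolding pair_def by simp_all
qed

lemma prod_eqI:
  assumes "a \<in> Ob V" "b \<in> Ob V" "h \<in> hom V x (Prod V a b)" "h' \<in> hom V x (Prod V a b)"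
    and "Pr1 V a b \<cdot>\<^bsub>V\<^esub> h = Pr1 V a b \<cdot>\<^bsub>V\<^esub> h'" "Pr2 V a b \<cdot>\<^bsub>V\<^esub> h = Pr2 V a b \<cdot>\<^bsub>V\<^esub> h'"
  shows "h = h'"
proof -
  have "\<exists>!h. h \<in> hom V x (Prod V a b) \<and> Pr1 V a b \<cdot>\<^bsub>V\<^esub> h = k \<and> Pr2 V a b \<cdot>\<^bsub>V\<^esub> h = l"
    if "k \<in> hom V x a" "l \<in> hom V x b" for k l
    using Prod_product[OF assms(1,2)] that unfolding is_product_def by blast
  then have "\<exists>!k. k \<in> hom V x (Prod V a b) \<and> Pr1 V a b \<cdot>\<^bsub>V\<^esub> k = Pr1 V a b \<cdot>\<^bsub>V\<^esub> h \<and>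
      Pr2 V a b \<cdot>\<^bsub>V\<^esub> k = Pr2 V a b \<cdot>\<^bsub>V\<^esub> h"
    using assms(1-4) by simp
  then show ?thesis using assms(3-) by metis
qed

lemma pair_Comp [simp]:
  assumes "f \<in> Ar V" "g \<in> Ar V" "Dom V g = Dom V f" "h \<in> Ar V" "Cod V h = Dom V f"
  shows "pair V f g \<cdot>\<^bsub>V\<^esub> h = pair V (f \<cdot>\<^bsub>V\<^esub> h) (g \<cdot>\<^bsub>V\<^esub> h)"
  by (rule prod_eqI[of "Cod V f" "Cod V g" _ "Dom V h"])
    (use assms in \<open>simp_all flip: Comp_assoc_simp\<close>)

lemma pair_Pr [simp]:
  "a \<in> Ob V \<Longrightarrow> b \<in> Ob V \<Longrightarrow> pair V (Pr1 V a b) (Pr2 V a b) = Ident V (Prod V a b)"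
  by (rule prod_eqI[of a b _ "Prod V a b"]) simp_all

lemma pair_eta:
  assumes "a \<in> Ob V" "b \<in> Ob V" "h \<in> Ar V" "Cod V h = Prod V a b"
  shows "pair V (Pr1 V a b \<cdot>\<^bsub>V\<^esub> h) (Pr2 V a b \<cdot>\<^bsub>V\<^esub> h) = h"
  using assms by (simp flip: pair_Comp)

lemma prod_map_simps [simp]:
  assumes "f \<in> Ar V" "g \<in> Ar V"
  shows "prod_map V f g \<in> Ar V" "Dom V (prod_map V f g) = Prod V (Dom V f) (Dom V g)"
    "Cod V (prod_map V f g) = Prod V (Cod V f) (Cod V g)"
    "\<lbrakk>h \<in> Ar V; k \<in> Ar V; Dom V k = Dom V h; Cod V h = Dom V f; Cod V k = Dom V g\<rbrakk>
      \<Longrightarrow> prod_map V f g \<cdot>\<^bsub>V\<^esub> pair V h k = pair V (f \<cdot>\<^bsub>V\<^esub> h) (g \<cdot>\<^bsub>V\<^esub> k)"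
  using assms by (simp_all add: prod_map_def)

lemma prod_assoc_simps [simp]:
  assumes "a \<in> Ob V" "b \<in> Ob V" "c \<in> Ob V"
  shows "prod_assoc V a b c \<in> Ar V" "Dom V (prod_assoc V a b c) = Prod V (Prod V a b) c"
    "Cod V (prod_assoc V a b c) = Prod V a (Prod V b c)"
    "\<lbrakk>f \<in> Ar V; g \<in> Ar V; h \<in> Ar V; Dom V g = Dom V f; Dom V h = Dom V f; Cod V f = a; Cod V g = b;
      Cod V h = c\<rbrakk> \<Longrightarrow> prod_assoc V a b c \<cdot>\<^bsub>V\<^esub> pair V (pair V f g) h = pair V f (pair V g h)"
  using assms by (simp_all add: prod_assoc_def)

end

section \<open>Small coproducts and distributivity\<close>

lemma is_coproduct_cong:
  assumes "\<And>i. i \<in> I \<Longrightarrow> F i = G i" "\<And>i. i \<in> I \<Longrightarrow> \<iota> i = \<kappa> i"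
  shows "is_coproduct C I F c \<iota> \<longleftrightarrow> is_coproduct C I G c \<kappa>"
  using assms by (simp add: is_coproduct_def)

text \<open>\<open>coproduct_of\<close> selects a coproduct of the restricted family; the universal
  property never looks outside \<open>I\<close>, so the selected cocone serves \<open>F\<close>
  itself.\<close>

lemma is_coproduct_restrict [simp]:
  "is_coproduct C I (restrict F I) c \<iota> \<longleftrightarrow> is_coproduct C I F c \<iota>"
  by (rule is_coproduct_cong) simp_all

lemma is_coproduct_ex1:
  assumes "is_coproduct C I F c \<iota>" "x \<in> Ob C" "\<And>i. i \<in> I \<Longrightarrow> f i \<in> hom C (F i) x"
  shows "\<exists>!h. h \<in> hom C c x \<and> (\<forall>i \<in> I. h \<cdot>\<^bsub>C\<^esub> \<iota> i = f i)"
  using assms unfolding is_coproduct_def by blast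

text \<open>Cocones are transported along \<open>h\<close> and its inverse. This bridges the gap
  between the hypotheses, which quantify over members of \<open>U\<close>, and sums indexed by sets
  of another type.\<close>

lemma is_coproduct_reindex:
  assumes h: "bij_betw h X I"
  shows "is_coproduct C X (\<lambda>x. F (h x)) c (\<lambda>x. \<iota> (h x)) \<longleftrightarrow> is_coproduct C I F c \<iota>"
proof -
  have I: "I = h ` X" and inv: "\<And>x. x \<in> X \<Longrightarrow> inv_into X h (h x) = x"
    using h by (auto simp: bij_betw_def inv_into_f_f)
  show ?thesis
  proof
    assume L: "is_coproduct C X (\<lambda>x. F (h x)) c (\<lambda>x. \<iota> (h x))"
    show "is_coproduct C I F c \<iota>"
      unfolding is_coproduct_def
    proof (intro conjI ballI allI impI)
      show "c \<in> Ob C" "\<And>i. i \<in> I \<Longrightarrow> \<iota> i \<in> hom C (F i) c"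
        using L by (auto simp: is_coproduct_def I)
      fix x f assume x: "x \<in> Ob C" "\<forall>i\<in>I. f i \<in> hom C (F i) x"
      then have "\<forall>i\<in>X. f (h i) \<in> hom C (F (h i)) x" by (auto simp: I)
      then have "\<exists>!k. k \<in> hom C c x \<and> (\<forall>i\<in>X. k \<cdot>\<^bsub>C\<^esub> \<iota> (h i) = f (h i))"
        by (intro is_coproduct_ex1[OF L x(1)]) blast
      then show "\<exists>!k. k \<in> hom C c x \<and> (\<forall>i\<in>I. k \<cdot>\<^bsub>C\<^esub> \<iota> i = f i)"
        by (simp add: I)
    qed
  next
    assume R: "is_coproduct C I F c \<iota>"
    show "is_coproduct C X (\<lambda>x. F (h x)) c (\<lambda>x. \<iota> (h x))"
      unfolding is_coproduct_def
    proof (intro conjI ballI allI impI)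
      show "c \<in> Ob C" "\<And>i. i \<in> X \<Longrightarrow> \<iota> (h i) \<in> hom C (F (h i)) c"
        using R by (auto simp: is_coproduct_def I)
      fix x f assume x: "x \<in> Ob C" "\<forall>i\<in>X. f i \<in> hom C (F (h i)) x"
      then have "\<forall>i\<in>I. f (inv_into X h i) \<in> hom C (F i) x" by (auto simp: I inv)
      then have "\<exists>!k. k \<in> hom C c x \<and> (\<forall>i\<in>I. k \<cdot>\<^bsub>C\<^esub> \<iota> i = f (inv_into X h i))"
        by (intro is_coproduct_ex1[OF R x(1)]) blast
      then show "\<exists>!k. k \<in> hom C c x \<and> (\<forall>i\<in>X. k \<cdot>\<^bsub>C\<^esub> \<iota> (h i) = f i)"
        by (simp add: I inv)
    qed
  qed
qed

locale distributive_category = cartesian_monoidal_category V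
  for V :: "('o, 'a, 'z) cartesian_category_scheme" (structure) +
  fixes U :: "'u set set"
  assumes universe: "small_universe U"
    and distrib: "distributive U V"
begin

definition small :: "'i set \<Rightarrow> bool" where
  "small I \<longleftrightarrow> (\<exists>X \<in> U. X \<approx> I)"

lemma small_U [simp]: "X \<in> U \<Longrightarrow> small X"
  by (auto simp: small_def)

text \<open>A product is the disjoint union of a constant family, so closure of \<open>U\<close>
  under disjoint unions applies.\<close>

lemma small_Times [simp]: "X \<in> U \<Longrightarrow> Y \<in> U \<Longrightarrow> small (X \<times> Y)"
  using universe unfolding small_universe_def small_def
  by (elim conjE ballE[of _ _ X] allE[of _ "\<lambda>_. Y"]) auto

lemma small_bracket [simp]: "small (bracket P)"
proof -
  have "{} \<in> U" "{undefined} \<in> U" using universe by (auto simp: small_universe_def)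
  moreover have "{undefined :: 'u} \<approx> {()}" by (rule singleton_eqpoll)
  ultimately show ?thesis by (auto simp: small_def bracket_def)
qed

lemma small_bij:
  assumes "small I" obtains X h where "X \<in> U" "bij_betw h X I"
  using assms by (auto simp: small_def eqpoll_def)

lemma is_coproduct_coprod:
  assumes "small I" "\<And>i. i \<in> I \<Longrightarrow> F i \<in> Ob V"
  shows "is_coproduct V I F (coprod V I F) (inj_at V I F)"
proof -
  obtain X h where X: "X \<in> U" and h: "bij_betw h X I" using assms(1) by (rule small_bij)
  then have "(\<lambda>x. F (h x)) ` X \<subseteq> Ob V" using assms(2) by (auto simp: bij_betw_def)
  then obtain c \<iota> where "is_coproduct V X (\<lambda>x. F (h x)) c \<iota>"
    using distrib X unfolding distributive_def has_small_coproducts_def by blast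
  \<comment> \<open>The injections are rewritten as a family that factors through \<open>h\<close>,
    the shape required for reindexing.\<close>
  then have "is_coproduct V X (\<lambda>x. F (h x)) c (\<lambda>x. \<iota> (inv_into X h (h x)))"
    using h by (simp add: bij_betw_def inv_into_f_f cong: is_coproduct_cong)
  then have "is_coproduct V I F c (\<lambda>i. \<iota> (inv_into X h i))"
    using is_coproduct_reindex[OF h, of V F c "\<lambda>i. \<iota> (inv_into X h i)"] by simp
  then have "is_coproduct V I (restrict F I) (fst (c, \<lambda>i. \<iota> (inv_into X h i))) (snd (c, \<lambda>i. \<iota> (inv_into X h i)))"
    by simp
  then have "\<exists>k. is_coproduct V I (restrict F I) (fst k) (snd k)"
    by (rule exI)
  then have "is_coproduct V I (restrict F I) (coprod V I F) (inj_at V I F)"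
    unfolding coprod_def inj_at_def coproduct_of_def by (rule someI_ex)
  then show ?thesis by simp
qed

text \<open>Distributivity is assumed over index sets in \<open>U\<close>; conjugating with a
  bijection extends it to every small index set.\<close>

lemma is_coproduct_prod:
  assumes "small I" "is_coproduct V I F c \<iota>" "a \<in> Ob V"
  shows "is_coproduct V I (\<lambda>i. Prod V a (F i)) (Prod V a c) (\<lambda>i. prod_map V (Ident V a) (\<iota> i))" (is ?T1)
    "is_coproduct V I (\<lambda>i. Prod V (F i) a) (Prod V c a) (\<lambda>i. prod_map V (\<iota> i) (Ident V a))" (is ?T2)
proof -
  obtain X h where X: "X \<in> U" and h: "bij_betw h X I" using assms(1) by (rule small_bij)
  have "is_coproduct V X (\<lambda>x. F (h x)) c (\<lambda>x. \<iota> (h x))"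
    using assms(2) by (simp add: is_coproduct_reindex[OF h])
  then have *: "is_coproduct V X (\<lambda>x. Prod V a (F (h x))) (Prod V a c) (\<lambda>x. prod_map V (Ident V a) (\<iota> (h x)))"
    "is_coproduct V X (\<lambda>x. Prod V (F (h x)) a) (Prod V c a) (\<lambda>x. prod_map V (\<iota> (h x)) (Ident V a))"
    using distrib X assms(3) unfolding distributive_def by (simp_all del: small_U)
  show ?T1 ?T2
    using * is_coproduct_reindex[OF h, of V "\<lambda>i. Prod V a (F i)" _ "\<lambda>i. prod_map V (Ident V a) (\<iota> i)"]
      is_coproduct_reindex[OF h, of V "\<lambda>i. Prod V (F i) a" _ "\<lambda>i. prod_map V (\<iota> i) (Ident V a)"]
    by simp_all
qed

context
  fixes I :: "'i set" and F
  assumes small: "small I" and F: "\<And>i. i \<in> I \<Longrightarrow> F i \<in> Ob V"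
begin

lemma coprod_Ob: "coprod V I F \<in> Ob V"
  and inj_at_simps: "i \<in> I \<Longrightarrow> inj_at V I F i \<in> Ar V" "i \<in> I \<Longrightarrow> Dom V (inj_at V I F i) = F i"
    "i \<in> I \<Longrightarrow> Cod V (inj_at V I F i) = coprod V I F"
  using is_coproduct_coprod[OF small F] by (simp_all add: is_coproduct_def)

lemma copair_simps:
  assumes "x \<in> Ob V" "\<And>i. i \<in> I \<Longrightarrow> f i \<in> hom V (F i) x"
  shows "copair V I F x f \<in> Ar V" "Dom V (copair V I F x f) = coprod V I F" (is ?T1)
    "Cod V (copair V I F x f) = x"
    "i \<in> I \<Longrightarrow> copair V I F x f \<cdot> inj_at V I F i = f i" (is "PROP ?T2")
proof -
  have "\<exists>!h. h \<in> hom V (coprod V I F) x \<and> (\<forall>i \<in> I. h \<cdot> inj_at V I F i = f i)"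
    by (rule is_coproduct_ex1[OF is_coproduct_coprod[OF small F] assms])
  from theI'[OF this] show "copair V I F x f \<in> Ar V" ?T1
    "Cod V (copair V I F x f) = x" "PROP ?T2"
    by (simp_all add: copair_def)
qed

end

lemma is_coproduct_ext:
  assumes "is_coproduct V I F c \<iota>" "g \<in> hom V c x" "h \<in> hom V c x"
    and "\<And>i. i \<in> I \<Longrightarrow> g \<cdot> \<iota> i = h \<cdot> \<iota> i"
  shows "g = h"
proof -
  have "x \<in> Ob V" using assms(2) by auto
  moreover have "g \<cdot> \<iota> i \<in> hom V (F i) x" if "i \<in> I" for i
    using assms(1,2) that by (simp add: is_coproduct_def)
  ultimately have "\<exists>!k. k \<in> hom V c x \<and> (\<forall>i\<in>I. k \<cdot> \<iota> i = g \<cdot> \<iota> i)"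
    by (rule is_coproduct_ex1[OF assms(1)])
  then show ?thesis using assms(2-4) by (metis (no_types, lifting))
qed

lemmas coprod_ext = is_coproduct_ext[OF is_coproduct_coprod]

text \<open>By distributivity the products of the injections with the identity of \<open>b\<close>
  are the injections of a coproduct, hence jointly epimorphic. Each of them is itself an admissible
  pair, obtained by taking the two projections for \<open>k\<close> and \<open>l\<close>.\<close>

lemma prod_coprod_ext:
  assumes "small I" "\<And>i. i \<in> I \<Longrightarrow> F i \<in> Ob V" "b \<in> Ob V"
    and "g \<in> hom V (Prod V (coprod V I F) b) c" "h \<in> hom V (Prod V (coprod V I F) b) c"
    and eq: "\<And>i k l. \<lbrakk>i \<in> I; k \<in> Ar V; l \<in> Ar V; Cod V k = F i; Cod V l = b; Dom V l = Dom V k\<rbrakk>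
      \<Longrightarrow> g \<cdot> pair V (inj_at V I F i \<cdot> k) l = h \<cdot> pair V (inj_at V I F i \<cdot> k) l"
  shows "g = h"
  using is_coproduct_prod(2)[OF assms(1) is_coproduct_coprod[OF assms(1,2)] assms(3)] assms(4,5)
proof (rule is_coproduct_ext)
  fix i assume i: "i \<in> I"
  have "prod_map V (inj_at V I F i) (Ident V b) =
      pair V (inj_at V I F i \<cdot> Pr1 V (F i) b) (Pr2 V (F i) b)"
    using i assms(1-3) by (simp add: prod_map_def inj_at_simps)
  then show "g \<cdot> prod_map V (inj_at V I F i) (Ident V b) = h \<cdot> prod_map V (inj_at V I F i) (Ident V b)"
    using eq[OF i, of "Pr1 V (F i) b" "Pr2 V (F i) b"] i assms(1-3) by simp
qed

lemma prod_coprod_ext':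
  assumes "small I" "\<And>i. i \<in> I \<Longrightarrow> F i \<in> Ob V" "b \<in> Ob V"
    and "g \<in> hom V (Prod V b (coprod V I F)) c" "h \<in> hom V (Prod V b (coprod V I F)) c"
    and eq: "\<And>i k l. \<lbrakk>i \<in> I; k \<in> Ar V; l \<in> Ar V; Cod V k = F i; Cod V l = b; Dom V l = Dom V k\<rbrakk>
      \<Longrightarrow> g \<cdot> pair V l (inj_at V I F i \<cdot> k) = h \<cdot> pair V l (inj_at V I F i \<cdot> k)"
  shows "g = h"
  using is_coproduct_prod(1)[OF assms(1) is_coproduct_coprod[OF assms(1,2)] assms(3)] assms(4,5)
proof (rule is_coproduct_ext)
  fix i assume i: "i \<in> I"
  have "prod_map V (Ident V b) (inj_at V I F i) =
      pair V (Pr1 V b (F i)) (inj_at V I F i \<cdot> Pr2 V b (F i))"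
    using i assms(1-3) by (simp add: prod_map_def inj_at_simps)
  then show "g \<cdot> prod_map V (Ident V b) (inj_at V I F i) = h \<cdot> prod_map V (Ident V b) (inj_at V I F i)"
    using eq[OF i, of "Pr2 V b (F i)" "Pr1 V b (F i)"] i assms(1-3) by simp
qed


section \<open>Copowers of the terminal object\<close>

lemma star_simps [simp]:
  assumes "small X"
  shows "star V X \<in> Ob V" "x \<in> X \<Longrightarrow> star_inj V X x \<in> Ar V" "x \<in> X \<Longrightarrow> Dom V (star_inj V X x) = One V"
    "x \<in> X \<Longrightarrow> Cod V (star_inj V X x) = star V X"
  using coprod_Ob[of X "\<lambda>_. One V"] inj_at_simps[of X "\<lambda>_. One V"] assms
  by (simp_all add: star_def star_inj_def)

lemma star_copair_simps [simp]:
  assumes "small X" "a \<in> Ob V" "\<And>x. x \<in> X \<Longrightarrow> f x \<in> hom V (One V) a"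
  shows "star_copair V X a f \<in> Ar V" "Dom V (star_copair V X a f) = star V X"
    "Cod V (star_copair V X a f) = a" "x \<in> X \<Longrightarrow> star_copair V X a f \<cdot> star_inj V X x = f x"
  using copair_simps[of X "\<lambda>_. One V" a f] assms
  by (simp_all add: star_def star_inj_def star_copair_def)

lemma star_ext:
  assumes "small X" "g \<in> hom V (star V X) a" "h \<in> hom V (star V X) a"
    and "\<And>x. x \<in> X \<Longrightarrow> g \<cdot> star_inj V X x = h \<cdot> star_inj V X x"
  shows "g = h"
  using coprod_ext[of X "\<lambda>_. One V" g a h] assms by (simp add: star_def star_inj_def)

lemma star_map_simps [simp]:
  assumes "small X" "small Y" "\<And>x. x \<in> X \<Longrightarrow> f x \<in> Y"
  shows "star_map V X Y f \<in> Ar V" "Dom V (star_map V X Y f) = star V X"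
    "Cod V (star_map V X Y f) = star V Y"
    "x \<in> X \<Longrightarrow> star_map V X Y f \<cdot> star_inj V X x = star_inj V Y (f x)"
    "\<lbrakk>x \<in> X; k \<in> Ar V; Cod V k = One V\<rbrakk>
      \<Longrightarrow> star_map V X Y f \<cdot> star_inj V X x \<cdot> k = star_inj V Y (f x) \<cdot> k"
  using assms Comp_reassoc[of "star_map V X Y f" "star_inj V X x" "star_inj V Y (f x)" k]
  by (simp_all add: star_map_def)

text \<open>The product of the empty copower with \<open>x\<close> is an empty sum by
  distributivity, so the composites of \<open>f\<close> and \<open>g\<close> with the second
  projection agree. The arrow \<open>u\<close> makes that projection split: it is followed back
  along the pair of \<open>u\<close> and the identity.\<close>

lemma star_bracket_False_strict:
  assumes "u \<in> hom V x (star V (bracket False))" "f \<in> hom V x y" "g \<in> hom V x y"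
  shows "f = g"
proof -
  have x [simp]: "x \<in> Ob V" using assms(2) by auto
  let ?s = "star V (bracket False)"
  have no: "i \<notin> bracket False" for i by (simp add: bracket_def)
  have "f \<cdot> Pr2 V ?s x = g \<cdot> Pr2 V ?s x"
    unfolding star_def
    by (rule prod_coprod_ext[where I = "bracket False" and F = "\<lambda>_. One V" and b = x and c = y])
      (use assms no in \<open>auto simp flip: star_def\<close>)
  then have "(f \<cdot> Pr2 V ?s x) \<cdot> pair V u (Ident V x) = (g \<cdot> Pr2 V ?s x) \<cdot> pair V u (Ident V x)"
    by simp
  then show ?thesis using assms by simp
qed

text \<open>These copowers are subterminal: a copy of the terminal object if \<open>P\<close> holds,
  and strictly initial otherwise.\<close>

lemma star_bracket_unique:
  assumes u: "u \<in> hom V x (star V (bracket P))" and v: "v \<in> hom V x (star V (bracket P))"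
  shows "u = v"
proof (cases P)
  case True
  let ?s = "star V (bracket True)"
  have [simp]: "() \<in> bracket True" by (simp add: bracket_def)
  have id: "star_inj V (bracket True) () \<cdot> to_one V ?s = Ident V ?s"
    by (rule star_ext[of "bracket True" _ ?s]) simp_all
  have *: "k = star_inj V (bracket True) () \<cdot> to_one V x" if "k \<in> hom V x ?s" for k
    using that arg_cong[OF id, of "\<lambda>m. m \<cdot> k"] by simp
  show ?thesis using *[of u] *[of v] u v True by simp
next
  case False
  then show ?thesis using star_bracket_False_strict[of u x u "star V (bracket P)" v] u v by simp
qed

lemma bracket_True [simp]: "() \<in> bracket True"
  by (simp add: bracket_def)

text \<open>Serves to restore a component that a unitor or the unit comparison has discarded: on the
  diagonal there was only one possibility.\<close>

lemma bracket_True_element: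
  assumes "u \<in> Ar V" "Cod V u = star V (bracket True)"
  shows "star_inj V (bracket True) () \<cdot> to_one V (Dom V u) = u"
  by (rule star_bracket_unique[of _ "Dom V u" True]) (use assms in simp_all)

end


section \<open>Matrices\<close>

lemma set_cat_simps [simp]:
  "Ob (set_cat U) = U" "Dom (set_cat U) = fn_dom" "Cod (set_cat U) = fn_cod"
  "Ident (set_cat U) X = Fn X X (\<lambda>x\<in>X. x)"
  "Comp (set_cat U) g f = Fn (fn_dom f) (fn_cod g) (compose (fn_dom f) (fn_app g) (fn_app f))"
  by (simp_all add: set_cat_def)

lemma set_cat_Ar [simp]:
  "f \<in> Ar (set_cat U) \<longleftrightarrow> fn_dom f \<in> U \<and> fn_cod f \<in> U \<and> fn_app f \<in> fn_dom f \<rightarrow>\<^sub>E fn_cod f"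
  by (cases f) (auto simp: set_cat_def)

lemma category_set_cat: "category (set_cat U)"
proof
  fix f g h w x y z
  assume "f \<in> hom (set_cat U) w x" "g \<in> hom (set_cat U) x y" "h \<in> hom (set_cat U) y z"
  then show "(h \<cdot>\<^bsub>set_cat U\<^esub> g) \<cdot>\<^bsub>set_cat U\<^esub> f = h \<cdot>\<^bsub>set_cat U\<^esub> (g \<cdot>\<^bsub>set_cat U\<^esub> f)"
    by (auto simp: compose_def fun_eq_iff PiE_iff restrict_def)
next
  fix f x y assume "f \<in> hom (set_cat U) x y"
  then show "f \<cdot>\<^bsub>set_cat U\<^esub> Ident (set_cat U) x = f" "Ident (set_cat U) y \<cdot>\<^bsub>set_cat U\<^esub> f = f"
    by (cases f; auto simp: compose_def fun_eq_iff PiE_iff extensional_def restrict_def)+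
qed (auto simp: compose_def PiE_iff)

lemma matrix_cells_simps [simp]:
  "Dom (matrix_cells U V) = mc_src" "Cod (matrix_cells U V) = mc_tgt"
  by (simp_all add: matrix_cells_def)

lemma matrix_Ident_simps [simp]:
  "mc_src (Ident (matrix_cells U V) p) = p" "mc_tgt (Ident (matrix_cells U V) p) = p"
  "mc_left (Ident (matrix_cells U V) p) = (\<lambda>x\<in>m_dom p. x)"
  "mc_right (Ident (matrix_cells U V) p) = (\<lambda>y\<in>m_cod p. y)"
  "\<lbrakk>x \<in> m_dom p; y \<in> m_cod p\<rbrakk> \<Longrightarrow> mc_entry (Ident (matrix_cells U V) p) (x, y) = Ident V (entry p (x, y))"
  by (simp_all add: matrix_cells_def)

lemma matrix_Comp_simps [simp]:
  "mc_src (\<psi> \<cdot>\<^bsub>matrix_cells U V\<^esub> \<phi>) = mc_src \<phi>" "mc_tgt (\<psi> \<cdot>\<^bsub>matrix_cells U V\<^esub> \<phi>) = mc_tgt \<psi>"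
  "mc_left (\<psi> \<cdot>\<^bsub>matrix_cells U V\<^esub> \<phi>) = compose (m_dom (mc_src \<phi>)) (mc_left \<psi>) (mc_left \<phi>)"
  "mc_right (\<psi> \<cdot>\<^bsub>matrix_cells U V\<^esub> \<phi>) = compose (m_cod (mc_src \<phi>)) (mc_right \<psi>) (mc_right \<phi>)"
  "\<lbrakk>x \<in> m_dom (mc_src \<phi>); y \<in> m_cod (mc_src \<phi>)\<rbrakk> \<Longrightarrow>
    mc_entry (\<psi> \<cdot>\<^bsub>matrix_cells U V\<^esub> \<phi>) (x, y) =
      mc_entry \<psi> (mc_left \<phi> x, mc_right \<phi> y) \<cdot>\<^bsub>V\<^esub> mc_entry \<phi> (x, y)"
  by (simp_all add: matrix_cells_def Let_def)

lemma matrix_cells_Ob_iff: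
  "p \<in> Ob (matrix_cells U V) \<longleftrightarrow>
    m_dom p \<in> U \<and> m_cod p \<in> U \<and> entry p \<in> m_dom p \<times> m_cod p \<rightarrow>\<^sub>E Ob V"
  by (cases p) (auto simp: matrix_cells_def)

lemma matrix_cells_Ar_iff:
  "\<phi> \<in> Ar (matrix_cells U V) \<longleftrightarrow>
    mc_src \<phi> \<in> Ob (matrix_cells U V) \<and> mc_tgt \<phi> \<in> Ob (matrix_cells U V) \<and>
    mc_left \<phi> \<in> m_dom (mc_src \<phi>) \<rightarrow>\<^sub>E m_dom (mc_tgt \<phi>) \<and>
    mc_right \<phi> \<in> m_cod (mc_src \<phi>) \<rightarrow>\<^sub>E m_cod (mc_tgt \<phi>) \<and>
    mc_entry \<phi> \<in> extensional (m_dom (mc_src \<phi>) \<times> m_cod (mc_src \<phi>)) \<and>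
    (\<forall>x \<in> m_dom (mc_src \<phi>). \<forall>y \<in> m_cod (mc_src \<phi>).
      mc_entry \<phi> (x, y) \<in> hom V (entry (mc_src \<phi>) (x, y)) (entry (mc_tgt \<phi>) (mc_left \<phi> x, mc_right \<phi> y)))"
proof (cases \<phi>)
  case (MatrixCell p q f g k)
  show ?thesis
    by (cases p; cases q)
      (auto simp: MatrixCell matrix_cells_def PiE_iff simp del: mem_hom)
qed

lemma matrix_ObD [simp]:
  assumes "p \<in> Ob (matrix_cells U V)"
  shows "m_dom p \<in> U" "m_cod p \<in> U"
    "x \<in> m_dom p \<Longrightarrow> y \<in> m_cod p \<Longrightarrow> entry p (x, y) \<in> Ob V"
  using assms by (auto simp: matrix_cells_Ob_iff)

lemma matrix_cells_ArD [simp]: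
  assumes "\<phi> \<in> Ar (matrix_cells U V)"
  shows "mc_src \<phi> \<in> Ob (matrix_cells U V)" "mc_tgt \<phi> \<in> Ob (matrix_cells U V)"
    "x \<in> m_dom (mc_src \<phi>) \<Longrightarrow> mc_left \<phi> x \<in> m_dom (mc_tgt \<phi>)"
    "y \<in> m_cod (mc_src \<phi>) \<Longrightarrow> mc_right \<phi> y \<in> m_cod (mc_tgt \<phi>)"
    "\<lbrakk>x \<in> m_dom (mc_src \<phi>); y \<in> m_cod (mc_src \<phi>)\<rbrakk> \<Longrightarrow> mc_entry \<phi> (x, y) \<in> Ar V"
    "\<lbrakk>x \<in> m_dom (mc_src \<phi>); y \<in> m_cod (mc_src \<phi>)\<rbrakk>
      \<Longrightarrow> Dom V (mc_entry \<phi> (x, y)) = entry (mc_src \<phi>) (x, y)"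
    "\<lbrakk>x \<in> m_dom (mc_src \<phi>); y \<in> m_cod (mc_src \<phi>)\<rbrakk>
      \<Longrightarrow> Cod V (mc_entry \<phi> (x, y)) = entry (mc_tgt \<phi>) (mc_left \<phi> x, mc_right \<phi> y)"
  using assms by (auto simp: matrix_cells_Ar_iff)

lemma matrix_cells_Ar_funcset:
  assumes "\<phi> \<in> Ar (matrix_cells U V)"
  shows "mc_left \<phi> \<in> m_dom (mc_src \<phi>) \<rightarrow>\<^sub>E m_dom (mc_tgt \<phi>)"
    "mc_right \<phi> \<in> m_cod (mc_src \<phi>) \<rightarrow>\<^sub>E m_cod (mc_tgt \<phi>)"
  using assms unfolding matrix_cells_Ar_iff by blast+

lemma matrix_cells_ArI:
  assumes "p \<in> Ob (matrix_cells U V)" "q \<in> Ob (matrix_cells U V)"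
    and "f \<in> m_dom p \<rightarrow>\<^sub>E m_dom q" "g \<in> m_cod p \<rightarrow>\<^sub>E m_cod q"
    and "k \<in> extensional (m_dom p \<times> m_cod p)"
    and "\<And>x y. \<lbrakk>x \<in> m_dom p; y \<in> m_cod p\<rbrakk> \<Longrightarrow> k (x, y) \<in> hom V (entry p (x, y)) (entry q (f x, g y))"
  shows "MatrixCell p q f g k \<in> Ar (matrix_cells U V)"
  using assms by (simp add: matrix_cells_Ar_iff)

text \<open>Membership in \<open>Ar\<close> makes the component functions extensional, so their
  values on the index sets of the source decide equality.\<close>

lemma matrix_cell_eqI:
  assumes "\<phi> \<in> Ar (matrix_cells U V)" "\<psi> \<in> Ar (matrix_cells U V)"
    and "mc_src \<phi> = mc_src \<psi>" "mc_tgt \<phi> = mc_tgt \<psi>"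
    and "\<And>x. x \<in> m_dom (mc_src \<psi>) \<Longrightarrow> mc_left \<phi> x = mc_left \<psi> x"
    and "\<And>y. y \<in> m_cod (mc_src \<psi>) \<Longrightarrow> mc_right \<phi> y = mc_right \<psi> y"
    and "\<And>x y. \<lbrakk>x \<in> m_dom (mc_src \<psi>); y \<in> m_cod (mc_src \<psi>)\<rbrakk> \<Longrightarrow> mc_entry \<phi> (x, y) = mc_entry \<psi> (x, y)"
  shows "\<phi> = \<psi>"
proof (rule matrix_cell.expand, intro conjI)
  note * = assms(1,2)[unfolded matrix_cells_Ar_iff]
  show "mc_left \<phi> = mc_left \<psi>"
    by (rule PiE_ext[of _ "m_dom (mc_src \<psi>)" "\<lambda>_. m_dom (mc_tgt \<psi>)"]) (use * assms in auto)
  show "mc_right \<phi> = mc_right \<psi>"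
    by (rule PiE_ext[of _ "m_cod (mc_src \<psi>)" "\<lambda>_. m_cod (mc_tgt \<psi>)"]) (use * assms in auto)
  show "mc_entry \<phi> = mc_entry \<psi>"
    by (rule extensionalityI[of _ "m_dom (mc_src \<psi>) \<times> m_cod (mc_src \<psi>)"]) (use * assms in auto)
qed (use assms in simp_all)

context category
begin

abbreviation "cells U \<equiv> matrix_cells U C"

lemma matrix_Ident_Ar [simp]: "p \<in> Ob (cells U) \<Longrightarrow> Ident (cells U) p \<in> Ar (cells U)"
  by (auto simp: matrix_cells_Ar_iff) (auto simp: matrix_cells_def extensional_def)

lemma matrix_Comp_Ar [simp]:
  assumes "\<phi> \<in> Ar (cells U)" "\<psi> \<in> Ar (cells U)" "mc_src \<psi> = mc_tgt \<phi>"
  shows "\<psi> \<cdot>\<^bsub>cells U\<^esub> \<phi> \<in> Ar (cells U)"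
  using assms
  by (auto simp: matrix_cells_Ar_iff[of "\<psi> \<cdot>\<^bsub>cells U\<^esub> \<phi>"] compose_def)
    (auto simp: matrix_cells_def extensional_def Let_def)

lemma category_matrix_cells: "category (cells U)"
proof
  fix f x y assume "f \<in> hom (cells U) x y"
  then show "f \<cdot>\<^bsub>cells U\<^esub> Ident (cells U) x = f" "Ident (cells U) y \<cdot>\<^bsub>cells U\<^esub> f = f"
    by (auto intro!: matrix_cell_eqI[where U = U and V = C] simp: compose_def)
next
  fix f g h w x y z
  assume "f \<in> hom (cells U) w x" "g \<in> hom (cells U) x y" "h \<in> hom (cells U) y z"
  then show "(h \<cdot>\<^bsub>cells U\<^esub> g) \<cdot>\<^bsub>cells U\<^esub> f = h \<cdot>\<^bsub>cells U\<^esub> (g \<cdot>\<^bsub>cells U\<^esub> f)"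
    by (auto intro!: matrix_cell_eqI[where U = U and V = C] simp: compose_def)
qed auto

lemma mat_globular_simps [simp]:
  "mc_src (mat_globular p q k) = p" "mc_tgt (mat_globular p q k) = q"
  "mc_left (mat_globular p q k) = (\<lambda>x\<in>m_dom p. x)" "mc_right (mat_globular p q k) = (\<lambda>y\<in>m_cod p. y)"
  "x \<in> m_dom p \<Longrightarrow> y \<in> m_cod p \<Longrightarrow> mc_entry (mat_globular p q k) (x, y) = k (x, y)"
  by (simp_all add: mat_globular_def)

lemma mat_globular_Ar:
  assumes "p \<in> Ob (cells U)" "q \<in> Ob (cells U)" "m_dom q = m_dom p" "m_cod q = m_cod p"
    and "\<And>x y. \<lbrakk>x \<in> m_dom p; y \<in> m_cod p\<rbrakk> \<Longrightarrow> k (x, y) \<in> hom C (entry p (x, y)) (entry q (x, y))"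
  shows "mat_globular p q k \<in> Ar (cells U)"
  unfolding mat_globular_def using assms by (intro matrix_cells_ArI) auto

text \<open>Invertibility is an entrywise matter: chosen inverses of the entries assemble into a
  globular cell in the other direction.\<close>

lemma mat_globular_iso:
  assumes pq: "p \<in> Ob (cells U)" "q \<in> Ob (cells U)" "m_dom q = m_dom p" "m_cod q = m_cod p"
    and k: "\<And>x y. \<lbrakk>x \<in> m_dom p; y \<in> m_cod p\<rbrakk> \<Longrightarrow> k (x, y) \<in> hom C (entry p (x, y)) (entry q (x, y))"
    and l: "\<And>x y. \<lbrakk>x \<in> m_dom p; y \<in> m_cod p\<rbrakk> \<Longrightarrow> \<exists>l \<in> hom C (entry q (x, y)) (entry p (x, y)).
        l \<cdot>\<^bsub>C\<^esub> k (x, y) = Ident C (entry p (x, y)) \<and> k (x, y) \<cdot>\<^bsub>C\<^esub> l = Ident C (entry q (x, y))"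
  shows "iso (cells U) (mat_globular p q k)"
proof -
  obtain l where l: "\<And>x y. \<lbrakk>x \<in> m_dom p; y \<in> m_cod p\<rbrakk> \<Longrightarrow>
        l x y \<in> hom C (entry q (x, y)) (entry p (x, y)) \<and>
        l x y \<cdot>\<^bsub>C\<^esub> k (x, y) = Ident C (entry p (x, y)) \<and> k (x, y) \<cdot>\<^bsub>C\<^esub> l x y = Ident C (entry q (x, y))"
    using l by metis
  let ?k = "mat_globular p q k" and ?l = "mat_globular q p (\<lambda>(x, y). l x y)"
  have [simp]: "?k \<in> Ar (cells U)" "?l \<in> Ar (cells U)"
    using pq k l by (auto intro!: mat_globular_Ar)
  show ?thesis
  proof (rule category.isoI[OF category_matrix_cells, where g = ?l])
    show "?l \<cdot>\<^bsub>cells U\<^esub> ?k = Ident (cells U) p" "?k \<cdot>\<^bsub>cells U\<^esub> ?l = Ident (cells U) q"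
      using pq l by (auto intro!: matrix_cell_eqI[where U = U and V = C] simp: compose_def)
  qed simp_all
qed

end

lemma mat_unit_simps [simp]:
  "m_dom (mat_unit V X) = X" "m_cod (mat_unit V X) = X"
  "\<lbrakk>x \<in> X; x' \<in> X\<rbrakk> \<Longrightarrow> entry (mat_unit V X) (x, x') = star V (bracket (x = x'))"
  by (simp_all add: mat_unit_def)

lemma mat_unit_cell_simps [simp]:
  "mc_src (mat_unit_cell V h) = mat_unit V (fn_dom h)" "mc_tgt (mat_unit_cell V h) = mat_unit V (fn_cod h)"
  "mc_left (mat_unit_cell V h) = fn_app h" "mc_right (mat_unit_cell V h) = fn_app h"
  by (simp_all add: mat_unit_cell_def Let_def)

lemma mat_comp_simps [simp]:
  "m_dom (mat_comp V q p) = m_dom p" "m_cod (mat_comp V q p) = m_cod q"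
  by (simp_all add: mat_comp_def)

lemma mat_comp_cell_simps [simp]:
  "mc_src (mat_comp_cell V \<psi> \<phi>) = mat_comp V (mc_src \<psi>) (mc_src \<phi>)"
  "mc_tgt (mat_comp_cell V \<psi> \<phi>) = mat_comp V (mc_tgt \<psi>) (mc_tgt \<phi>)"
  "mc_left (mat_comp_cell V \<psi> \<phi>) = mc_left \<phi>" "mc_right (mat_comp_cell V \<psi> \<phi>) = mc_right \<psi>"
  by (simp_all add: mat_comp_cell_def Let_def)

text \<open>The generalized element \<open>[b,a]\<close> of \<open>(q \<cdot> p)(x,z)\<close> in the summand of index \<open>y\<close>.\<close>

definition elt :: "('o, 'a, 'z) cartesian_category_scheme
    \<Rightarrow> ('u, 'o) matrix \<Rightarrow> ('u, 'o) matrix \<Rightarrow> 'u \<Rightarrow> 'u \<Rightarrow> 'u \<Rightarrow> 'a \<Rightarrow> 'a \<Rightarrow> 'a" where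
  "elt V q p x y z b a = comp_inj V q p x z y \<cdot>\<^bsub>V\<^esub> pair V b a"

section \<open>Units, composites and their generalized elements\<close>

context distributive_category
begin

abbreviation "M \<equiv> matrix_cells U V"

lemmas [simp] = matrix_ObD[where U = U and V = V] matrix_cells_ArD[where U = U and V = V]

lemma bracket_False [simp]: "u \<notin> bracket False"
  by (simp add: bracket_def)

lemma mat_unit_Ob [simp]: "X \<in> U \<Longrightarrow> mat_unit V X \<in> Ob M"
  by (auto simp: matrix_cells_Ob_iff mat_unit_def)

text \<open>A function preserves equality, so the bracket of \<open>x = x'\<close> is contained in
  the bracket of the images; this is what makes the entry a well-typed
  \<open>star_map\<close>.\<close>

lemma mat_unit_cell_entry [simp]:
  assumes "h \<in> Ar (set_cat U)" "x \<in> fn_dom h" "x' \<in> fn_dom h"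
  shows "mc_entry (mat_unit_cell V h) (x, x') \<in> Ar V" (is ?T1)
    "Dom V (mc_entry (mat_unit_cell V h) (x, x')) = star V (bracket (x = x'))" (is ?T2)
    "Cod V (mc_entry (mat_unit_cell V h) (x, x')) = star V (bracket (fn_app h x = fn_app h x'))" (is ?T3)
proof -
  have "u \<in> bracket (fn_app h x = fn_app h x')" if "u \<in> bracket (x = x')" for u
    using that by (cases "x = x'") simp_all
  then have "star_map V (bracket (x = x')) (bracket (fn_app h x = fn_app h x')) (\<lambda>u. u) \<in>
      hom V (star V (bracket (x = x'))) (star V (bracket (fn_app h x = fn_app h x')))"
    unfolding mem_hom by (intro conjI star_map_simps(1-3) small_bracket)
  then show ?T1 ?T2 ?T3
    using assms(2,3) by (simp_all add: mat_unit_cell_def Let_def)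
qed

lemma mat_unit_cell_Ar [simp]:
  assumes "h \<in> Ar (set_cat U)" shows "mat_unit_cell V h \<in> Ar M"
proof -
  have "fn_app h x \<in> fn_cod h" if "x \<in> fn_dom h" for x using assms that by auto
  then show ?thesis
    using assms mat_unit_cell_entry[OF assms]
    by (subst matrix_cells_Ar_iff) (auto simp: mat_unit_cell_def Let_def)
qed

lemma unit_entry_unique:
  assumes "u \<in> hom V a (entry (mat_unit V X) (x, x'))" "v \<in> hom V a (entry (mat_unit V X) (x, x'))"
    and "x \<in> X" "x' \<in> X"
  shows "u = v"
  using assms star_bracket_unique[of u a "x = x'" v] by simp

text \<open>Off the diagonal the unit entry is the empty copower, so the mere existence of
  \<open>u\<close> identifies parallel arrows out of \<open>a\<close>. Every coherence law involving
  units disposes of its remaining summands in this way.\<close>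

lemma unit_entry_strict:
  assumes "u \<in> hom V a (entry (mat_unit V X) (x, x'))" "x \<in> X" "x' \<in> X" "x \<noteq> x'"
    and "f \<in> hom V a b" "g \<in> hom V a b"
  shows "f = g"
  using assms star_bracket_False_strict[of u a f b g] by simp

lemma comp_family_Ob:
  assumes "q \<in> Ob M" "p \<in> Ob M" "m_dom q = m_cod p" "x \<in> m_dom p" "z \<in> m_cod q" "y \<in> m_cod p"
  shows "comp_family V q p x z y \<in> Ob V"
  using assms by (simp add: comp_family_def)

lemma entry_mat_comp:
  "x \<in> m_dom p \<Longrightarrow> z \<in> m_cod q \<Longrightarrow> entry (mat_comp V q p) (x, z) = coprod V (m_cod p) (comp_family V q p x z)"
  by (simp add: mat_comp_def)

lemma mat_comp_Ob [simp]:
  assumes "q \<in> Ob M" "p \<in> Ob M" "m_dom q = m_cod p"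
  shows "mat_comp V q p \<in> Ob M"
proof -
  have "coprod V (m_cod p) (comp_family V q p x z) \<in> Ob V" if "x \<in> m_dom p" "z \<in> m_cod q" for x z
    using assms that comp_family_Ob[OF assms that] by (intro coprod_Ob) simp_all
  then show ?thesis using assms by (subst matrix_cells_Ob_iff) (auto simp: mat_comp_def)
qed

context
  fixes q p x z
  assumes qp: "q \<in> Ob M" "p \<in> Ob M" "m_dom q = m_cod p" and xz: "x \<in> m_dom p" "z \<in> m_cod q"
begin

lemma comp_inj_simps [simp]:
  assumes "y \<in> m_cod p"
  shows "comp_inj V q p x z y \<in> Ar V"
    "Dom V (comp_inj V q p x z y) = Prod V (entry q (y, z)) (entry p (x, y))"
    "Cod V (comp_inj V q p x z y) = entry (mat_comp V q p) (x, z)"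
  using inj_at_simps[of "m_cod p" "comp_family V q p x z" y] comp_family_Ob[OF qp xz] qp xz assms
  by (simp_all add: comp_inj_def entry_mat_comp) (simp add: comp_family_def)

lemma elt_simps [simp]:
  assumes "y \<in> m_cod p" "b \<in> Ar V" "a \<in> Ar V" "Cod V b = entry q (y, z)" "Cod V a = entry p (x, y)"
    and "Dom V b = Dom V a"
  shows "elt V q p x y z b a \<in> Ar V" "Dom V (elt V q p x y z b a) = Dom V a"
    "Cod V (elt V q p x y z b a) = entry (mat_comp V q p) (x, z)"
    "\<lbrakk>k \<in> Ar V; Cod V k = Dom V a\<rbrakk> \<Longrightarrow> elt V q p x y z b a \<cdot> k = elt V q p x y z (b \<cdot> k) (a \<cdot> k)"
  using assms by (simp_all add: elt_def)

lemma comp_inj_eq_elt: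
  assumes "y \<in> m_cod p"
  shows "comp_inj V q p x z y =
    elt V q p x y z (Pr1 V (entry q (y, z)) (entry p (x, y))) (Pr2 V (entry q (y, z)) (entry p (x, y)))"
  using assms qp xz by (simp add: elt_def)

lemma comp_copair_simps [simp]:
  assumes "c \<in> Ob V"
    and f: "\<And>y. y \<in> m_cod p \<Longrightarrow> f y \<in> hom V (Prod V (entry q (y, z)) (entry p (x, y))) c"
  shows "comp_copair V q p x z c f \<in> Ar V"
    "Dom V (comp_copair V q p x z c f) = entry (mat_comp V q p) (x, z)"
    "Cod V (comp_copair V q p x z c f) = c"
    "\<lbrakk>y \<in> m_cod p; b \<in> Ar V; a \<in> Ar V; Cod V b = entry q (y, z); Cod V a = entry p (x, y); Dom V b = Dom V a\<rbrakk>
      \<Longrightarrow> comp_copair V q p x z c f \<cdot> elt V q p x y z b a = f y \<cdot> pair V b a"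
proof -
  have *: "comp_copair V q p x z c f \<in> Ar V"
    "Dom V (comp_copair V q p x z c f) = entry (mat_comp V q p) (x, z)"
    "Cod V (comp_copair V q p x z c f) = c"
    "y \<in> m_cod p \<Longrightarrow> comp_copair V q p x z c f \<cdot> comp_inj V q p x z y = f y" for y
    using copair_simps[of "m_cod p" "comp_family V q p x z" c f] comp_family_Ob[OF qp xz] qp xz assms
    by (simp_all add: comp_copair_def comp_inj_def entry_mat_comp) (simp_all add: comp_family_def)
  then show "comp_copair V q p x z c f \<in> Ar V"
    "Dom V (comp_copair V q p x z c f) = entry (mat_comp V q p) (x, z)"
    "Cod V (comp_copair V q p x z c f) = c"
    by simp_all
  show "comp_copair V q p x z c f \<cdot> elt V q p x y z b a = f y \<cdot> pair V b a"
    if "y \<in> m_cod p" "b \<in> Ar V" "a \<in> Ar V" "Cod V b = entry q (y, z)" "Cod V a = entry p (x, y)"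
      "Dom V b = Dom V a"
    using * that Comp_reassoc[OF *(4), of y "pair V b a"] by (simp add: elt_def)
qed

text \<open>With the two product projections as components, an element is an injection of the
  composite entry; testing on elements therefore covers the injections.\<close>

lemma comp_ext:
  assumes "g \<in> hom V (entry (mat_comp V q p) (x, z)) c" "h \<in> hom V (entry (mat_comp V q p) (x, z)) c"
    and eq: "\<And>y b a. \<lbrakk>y \<in> m_cod p; b \<in> Ar V; a \<in> Ar V; Cod V b = entry q (y, z); Cod V a = entry p (x, y);
      Dom V b = Dom V a\<rbrakk> \<Longrightarrow> g \<cdot> elt V q p x y z b a = h \<cdot> elt V q p x y z b a"
  shows "g = h"
proof (rule coprod_ext[of "m_cod p" "comp_family V q p x z"])
  fix y assume y: "y \<in> m_cod p"
  then show "g \<cdot> inj_at V (m_cod p) (comp_family V q p x z) y =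
      h \<cdot> inj_at V (m_cod p) (comp_family V q p x z) y"
    unfolding comp_inj_def[symmetric] comp_inj_eq_elt[OF y] using qp xz by (intro eq) simp_all
qed (use assms(1,2) qp xz comp_family_Ob[OF qp xz] in \<open>simp_all add: entry_mat_comp\<close>)

text \<open>The elements stay jointly epimorphic after multiplication with a side factor
  \<open>d\<close>; this is where distributivity is spent. It allows an inner composite to be opened
  while it is a component of an outer one.\<close>

lemma elt_left_ext:
  assumes "d \<in> Ob V" "g \<in> hom V (Prod V (entry (mat_comp V q p) (x, z)) d) c"
    "h \<in> hom V (Prod V (entry (mat_comp V q p) (x, z)) d) c"
    and eq: "\<And>y b a l. \<lbrakk>y \<in> m_cod p; b \<in> Ar V; a \<in> Ar V; l \<in> Ar V; Cod V b = entry q (y, z);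
      Cod V a = entry p (x, y); Cod V l = d; Dom V b = Dom V a; Dom V l = Dom V a\<rbrakk>
      \<Longrightarrow> g \<cdot> pair V (elt V q p x y z b a) l = h \<cdot> pair V (elt V q p x y z b a) l"
  shows "g = h"
proof (rule prod_coprod_ext[of "m_cod p" "comp_family V q p x z" d])
  fix y k l
  assume *: "y \<in> m_cod p" "k \<in> Ar V" "l \<in> Ar V" "Cod V k = comp_family V q p x z y" "Cod V l = d"
    "Dom V l = Dom V k"
  let ?p1 = "Pr1 V (entry q (y, z)) (entry p (x, y))" and ?p2 = "Pr2 V (entry q (y, z)) (entry p (x, y))"
    and ?j = "inj_at V (m_cod p) (comp_family V q p x z) y"
  have k: "pair V (?p1 \<cdot> k) (?p2 \<cdot> k) = k"
    using * qp xz by (intro pair_eta) (simp_all add: comp_family_def)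
  show "g \<cdot> pair V (?j \<cdot> k) l =
      h \<cdot> pair V (?j \<cdot> k) l"
    using eq[of y "?p1 \<cdot> k" "?p2 \<cdot> k" l]
      * qp xz unfolding comp_inj_def[symmetric] by (simp add: comp_family_def elt_def k)
qed (use assms(1-3) qp xz comp_family_Ob[OF qp xz] in \<open>simp_all add: entry_mat_comp\<close>)

lemma elt_right_ext:
  assumes "d \<in> Ob V" "g \<in> hom V (Prod V d (entry (mat_comp V q p) (x, z))) c"
    "h \<in> hom V (Prod V d (entry (mat_comp V q p) (x, z))) c"
    and eq: "\<And>y b a l. \<lbrakk>y \<in> m_cod p; b \<in> Ar V; a \<in> Ar V; l \<in> Ar V; Cod V b = entry q (y, z);
      Cod V a = entry p (x, y); Cod V l = d; Dom V b = Dom V a; Dom V l = Dom V a\<rbrakk>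
      \<Longrightarrow> g \<cdot> pair V l (elt V q p x y z b a) = h \<cdot> pair V l (elt V q p x y z b a)"
  shows "g = h"
proof (rule prod_coprod_ext'[of "m_cod p" "comp_family V q p x z" d])
  fix y k l
  assume *: "y \<in> m_cod p" "k \<in> Ar V" "l \<in> Ar V" "Cod V k = comp_family V q p x z y" "Cod V l = d"
    "Dom V l = Dom V k"
  let ?p1 = "Pr1 V (entry q (y, z)) (entry p (x, y))" and ?p2 = "Pr2 V (entry q (y, z)) (entry p (x, y))"
    and ?j = "inj_at V (m_cod p) (comp_family V q p x z) y"
  have k: "pair V (?p1 \<cdot> k) (?p2 \<cdot> k) = k"
    using * qp xz by (intro pair_eta) (simp_all add: comp_family_def)
  show "g \<cdot> pair V l (?j \<cdot> k) =
      h \<cdot> pair V l (?j \<cdot> k)"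
    using eq[of y "?p1 \<cdot> k" "?p2 \<cdot> k" l]
      * qp xz unfolding comp_inj_def[symmetric] by (simp add: comp_family_def elt_def k)
qed (use assms(1-3) qp xz comp_family_Ob[OF qp xz] in \<open>simp_all add: entry_mat_comp\<close>)

end

context
  fixes t s r w z
  assumes tsr: "t \<in> Ob M" "s \<in> Ob M" "r \<in> Ob M" "m_dom t = m_cod s" "m_dom s = m_cod r"
    and wz: "w \<in> m_dom r" "z \<in> m_cod t"
begin

text \<open>An arbitrary element \<open>k\<close> of \<open>(t \<cdot> s)(x,z)\<close> need not have
  the form \<open>[c,b]\<close>. The equation is therefore proved first for the universal pair of
  projections, whose domain is a product to which \<open>elt_left_ext\<close> applies, and then
  carried to \<open>k\<close> and \<open>a\<close> by precomposition.\<close>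

lemma comp3_ext:
  assumes "g \<in> hom V (entry (mat_comp V (mat_comp V t s) r) (w, z)) d"
    "h \<in> hom V (entry (mat_comp V (mat_comp V t s) r) (w, z)) d"
    and eq: "\<And>x y c b a. \<lbrakk>x \<in> m_cod r; y \<in> m_cod s; c \<in> Ar V; b \<in> Ar V; a \<in> Ar V;
      Cod V c = entry t (y, z); Cod V b = entry s (x, y); Cod V a = entry r (w, x);
      Dom V c = Dom V a; Dom V b = Dom V a\<rbrakk>
      \<Longrightarrow> g \<cdot> elt V (mat_comp V t s) r w x z (elt V t s x y z c b) a =
          h \<cdot> elt V (mat_comp V t s) r w x z (elt V t s x y z c b) a"
  shows "g = h"
proof (rule comp_ext[of "mat_comp V t s" r w z])
  note [simp] = tsr wz
  fix x k a
  assume [simp]: "x \<in> m_cod r" "k \<in> Ar V" "a \<in> Ar V" "Cod V k = entry (mat_comp V t s) (x, z)"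
    "Cod V a = entry r (w, x)" "Dom V k = Dom V a"
  note [simp] = assms(1,2)[simplified]
  let ?p1 = "Pr1 V (entry (mat_comp V t s) (x, z)) (entry r (w, x))"
    and ?p2 = "Pr2 V (entry (mat_comp V t s) (x, z)) (entry r (w, x))"
  have "g \<cdot> elt V (mat_comp V t s) r w x z ?p1 ?p2 = h \<cdot> elt V (mat_comp V t s) r w x z ?p1 ?p2"
    by (rule elt_left_ext[of t s x z "entry r (w, x)" _ d]) (simp_all add: eq)
  from arg_cong[OF this, of "\<lambda>m. m \<cdot> pair V k a"]
  show "g \<cdot> elt V (mat_comp V t s) r w x z k a = h \<cdot> elt V (mat_comp V t s) r w x z k a"
    by simp
qed (use assms(1,2) tsr wz in simp_all)

text \<open>The counterpart for the other bracketing, where the inner composite is the second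
  component. It is what verifies that the rebracketing backwards is inverse to the associator on the
  target side.\<close>

lemma comp3_ext':
  assumes "g \<in> hom V (entry (mat_comp V t (mat_comp V s r)) (w, z)) d"
    "h \<in> hom V (entry (mat_comp V t (mat_comp V s r)) (w, z)) d"
    and eq: "\<And>x y c b a. \<lbrakk>x \<in> m_cod r; y \<in> m_cod s; c \<in> Ar V; b \<in> Ar V; a \<in> Ar V;
      Cod V c = entry t (y, z); Cod V b = entry s (x, y); Cod V a = entry r (w, x);
      Dom V c = Dom V a; Dom V b = Dom V a\<rbrakk>
      \<Longrightarrow> g \<cdot> elt V t (mat_comp V s r) w y z c (elt V s r w x y b a) =
          h \<cdot> elt V t (mat_comp V s r) w y z c (elt V s r w x y b a)"
  shows "g = h"
proof (rule comp_ext[of t "mat_comp V s r" w z])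
  note [simp] = tsr wz
  fix y c k
  assume "y \<in> m_cod (mat_comp V s r)" and [simp]: "c \<in> Ar V" "k \<in> Ar V" "Cod V c = entry t (y, z)"
    "Cod V k = entry (mat_comp V s r) (w, y)" "Dom V c = Dom V k"
  then have [simp]: "y \<in> m_cod s" by simp
  note [simp] = assms(1,2)[simplified]
  let ?p1 = "Pr1 V (entry t (y, z)) (entry (mat_comp V s r) (w, y))"
    and ?p2 = "Pr2 V (entry t (y, z)) (entry (mat_comp V s r) (w, y))"
  have "g \<cdot> elt V t (mat_comp V s r) w y z ?p1 ?p2 = h \<cdot> elt V t (mat_comp V s r) w y z ?p1 ?p2"
    by (rule elt_right_ext[of s r w y "entry t (y, z)" _ d]) (simp_all add: eq)
  from arg_cong[OF this, of "\<lambda>m. m \<cdot> pair V c k"]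
  show "g \<cdot> elt V t (mat_comp V s r) w y z c k = h \<cdot> elt V t (mat_comp V s r) w y z c k"
    by simp
qed (use assms(1,2) tsr wz in simp_all)

end


text \<open>On elements the horizontal composite acts componentwise and moves the summand
  \<open>y\<close> to \<open>mc_right \<phi> y\<close>. The equality
  \<open>mc_left \<psi> = mc_right \<phi>\<close> makes the two images meet in that summand.\<close>

lemma mat_comp_cell_entry:
  assumes "\<psi> \<in> Ar M" "\<phi> \<in> Ar M" "mc_left \<psi> = mc_right \<phi>"
    and "m_dom (mc_src \<psi>) = m_cod (mc_src \<phi>)" "m_dom (mc_tgt \<psi>) = m_cod (mc_tgt \<phi>)"
    and "x \<in> m_dom (mc_src \<phi>)" "z \<in> m_cod (mc_src \<psi>)"
  shows "mc_entry (mat_comp_cell V \<psi> \<phi>) (x, z) \<in> hom V (entry (mat_comp V (mc_src \<psi>) (mc_src \<phi>)) (x, z))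
      (entry (mat_comp V (mc_tgt \<psi>) (mc_tgt \<phi>)) (mc_left \<phi> x, mc_right \<psi> z))" (is ?typ)
    and "\<lbrakk>q = mc_src \<psi>; p = mc_src \<phi>; y \<in> m_cod p; b \<in> Ar V; a \<in> Ar V; Cod V b = entry q (y, z);
        Cod V a = entry p (x, y); Dom V b = Dom V a\<rbrakk> \<Longrightarrow>
      mc_entry (mat_comp_cell V \<psi> \<phi>) (x, z) \<cdot> elt V q p x y z b a =
        elt V (mc_tgt \<psi>) (mc_tgt \<phi>) (mc_left \<phi> x) (mc_right \<phi> y) (mc_right \<psi> z)
          (mc_entry \<psi> (y, z) \<cdot> b) (mc_entry \<phi> (x, y) \<cdot> a)" (is "PROP ?elt")
proof -
  note [simp] = assms matrix_cells_ArD(3)[OF assms(1)] matrix_cells_ArD(4)[OF assms(1)]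
    matrix_cells_ArD(3)[OF assms(2)] matrix_cells_ArD(4)[OF assms(2)]
  have ent: "mc_entry (mat_comp_cell V \<psi> \<phi>) (x, z) =
      comp_copair V (mc_src \<psi>) (mc_src \<phi>) x z
        (entry (mat_comp V (mc_tgt \<psi>) (mc_tgt \<phi>)) (mc_left \<phi> x, mc_right \<psi> z))
        (\<lambda>y. comp_inj V (mc_tgt \<psi>) (mc_tgt \<phi>) (mc_left \<phi> x) (mc_right \<psi> z) (mc_right \<phi> y) \<cdot>
             prod_map V (mc_entry \<psi> (y, z)) (mc_entry \<phi> (x, y)))"
    by (simp add: mat_comp_cell_def Let_def)
  have ty: "comp_inj V (mc_tgt \<psi>) (mc_tgt \<phi>) (mc_left \<phi> x) (mc_right \<psi> z) (mc_right \<phi> y) \<cdot>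
             prod_map V (mc_entry \<psi> (y, z)) (mc_entry \<phi> (x, y)) \<in>
      hom V (Prod V (entry (mc_src \<psi>) (y, z)) (entry (mc_src \<phi>) (x, y)))
        (entry (mat_comp V (mc_tgt \<psi>) (mc_tgt \<phi>)) (mc_left \<phi> x, mc_right \<psi> z))"
    if "y \<in> m_cod (mc_src \<phi>)" for y
    using that by simp
  have c: "entry (mat_comp V (mc_tgt \<psi>) (mc_tgt \<phi>)) (mc_left \<phi> x, mc_right \<psi> z) \<in> Ob V"
    by simp
  show ?typ
    unfolding ent using comp_copair_simps(1-3)[OF _ _ _ _ _ c ty] by simp
  show "PROP ?elt"
  proof -
    assume *: "q = mc_src \<psi>" "p = mc_src \<phi>" "y \<in> m_cod p" "b \<in> Ar V" "a \<in> Ar V"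
      "Cod V b = entry q (y, z)" "Cod V a = entry p (x, y)" "Dom V b = Dom V a"
    then show "mc_entry (mat_comp_cell V \<psi> \<phi>) (x, z) \<cdot> elt V q p x y z b a =
        elt V (mc_tgt \<psi>) (mc_tgt \<phi>) (mc_left \<phi> x) (mc_right \<phi> y) (mc_right \<psi> z)
          (mc_entry \<psi> (y, z) \<cdot> b) (mc_entry \<phi> (x, y) \<cdot> a)"
      unfolding ent using comp_copair_simps(4)[OF _ _ _ _ _ c ty, of y b a] by (simp add: elt_def)
  qed
qed

lemma mat_comp_cell_Ar [simp]:
  assumes "\<psi> \<in> Ar M" "\<phi> \<in> Ar M" "mc_left \<psi> = mc_right \<phi>"
    and "m_dom (mc_src \<psi>) = m_cod (mc_src \<phi>)" "m_dom (mc_tgt \<psi>) = m_cod (mc_tgt \<phi>)"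
  shows "mat_comp_cell V \<psi> \<phi> \<in> Ar M"
proof (subst matrix_cells_Ar_iff, intro conjI ballI)
  show "mc_entry (mat_comp_cell V \<psi> \<phi>) \<in> extensional (m_dom (mc_src (mat_comp_cell V \<psi> \<phi>)) \<times>
      m_cod (mc_src (mat_comp_cell V \<psi> \<phi>)))"
    by (simp add: mat_comp_cell_def Let_def)
qed (use assms mat_comp_cell_entry(1)[OF assms] matrix_cells_Ar_funcset[OF assms(1)]
      matrix_cells_Ar_funcset[OF assms(2)] in simp_all)

lemmas mat_comp_cell_elt [simp] = mat_comp_cell_entry(2)

section \<open>Unitors and associator of matrices\<close>

lemma strict_the:
  assumes "u \<in> hom V w (star V (bracket False))" "a \<in> Ob V"
  shows "(THE f. f \<in> hom V w a) \<in> hom V w a"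
proof (rule theI')
  \<comment> \<open>Existence comes from \<open>u\<close> followed by a copairing over the empty
    index set, where the family \<open>undefined\<close> has no member to specify; uniqueness is
    strictness. Hence the definite descriptions in the unitors denote.\<close>
  have "star_copair V (bracket False) a undefined \<cdot> u \<in> hom V w a"
    using assms star_copair_simps(1-3)[of "bracket False" a undefined] by simp
  then show "\<exists>!f. f \<in> hom V w a"
    using star_bracket_False_strict[OF assms(1)] by blast
qed

lemma mat_lam_simps [simp]:
  "mc_src (mat_lam V p) = mat_comp V (mat_unit V (m_cod p)) p" "mc_tgt (mat_lam V p) = p"
  "mc_left (mat_lam V p) = (\<lambda>x\<in>m_dom p. x)" "mc_right (mat_lam V p) = (\<lambda>y\<in>m_cod p. y)"
  by (simp_all add: mat_lam_def Let_def)

lemma mat_rho_simps [simp]: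
  "mc_src (mat_rho V p) = mat_comp V p (mat_unit V (m_dom p))" "mc_tgt (mat_rho V p) = p"
  "mc_left (mat_rho V p) = (\<lambda>x\<in>m_dom p. x)" "mc_right (mat_rho V p) = (\<lambda>y\<in>m_cod p. y)"
  by (simp_all add: mat_rho_def Let_def)

lemma mat_alpha_simps [simp]:
  "mc_src (mat_alpha V t s r) = mat_comp V (mat_comp V t s) r"
  "mc_tgt (mat_alpha V t s r) = mat_comp V t (mat_comp V s r)"
  "mc_left (mat_alpha V t s r) = (\<lambda>x\<in>m_dom r. x)" "mc_right (mat_alpha V t s r) = (\<lambda>y\<in>m_cod t. y)"
  by (simp_all add: mat_alpha_def Let_def)

context
  fixes p x y
  assumes p [simp]: "p \<in> Ob M" and xy [simp]: "x \<in> m_dom p" "y \<in> m_cod p"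
begin

text \<open>The evaluation rule covers the diagonal summand only, because elements of the other
  summands are settled by strictness without evaluating anything. The case distinction inside the
  proof serves the typing of the copaired family.\<close>

lemma mat_lam_entry:
  shows "mc_entry (mat_lam V p) (x, y) \<in> hom V (entry (mat_comp V (mat_unit V (m_cod p)) p) (x, y)) (entry p (x, y))"
    and "\<lbrakk>i = mat_unit V (m_cod p); u \<in> Ar V; a \<in> Ar V; Cod V u = star V (bracket True);
      Cod V a = entry p (x, y); Dom V u = Dom V a\<rbrakk>
      \<Longrightarrow> mc_entry (mat_lam V p) (x, y) \<cdot> elt V i p x y y u a = a"
proof -
  let ?i = "mat_unit V (m_cod p)"
  define f where "f = (\<lambda>y'. if y' = y then Pr2 V (entry ?i (y', y)) (entry p (x, y'))
                 else (THE f. f \<in> hom V (comp_family V ?i p x y y') (entry p (x, y))))"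
  have ent: "mc_entry (mat_lam V p) (x, y) = comp_copair V ?i p x y (entry p (x, y)) f"
    by (simp add: mat_lam_def Let_def f_def del: mem_hom)
  have f: "f y' \<in> hom V (Prod V (entry ?i (y', y)) (entry p (x, y'))) (entry p (x, y))"
    if y': "y' \<in> m_cod p" for y'
  proof (cases "y' = y")
    case False
    have "Pr1 V (entry ?i (y', y)) (entry p (x, y')) \<in>
        hom V (comp_family V ?i p x y y') (star V (bracket False))"
      using False y' by (simp add: comp_family_def)
    from strict_the[OF this, of "entry p (x, y)"] False y' show ?thesis
      by (simp add: f_def comp_family_def)
  qed (simp add: f_def)
  have c: "entry p (x, y) \<in> Ob V" by simp
  have i: "?i \<in> Ob M" "m_dom ?i = m_cod p" "y \<in> m_cod ?i" by simp_all
  note cc = comp_copair_simps[OF i(1) p i(2) xy(1) i(3) c f]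
  show "mc_entry (mat_lam V p) (x, y) \<in> hom V (entry (mat_comp V ?i p) (x, y)) (entry p (x, y))"
    unfolding ent mem_hom by (intro conjI cc)
  show "mc_entry (mat_lam V p) (x, y) \<cdot> elt V i p x y y u a = a"
    if "i = ?i" "u \<in> Ar V" "a \<in> Ar V" "Cod V u = star V (bracket True)" "Cod V a = entry p (x, y)"
      "Dom V u = Dom V a"
  proof -
    have "f y = Pr2 V (entry ?i (y, y)) (entry p (x, y))" by (simp add: f_def)
    then show ?thesis unfolding ent that(1) by (subst cc(4)) (use that in simp_all)
  qed
qed

lemma mat_rho_entry:
  shows "mc_entry (mat_rho V p) (x, y) \<in> hom V (entry (mat_comp V p (mat_unit V (m_dom p))) (x, y)) (entry p (x, y))"
    and "\<lbrakk>i = mat_unit V (m_dom p); u \<in> Ar V; a \<in> Ar V; Cod V u = star V (bracket True);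
      Cod V a = entry p (x, y); Dom V a = Dom V u\<rbrakk>
      \<Longrightarrow> mc_entry (mat_rho V p) (x, y) \<cdot> elt V p i x x y a u = a"
proof -
  let ?i = "mat_unit V (m_dom p)"
  define f where "f = (\<lambda>x'. if x' = x then Pr1 V (entry p (x', y)) (entry ?i (x, x'))
                 else (THE f. f \<in> hom V (comp_family V p ?i x y x') (entry p (x, y))))"
  have ent: "mc_entry (mat_rho V p) (x, y) = comp_copair V p ?i x y (entry p (x, y)) f"
    by (simp add: mat_rho_def Let_def f_def del: mem_hom)
  have f: "f x' \<in> hom V (Prod V (entry p (x', y)) (entry ?i (x, x'))) (entry p (x, y))"
    if x': "x' \<in> m_cod ?i" for x'
  proof (cases "x' = x")
    case False
    have "Pr2 V (entry p (x', y)) (entry ?i (x, x')) \<in>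
        hom V (comp_family V p ?i x y x') (star V (bracket False))"
      using False x' by (simp add: comp_family_def)
    from strict_the[OF this, of "entry p (x, y)"] False x' show ?thesis
      by (simp add: f_def comp_family_def)
  qed (simp add: f_def)
  have c: "entry p (x, y) \<in> Ob V" by simp
  have i: "?i \<in> Ob M" "m_dom p = m_cod ?i" "x \<in> m_dom ?i" by simp_all
  note cc = comp_copair_simps[OF p i(1) i(2,3) xy(2) c f]
  show "mc_entry (mat_rho V p) (x, y) \<in> hom V (entry (mat_comp V p ?i) (x, y)) (entry p (x, y))"
    unfolding ent mem_hom by (intro conjI cc)
  show "mc_entry (mat_rho V p) (x, y) \<cdot> elt V p i x x y a u = a"
    if "i = ?i" "u \<in> Ar V" "a \<in> Ar V" "Cod V u = star V (bracket True)" "Cod V a = entry p (x, y)"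
      "Dom V a = Dom V u"
  proof -
    have "f x = Pr1 V (entry p (x, y)) (entry ?i (x, x))" by (simp add: f_def)
    then show ?thesis unfolding ent that(1) by (subst cc(4)) (use that in simp_all)
  qed
qed

text \<open>An element in a summand \<open>y'\<close> other than \<open>y\<close> contains an arrow
  into the empty copower, so there the equation holds for want of distinct arrows.\<close>

lemma unit_left_ext:
  assumes "i = mat_unit V (m_cod p)"
    and "g \<in> hom V (entry (mat_comp V i p) (x, y)) c" "h \<in> hom V (entry (mat_comp V i p) (x, y)) c"
    and eq: "\<And>u a. \<lbrakk>u \<in> Ar V; a \<in> Ar V; Cod V u = star V (bracket True); Cod V a = entry p (x, y);
      Dom V u = Dom V a\<rbrakk> \<Longrightarrow> g \<cdot> elt V i p x y y u a = h \<cdot> elt V i p x y y u a"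
  shows "g = h"
proof (rule comp_ext[of i p x y])
  fix y' u a
  assume *: "y' \<in> m_cod p" "u \<in> Ar V" "a \<in> Ar V" "Cod V u = entry i (y', y)"
    "Cod V a = entry p (x, y')" "Dom V u = Dom V a"
  show "g \<cdot> elt V i p x y' y u a = h \<cdot> elt V i p x y' y u a"
  proof (cases "y' = y")
    case True
    then show ?thesis using eq[of u a] * assms(1) by simp
  next
    case False
    show ?thesis
      by (rule unit_entry_strict[of u "Dom V a" "m_cod p" y' y _ c]) (use * False assms in simp_all)
  qed
qed (use assms in simp_all)

lemma unit_right_ext:
  assumes "i = mat_unit V (m_dom p)"
    and "g \<in> hom V (entry (mat_comp V p i) (x, y)) c" "h \<in> hom V (entry (mat_comp V p i) (x, y)) c"
    and eq: "\<And>u a. \<lbrakk>u \<in> Ar V; a \<in> Ar V; Cod V u = star V (bracket True); Cod V a = entry p (x, y);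
      Dom V a = Dom V u\<rbrakk> \<Longrightarrow> g \<cdot> elt V p i x x y a u = h \<cdot> elt V p i x x y a u"
  shows "g = h"
proof (rule comp_ext[of p i x y])
  fix x' u a
  assume *: "x' \<in> m_cod i" "a \<in> Ar V" "u \<in> Ar V" "Cod V a = entry p (x', y)"
    "Cod V u = entry i (x, x')" "Dom V a = Dom V u"
  show "g \<cdot> elt V p i x x' y a u = h \<cdot> elt V p i x x' y a u"
  proof (cases "x = x'")
    case True
    then show ?thesis using eq[of u a] * assms(1) by simp
  next
    case False
    show ?thesis
      by (rule unit_entry_strict[of u "Dom V u" "m_dom p" x x' _ c]) (use * False assms in simp_all)
  qed
qed (use assms in simp_all)

end

lemma mat_lam_Ar [simp]: "p \<in> Ob M \<Longrightarrow> mat_lam V p \<in> Ar M"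
  using mat_lam_entry(1)[of p]
  by (subst matrix_cells_Ar_iff) (auto simp: mat_lam_def Let_def mat_globular_def)

lemma mat_rho_Ar [simp]: "p \<in> Ob M \<Longrightarrow> mat_rho V p \<in> Ar M"
  using mat_rho_entry(1)[of p]
  by (subst matrix_cells_Ar_iff) (auto simp: mat_rho_def Let_def mat_globular_def)

lemmas mat_unitor_elts [simp] = mat_lam_entry(2) mat_rho_entry(2)


context
  fixes t s r w z
  assumes [simp]: "t \<in> Ob M" "s \<in> Ob M" "r \<in> Ob M" "m_dom t = m_cod s" "m_dom s = m_cod r"
    "w \<in> m_dom r" "z \<in> m_cod t"
begin

text \<open>The existence half of the statement that an iterated composite is a sum over pairs
  \<open>x\<close>, \<open>y\<close>. Distributivity in the first variable combines the
  \<open>g x y\<close> over \<open>y\<close> into one arrow \<open>k x\<close>, and the outer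
  copairing combines these over \<open>x\<close>.\<close>

lemma ex_left_nested:
  assumes d: "d \<in> Ob V" and g: "\<And>x y. \<lbrakk>x \<in> m_cod r; y \<in> m_cod s\<rbrakk> \<Longrightarrow>
      g x y \<in> hom V (Prod V (Prod V (entry t (y, z)) (entry s (x, y))) (entry r (w, x))) d"
  shows "\<exists>h \<in> hom V (entry (mat_comp V (mat_comp V t s) r) (w, z)) d.
    \<forall>x y c b a. x \<in> m_cod r \<and> y \<in> m_cod s \<and> c \<in> hom V (Dom V a) (entry t (y, z)) \<and>
      b \<in> hom V (Dom V a) (entry s (x, y)) \<and> a \<in> hom V (Dom V a) (entry r (w, x)) \<longrightarrow>
      h \<cdot> elt V (mat_comp V t s) r w x z (elt V t s x y z c b) a = g x y \<cdot> pair V (pair V c b) a"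
proof -
  have "\<exists>k. k \<in> hom V (Prod V (entry (mat_comp V t s) (x, z)) (entry r (w, x))) d \<and>
      (\<forall>y \<in> m_cod s. k \<cdot> prod_map V (comp_inj V t s x z y) (Ident V (entry r (w, x))) = g x y)"
    if x: "x \<in> m_cod r" for x
  proof -
    have "is_coproduct V (m_cod s) (comp_family V t s x z) (entry (mat_comp V t s) (x, z)) (comp_inj V t s x z)"
      using is_coproduct_coprod[of "m_cod s" "comp_family V t s x z"] x
      by (simp add: entry_mat_comp comp_family_Ob comp_inj_def[abs_def])
    from is_coproduct_ex1[OF is_coproduct_prod(2)[OF _ this, of "entry r (w, x)"] d, of "g x"] g x
    show ?thesis by (auto simp: comp_family_def)
  qed
  then obtain k where k: "\<And>x. x \<in> m_cod r \<Longrightarrow>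
      k x \<in> hom V (Prod V (entry (mat_comp V t s) (x, z)) (entry r (w, x))) d"
    and kg: "\<And>x y. x \<in> m_cod r \<Longrightarrow> y \<in> m_cod s \<Longrightarrow>
      k x \<cdot> prod_map V (comp_inj V t s x z y) (Ident V (entry r (w, x))) = g x y"
    by metis
  define h where "h = comp_copair V (mat_comp V t s) r w z d k"
  have h: "h \<in> hom V (entry (mat_comp V (mat_comp V t s) r) (w, z)) d"
    unfolding h_def mem_hom using d by (intro conjI comp_copair_simps k) simp_all
  have "h \<cdot> elt V (mat_comp V t s) r w x z (elt V t s x y z c b) a = g x y \<cdot> pair V (pair V c b) a"
    if [simp]: "x \<in> m_cod r" "y \<in> m_cod s" and cba [simp]: "c \<in> Ar V" "b \<in> Ar V" "a \<in> Ar V"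
      "Cod V c = entry t (y, z)" "Cod V b = entry s (x, y)" "Cod V a = entry r (w, x)"
      "Dom V c = Dom V a" "Dom V b = Dom V a" for x y c b a
  proof -
    have "h \<cdot> elt V (mat_comp V t s) r w x z (elt V t s x y z c b) a = k x \<cdot> pair V (elt V t s x y z c b) a"
      unfolding h_def using d by (intro comp_copair_simps k) simp_all
    also have "pair V (elt V t s x y z c b) a =
        prod_map V (comp_inj V t s x z y) (Ident V (entry r (w, x))) \<cdot> pair V (pair V c b) a"
      by (simp add: elt_def)
    finally show ?thesis
      using Comp_reassoc[OF kg, of x y "pair V (pair V c b) a"] k[of x] by simp
  qed
  with h show ?thesis by (intro bexI[of _ h]) simp_all
qed

text \<open>The same construction with the inner sum over \<open>x\<close> in the second factor,
  hence with distributivity in the other variable; it provides the inverse of the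
  associator.\<close>

lemma ex_right_nested:
  assumes d: "d \<in> Ob V" and g: "\<And>x y. \<lbrakk>x \<in> m_cod r; y \<in> m_cod s\<rbrakk> \<Longrightarrow>
      g x y \<in> hom V (Prod V (entry t (y, z)) (Prod V (entry s (x, y)) (entry r (w, x)))) d"
  shows "\<exists>h \<in> hom V (entry (mat_comp V t (mat_comp V s r)) (w, z)) d.
    \<forall>x y c b a. x \<in> m_cod r \<and> y \<in> m_cod s \<and> c \<in> hom V (Dom V a) (entry t (y, z)) \<and>
      b \<in> hom V (Dom V a) (entry s (x, y)) \<and> a \<in> hom V (Dom V a) (entry r (w, x)) \<longrightarrow>
      h \<cdot> elt V t (mat_comp V s r) w y z c (elt V s r w x y b a) = g x y \<cdot> pair V c (pair V b a)"
proof -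
  have "\<exists>k. k \<in> hom V (Prod V (entry t (y, z)) (entry (mat_comp V s r) (w, y))) d \<and>
      (\<forall>x \<in> m_cod r. k \<cdot> prod_map V (Ident V (entry t (y, z))) (comp_inj V s r w y x) = g x y)"
    if y: "y \<in> m_cod s" for y
  proof -
    have "is_coproduct V (m_cod r) (comp_family V s r w y) (entry (mat_comp V s r) (w, y)) (comp_inj V s r w y)"
      using is_coproduct_coprod[of "m_cod r" "comp_family V s r w y"] y
      by (simp add: entry_mat_comp comp_family_Ob comp_inj_def[abs_def])
    from is_coproduct_ex1[OF is_coproduct_prod(1)[OF _ this, of "entry t (y, z)"] d, of "\<lambda>x. g x y"] g y
    show ?thesis by (auto simp: comp_family_def)
  qed
  then obtain k where k: "\<And>y. y \<in> m_cod s \<Longrightarrow>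
      k y \<in> hom V (Prod V (entry t (y, z)) (entry (mat_comp V s r) (w, y))) d"
    and kg: "\<And>x y. x \<in> m_cod r \<Longrightarrow> y \<in> m_cod s \<Longrightarrow>
      k y \<cdot> prod_map V (Ident V (entry t (y, z))) (comp_inj V s r w y x) = g x y"
    by metis
  define h where "h = comp_copair V t (mat_comp V s r) w z d k"
  have h: "h \<in> hom V (entry (mat_comp V t (mat_comp V s r)) (w, z)) d"
    unfolding h_def mem_hom using d by (intro conjI comp_copair_simps k) simp_all
  have "h \<cdot> elt V t (mat_comp V s r) w y z c (elt V s r w x y b a) = g x y \<cdot> pair V c (pair V b a)"
    if [simp]: "x \<in> m_cod r" "y \<in> m_cod s" and cba [simp]: "c \<in> Ar V" "b \<in> Ar V" "a \<in> Ar V"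
      "Cod V c = entry t (y, z)" "Cod V b = entry s (x, y)" "Cod V a = entry r (w, x)"
      "Dom V c = Dom V a" "Dom V b = Dom V a" for x y c b a
  proof -
    have "h \<cdot> elt V t (mat_comp V s r) w y z c (elt V s r w x y b a) = k y \<cdot> pair V c (elt V s r w x y b a)"
      unfolding h_def using d by (intro comp_copair_simps k) simp_all
    also have "pair V c (elt V s r w x y b a) =
        prod_map V (Ident V (entry t (y, z))) (comp_inj V s r w y x) \<cdot> pair V c (pair V b a)"
      by (simp add: elt_def)
    finally show ?thesis
      using Comp_reassoc[OF kg, of x y "pair V c (pair V b a)"] k[of y] by simp
  qed
  with h show ?thesis by (intro bexI[of _ h]) simp_all
qed

lemma ex_assoc:
  "\<exists>h \<in> hom V (entry (mat_comp V (mat_comp V t s) r) (w, z)) (entry (mat_comp V t (mat_comp V s r)) (w, z)).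
    \<forall>x y c b a. x \<in> m_cod r \<and> y \<in> m_cod s \<and> c \<in> hom V (Dom V a) (entry t (y, z)) \<and>
      b \<in> hom V (Dom V a) (entry s (x, y)) \<and> a \<in> hom V (Dom V a) (entry r (w, x)) \<longrightarrow>
      h \<cdot> elt V (mat_comp V t s) r w x z (elt V t s x y z c b) a =
        elt V t (mat_comp V s r) w y z c (elt V s r w x y b a)"
proof -
  let ?P = "\<lambda>x y. Prod V (entry t (y, z)) (entry s (x, y))"
  \<comment> \<open>\<open>a1\<close>, \<open>a2\<close>, \<open>a3\<close> form the universal
    triple of the summand. Prescribing the value \<open>[a1,[a2,a3]]\<close> on it prescribes the
    value on every triple.\<close>
  define a1 where "a1 = (\<lambda>x y. Pr1 V (entry t (y, z)) (entry s (x, y)) \<cdot> Pr1 V (?P x y) (entry r (w, x)))"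
  define a2 where "a2 = (\<lambda>x y. Pr2 V (entry t (y, z)) (entry s (x, y)) \<cdot> Pr1 V (?P x y) (entry r (w, x)))"
  define a3 where "a3 = (\<lambda>x y. Pr2 V (?P x y) (entry r (w, x)))"
  define g where "g = (\<lambda>x y. elt V t (mat_comp V s r) w y z (a1 x y) (elt V s r w x y (a2 x y) (a3 x y)))"
  have g: "g x y \<in> hom V (Prod V (?P x y) (entry r (w, x))) (entry (mat_comp V t (mat_comp V s r)) (w, z))"
    if "x \<in> m_cod r" "y \<in> m_cod s" for x y
    using that by (simp add: g_def a1_def a2_def a3_def)
  have "g x y \<cdot> pair V (pair V c b) a = elt V t (mat_comp V s r) w y z c (elt V s r w x y b a)"
    if "x \<in> m_cod r" "y \<in> m_cod s" "c \<in> Ar V" "b \<in> Ar V" "a \<in> Ar V"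
      "Cod V c = entry t (y, z)" "Cod V b = entry s (x, y)" "Cod V a = entry r (w, x)"
      "Dom V c = Dom V a" "Dom V b = Dom V a" for x y c b a
    using that by (simp add: g_def a1_def a2_def a3_def)
  then show ?thesis
    using ex_left_nested[OF _ g] by simp
qed

lemma ex_assoc_inverse:
  "\<exists>h \<in> hom V (entry (mat_comp V t (mat_comp V s r)) (w, z)) (entry (mat_comp V (mat_comp V t s) r) (w, z)).
    \<forall>x y c b a. x \<in> m_cod r \<and> y \<in> m_cod s \<and> c \<in> hom V (Dom V a) (entry t (y, z)) \<and>
      b \<in> hom V (Dom V a) (entry s (x, y)) \<and> a \<in> hom V (Dom V a) (entry r (w, x)) \<longrightarrow>
      h \<cdot> elt V t (mat_comp V s r) w y z c (elt V s r w x y b a) =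
        elt V (mat_comp V t s) r w x z (elt V t s x y z c b) a"
proof -
  let ?P = "\<lambda>x y. Prod V (entry s (x, y)) (entry r (w, x))"
  \<comment> \<open>The universal triple of the opposite bracketing, to be sent to
    \<open>[[a1,a2],a3]\<close>.\<close>
  define a1 where "a1 = (\<lambda>x y. Pr1 V (entry t (y, z)) (?P x y))"
  define a2 where "a2 = (\<lambda>x y. Pr1 V (entry s (x, y)) (entry r (w, x)) \<cdot> Pr2 V (entry t (y, z)) (?P x y))"
  define a3 where "a3 = (\<lambda>x y. Pr2 V (entry s (x, y)) (entry r (w, x)) \<cdot> Pr2 V (entry t (y, z)) (?P x y))"
  define g where "g = (\<lambda>x y. elt V (mat_comp V t s) r w x z (elt V t s x y z (a1 x y) (a2 x y)) (a3 x y))"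
  have g: "g x y \<in> hom V (Prod V (entry t (y, z)) (?P x y)) (entry (mat_comp V (mat_comp V t s) r) (w, z))"
    if "x \<in> m_cod r" "y \<in> m_cod s" for x y
    using that by (simp add: g_def a1_def a2_def a3_def)
  have "g x y \<cdot> pair V c (pair V b a) = elt V (mat_comp V t s) r w x z (elt V t s x y z c b) a"
    if "x \<in> m_cod r" "y \<in> m_cod s" "c \<in> Ar V" "b \<in> Ar V" "a \<in> Ar V"
      "Cod V c = entry t (y, z)" "Cod V b = entry s (x, y)" "Cod V a = entry r (w, x)"
      "Dom V c = Dom V a" "Dom V b = Dom V a" for x y c b a
    using that by (simp add: g_def a1_def a2_def a3_def)
  then show ?thesis
    using ex_right_nested[OF _ g] by simp
qed

text \<open>The associator is a definite description phrased with injections, so it can be evaluated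
  only after existence and uniqueness are known. Both are available for elements, from
  \<open>ex_assoc\<close> and \<open>comp3_ext\<close>; the work lies in translating between the two
  phrasings.\<close>

lemma mat_alpha_entry:
  shows "mc_entry (mat_alpha V t s r) (w, z) \<in>
      hom V (entry (mat_comp V (mat_comp V t s) r) (w, z)) (entry (mat_comp V t (mat_comp V s r)) (w, z))"
    and "\<lbrakk>ts = mat_comp V t s; x \<in> m_cod r; y \<in> m_cod s; c \<in> Ar V; b \<in> Ar V; a \<in> Ar V;
      Cod V c = entry t (y, z); Cod V b = entry s (x, y); Cod V a = entry r (w, x);
      Dom V c = Dom V a; Dom V b = Dom V a\<rbrakk> \<Longrightarrow>
      mc_entry (mat_alpha V t s r) (w, z) \<cdot> elt V ts r w x z (elt V t s x y z c b) a =
        elt V t (mat_comp V s r) w y z c (elt V s r w x y b a)"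
proof -
  let ?ts = "mat_comp V t s" and ?sr = "mat_comp V s r"
  let ?typ = "\<lambda>h. h \<in> hom V (entry (mat_comp V ?ts r) (w, z)) (entry (mat_comp V t ?sr) (w, z))"
  let ?L = "\<lambda>x y. comp_inj V ?ts r w z x \<cdot> prod_map V (comp_inj V t s x z y) (Ident V (entry r (w, x)))"
    and ?R = "\<lambda>x y. comp_inj V t ?sr w z y \<cdot> prod_map V (Ident V (entry t (y, z))) (comp_inj V s r w y x) \<cdot>
      prod_assoc V (entry t (y, z)) (entry s (x, y)) (entry r (w, x))"
  let ?Q = "\<lambda>h. ?typ h \<and> (\<forall>x \<in> m_cod r. \<forall>y \<in> m_cod s.
              h \<cdot> ?L x y = ?R x y)"
  obtain h where h: "?typ h"
    and helt: "\<And>x y c b a. \<lbrakk>x \<in> m_cod r; y \<in> m_cod s; c \<in> hom V (Dom V a) (entry t (y, z));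
      b \<in> hom V (Dom V a) (entry s (x, y)); a \<in> hom V (Dom V a) (entry r (w, x))\<rbrakk> \<Longrightarrow>
      h \<cdot> elt V ?ts r w x z (elt V t s x y z c b) a = elt V t ?sr w y z c (elt V s r w x y b a)"
    using ex_assoc by blast
  have elts: "comp_inj V ?ts r w z x \<cdot> prod_map V (comp_inj V t s x z y) (Ident V (entry r (w, x))) \<cdot>
        pair V (pair V c b) a = elt V ?ts r w x z (elt V t s x y z c b) a"
      "comp_inj V t ?sr w z y \<cdot> prod_map V (Ident V (entry t (y, z))) (comp_inj V s r w y x) \<cdot>
        prod_assoc V (entry t (y, z)) (entry s (x, y)) (entry r (w, x)) \<cdot> pair V (pair V c b) a =
        elt V t ?sr w y z c (elt V s r w x y b a)"
    if "x \<in> m_cod r" "y \<in> m_cod s" "c \<in> Ar V" "b \<in> Ar V" "a \<in> Ar V"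
      "Cod V c = entry t (y, z)" "Cod V b = entry s (x, y)" "Cod V a = entry r (w, x)"
      "Dom V c = Dom V a" "Dom V b = Dom V a" for x y c b a
    using that by (simp_all add: elt_def)
  have "?Q h"
  proof (intro conjI ballI h)
    fix x y assume xy [simp]: "x \<in> m_cod r" "y \<in> m_cod s"
    let ?P = "Prod V (entry t (y, z)) (entry s (x, y))"
    let ?a1 = "Pr1 V (entry t (y, z)) (entry s (x, y)) \<cdot> Pr1 V ?P (entry r (w, x))"
      and ?a2 = "Pr2 V (entry t (y, z)) (entry s (x, y)) \<cdot> Pr1 V ?P (entry r (w, x))"
      and ?a3 = "Pr2 V ?P (entry r (w, x))"
    have ty: "?a1 \<in> Ar V" "?a2 \<in> Ar V" "?a3 \<in> Ar V" "Cod V ?a1 = entry t (y, z)"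
      "Cod V ?a2 = entry s (x, y)" "Cod V ?a3 = entry r (w, x)" "Dom V ?a1 = Dom V ?a3" "Dom V ?a2 = Dom V ?a3"
      by simp_all
    \<comment> \<open>The universal triple is an identity, so the equation for elements, evaluated
      at it, is the equation for injections.\<close>
    have id: "pair V (pair V ?a1 ?a2) ?a3 = Ident V (Prod V ?P (entry r (w, x)))"
      by (simp add: pair_eta)
    have "h \<cdot> comp_inj V ?ts r w z x \<cdot> prod_map V (comp_inj V t s x z y) (Ident V (entry r (w, x))) \<cdot>
        pair V (pair V ?a1 ?a2) ?a3 =
      comp_inj V t ?sr w z y \<cdot> prod_map V (Ident V (entry t (y, z))) (comp_inj V s r w y x) \<cdot>
        prod_assoc V (entry t (y, z)) (entry s (x, y)) (entry r (w, x)) \<cdot> pair V (pair V ?a1 ?a2) ?a3"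
      unfolding elts[OF xy ty] by (rule helt) (use ty in simp_all)
    then show "h \<cdot> ?L x y = ?R x y"
      unfolding id by simp
  qed
  moreover have "k = h" if k: "?Q k" for k
  proof (rule comp3_ext[of t s r w z])
    fix x y c b a
    assume *: "x \<in> m_cod r" "y \<in> m_cod s" "c \<in> Ar V" "b \<in> Ar V" "a \<in> Ar V"
      "Cod V c = entry t (y, z)" "Cod V b = entry s (x, y)" "Cod V a = entry r (w, x)"
      "Dom V c = Dom V a" "Dom V b = Dom V a"
    have kt: "k \<in> Ar V" "Dom V k = entry (mat_comp V ?ts r) (w, z)" "Cod V k = entry (mat_comp V t ?sr) (w, z)"
      using k by simp_all
    \<comment> \<open>Conversely, precomposing the equation for injections with a triple gives the
      equation for elements.\<close>
    have "(k \<cdot> ?L x y) \<cdot> pair V (pair V c b) a = (?R x y) \<cdot> pair V (pair V c b) a"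
      using k * by simp
    then have "k \<cdot> elt V ?ts r w x z (elt V t s x y z c b) a = elt V t ?sr w y z c (elt V s r w x y b a)"
      using kt * by (simp add: elt_def)
    then show "k \<cdot> elt V ?ts r w x z (elt V t s x y z c b) a = h \<cdot> elt V ?ts r w x z (elt V t s x y z c b) a"
      using helt[of x y c a b] * by simp
  qed (use h k in simp_all)
  ultimately have "(THE h. ?Q h) = h" by (rule the_equality)
  then have ent: "mc_entry (mat_alpha V t s r) (w, z) = h"
    by (simp add: mat_alpha_def Let_def del: mem_hom)
  show "?typ (mc_entry (mat_alpha V t s r) (w, z))" using h by (simp add: ent)
  show "mc_entry (mat_alpha V t s r) (w, z) \<cdot> elt V ts r w x z (elt V t s x y z c b) a =
        elt V t ?sr w y z c (elt V s r w x y b a)"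
    if "ts = ?ts" "x \<in> m_cod r" "y \<in> m_cod s" "c \<in> Ar V" "b \<in> Ar V" "a \<in> Ar V"
      "Cod V c = entry t (y, z)" "Cod V b = entry s (x, y)" "Cod V a = entry r (w, x)"
      "Dom V c = Dom V a" "Dom V b = Dom V a"
    using helt[of x y c a b] that by (simp add: ent)
qed

end

lemmas mat_alpha_elt [simp] = mat_alpha_entry(2)

lemma mat_globular_extensional: "mc_entry (mat_globular p q k) \<in> extensional (m_dom p \<times> m_cod p)"
  by (simp add: mat_globular_def)

lemma mat_alpha_Ar [simp]:
  assumes "t \<in> Ob M" "s \<in> Ob M" "r \<in> Ob M" "m_dom t = m_cod s" "m_dom s = m_cod r"
  shows "mat_alpha V t s r \<in> Ar M"
proof (subst matrix_cells_Ar_iff, intro conjI ballI)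
  show "mc_entry (mat_alpha V t s r) \<in> extensional (m_dom (mc_src (mat_alpha V t s r)) \<times>
      m_cod (mc_src (mat_alpha V t s r)))"
    unfolding mat_alpha_simps unfolding mat_alpha_def Let_def by (rule mat_globular_extensional)
next
  fix x y assume "x \<in> m_dom (mc_src (mat_alpha V t s r))" "y \<in> m_cod (mc_src (mat_alpha V t s r))"
  then have xy: "x \<in> m_dom r" "y \<in> m_cod t" by simp_all
  show "mc_entry (mat_alpha V t s r) (x, y) \<in> hom V (entry (mc_src (mat_alpha V t s r)) (x, y))
      (entry (mc_tgt (mat_alpha V t s r)) (mc_left (mat_alpha V t s r) x, mc_right (mat_alpha V t s r) y))"
    using mat_alpha_entry(1)[OF assms xy] xy by simp
qed (use assms in simp_all)

text \<open>After three factors are separated, \<open>k\<close> still ranges over arbitrary elements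
  of the composite of \<open>u\<close> and \<open>t\<close>. Bundling \<open>b\<close> and
  \<open>a\<close> into a single arrow to a product leaves one side factor, and
  \<open>elt_left_ext\<close> can open \<open>k\<close> too; \<open>m\<close> expresses the nested
  element as a function of this bundled pair.\<close>

lemma comp4_ext:
  assumes [simp]: "u \<in> Ob M" "t \<in> Ob M" "s \<in> Ob M" "r \<in> Ob M"
    and [simp]: "m_dom u = m_cod t" "m_dom t = m_cod s" "m_dom s = m_cod r" "v \<in> m_dom r" "z \<in> m_cod u"
    and g: "g \<in> hom V (entry (mat_comp V (mat_comp V (mat_comp V u t) s) r) (v, z)) e"
    and h: "h \<in> hom V (entry (mat_comp V (mat_comp V (mat_comp V u t) s) r) (v, z)) e"
    and eq: "\<And>w x y d c b a. \<lbrakk>w \<in> m_cod r; x \<in> m_cod s; y \<in> m_cod t; d \<in> Ar V; c \<in> Ar V; b \<in> Ar V; a \<in> Ar V;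
      Cod V d = entry u (y, z); Cod V c = entry t (x, y); Cod V b = entry s (w, x); Cod V a = entry r (v, w);
      Dom V d = Dom V a; Dom V c = Dom V a; Dom V b = Dom V a\<rbrakk> \<Longrightarrow>
      g \<cdot> elt V (mat_comp V (mat_comp V u t) s) r v w z (elt V (mat_comp V u t) s w x z (elt V u t x y z d c) b) a =
      h \<cdot> elt V (mat_comp V (mat_comp V u t) s) r v w z (elt V (mat_comp V u t) s w x z (elt V u t x y z d c) b) a"
  shows "g = h"
proof (rule comp3_ext[of "mat_comp V u t" s r v z])
  fix w x k b a
  assume *[simp]: "w \<in> m_cod r" "x \<in> m_cod s" "k \<in> Ar V" "b \<in> Ar V" "a \<in> Ar V"
    "Cod V k = entry (mat_comp V u t) (x, z)" "Cod V b = entry s (w, x)" "Cod V a = entry r (v, w)"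
    "Dom V k = Dom V a" "Dom V b = Dom V a"
  note [simp] = g[simplified] h[simplified]
  let ?ut = "entry (mat_comp V u t) (x, z)" and ?sr = "Prod V (entry s (w, x)) (entry r (v, w))"
  let ?e = "elt V (mat_comp V (mat_comp V u t) s) r v w z" and ?e' = "elt V (mat_comp V u t) s w x z"
  define p where "p = Pr1 V (entry s (w, x)) (entry r (v, w)) \<cdot> Pr2 V ?ut ?sr"
  define q where "q = Pr2 V (entry s (w, x)) (entry r (v, w)) \<cdot> Pr2 V ?ut ?sr"
  define m where "m = ?e (?e' (Pr1 V ?ut ?sr) p) q"
  have pq [simp]: "p \<in> Ar V" "q \<in> Ar V" "Dom V p = Prod V ?ut ?sr" "Dom V q = Prod V ?ut ?sr"
    "Cod V p = entry s (w, x)" "Cod V q = entry r (v, w)"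
    by (simp_all add: p_def q_def)
  have m [simp]: "m \<in> Ar V" "Dom V m = Prod V ?ut ?sr"
    "Cod V m = entry (mat_comp V (mat_comp V (mat_comp V u t) s) r) (v, z)"
    by (simp_all add: m_def)
  have m_pair: "m \<cdot> pair V k' l = ?e (?e' k' (Pr1 V (entry s (w, x)) (entry r (v, w)) \<cdot> l))
      (Pr2 V (entry s (w, x)) (entry r (v, w)) \<cdot> l)"
    if "k' \<in> Ar V" "l \<in> Ar V" "Cod V k' = ?ut" "Cod V l = ?sr" "Dom V k' = Dom V l" for k' l
    using that by (simp add: m_def) (simp add: p_def q_def)
  have "g \<cdot> m = h \<cdot> m"
    by (rule elt_left_ext[of u t x z ?sr _ e]) (simp_all add: m_pair eq)
  from arg_cong[OF this, of "\<lambda>m. m \<cdot> pair V k (pair V b a)"]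
  show "g \<cdot> ?e (?e' k b) a =
      h \<cdot> ?e (?e' k b) a"
    by (simp add: m_pair)
qed (use g h in simp_all)

end

section \<open>The pseudodouble category of matrices\<close>

lemma Mat_simps [simp]:
  "D0 (Mat U V) = set_cat U" "D1 (Mat U V) = matrix_cells U V"
  "onOb (hDom (Mat U V)) = m_dom"
  "onAr (hDom (Mat U V)) \<phi> = Fn (m_dom (mc_src \<phi>)) (m_dom (mc_tgt \<phi>)) (mc_left \<phi>)"
  "onOb (hCod (Mat U V)) = m_cod"
  "onAr (hCod (Mat U V)) \<phi> = Fn (m_cod (mc_src \<phi>)) (m_cod (mc_tgt \<phi>)) (mc_right \<phi>)"
  "onOb (hUnit (Mat U V)) = mat_unit V" "onAr (hUnit (Mat U V)) = mat_unit_cell V"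
  "onOb (hComp (Mat U V)) (q, p) = mat_comp V q p" "onAr (hComp (Mat U V)) (\<psi>, \<phi>) = mat_comp_cell V \<psi> \<phi>"
  "lam (Mat U V) = mat_lam V" "rho (Mat U V) = mat_rho V" "alpha (Mat U V) = mat_alpha V"
  by (simp_all add: Mat_def)

lemma composables_Mat [simp]:
  "(q, p) \<in> Ob (composables (Mat U V)) \<longleftrightarrow>
    q \<in> Ob (matrix_cells U V) \<and> p \<in> Ob (matrix_cells U V) \<and> m_dom q = m_cod p"
  "(\<psi>, \<phi>) \<in> Ar (composables (Mat U V)) \<longleftrightarrow> \<psi> \<in> Ar (matrix_cells U V) \<and> \<phi> \<in> Ar (matrix_cells U V) \<and>
     m_dom (mc_src \<psi>) = m_cod (mc_src \<phi>) \<and> m_dom (mc_tgt \<psi>) = m_cod (mc_tgt \<phi>) \<and> mc_left \<psi> = mc_right \<phi>"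
  "Dom (composables (Mat U V)) (\<psi>, \<phi>) = (mc_src \<psi>, mc_src \<phi>)"
  "Cod (composables (Mat U V)) (\<psi>, \<phi>) = (mc_tgt \<psi>, mc_tgt \<phi>)"
  "Ident (composables (Mat U V)) (q, p) = (Ident (matrix_cells U V) q, Ident (matrix_cells U V) p)"
  "Comp (composables (Mat U V)) (\<psi>', \<phi>') (\<psi>, \<phi>) = (\<psi>' \<cdot>\<^bsub>matrix_cells U V\<^esub> \<psi>, \<phi>' \<cdot>\<^bsub>matrix_cells U V\<^esub> \<phi>)"
  by (simp_all add: composables_def)

context distributive_category
begin

lemmas M_eqI = matrix_cell_eqI[where U = U and V = V]

lemma hDom_Mat_functor: "cfunctor M (set_cat U) (hDom (Mat U V))"
  by (rule cfunctorI[OF category_matrix_cells category_set_cat])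
    (simp_all add: matrix_cells_Ar_funcset[where U = U and V = V])

lemma hCod_Mat_functor: "cfunctor M (set_cat U) (hCod (Mat U V))"
  by (rule cfunctorI[OF category_matrix_cells category_set_cat])
    (simp_all add: matrix_cells_Ar_funcset[where U = U and V = V])

text \<open>Parallel arrows into an entry of a unit matrix are equal, so preservation of identities
  and composites holds on entries as soon as both sides have the right type.\<close>

lemma hUnit_Mat_functor: "cfunctor (set_cat U) M (hUnit (Mat U V))" (is "cfunctor _ _ ?F")
proof (rule cfunctorI[OF category_set_cat category_matrix_cells])
  fix X assume "X \<in> Ob (set_cat U)"
  then have X: "X \<in> U" by simp
  then have id: "Fn X X (\<lambda>x\<in>X. x) \<in> Ar (set_cat U)" by simp
  show "onAr ?F (Ident (set_cat U) X) = Ident M (onOb ?F X)"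
  proof (rule M_eqI)
    fix x x' assume x: "x \<in> m_dom (mc_src (Ident M (onOb ?F X)))"
      "x' \<in> m_cod (mc_src (Ident M (onOb ?F X)))"
    show "mc_entry (onAr ?F (Ident (set_cat U) X)) (x, x') =
      mc_entry (Ident M (onOb ?F X)) (x, x')"
      by (rule unit_entry_unique[of _ "star V (bracket (x = x'))" X x x'])
        (use x X mat_unit_cell_entry[OF id] in simp_all)
  qed (use X id in simp_all)
next
  fix f g assume fg: "f \<in> Ar (set_cat U)" "g \<in> Ar (set_cat U)" "Dom (set_cat U) g = Cod (set_cat U) f"
  then have gf: "g \<cdot>\<^bsub>set_cat U\<^esub> f \<in> Ar (set_cat U)"
    using category.Comp_simps(1)[OF category_set_cat, of f U g] by blast
  have mem: "fn_app f x \<in> fn_dom g" "fn_app g (fn_app f x) \<in> fn_cod g" if "x \<in> fn_dom f" for x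
    using fg that by auto
  have [simp]: "mat_unit_cell V f \<in> Ar M" "mat_unit_cell V g \<in> Ar M" using fg by simp_all
  show "onAr ?F (g \<cdot>\<^bsub>set_cat U\<^esub> f) = onAr ?F g \<cdot>\<^bsub>M\<^esub> onAr ?F f"
  proof (rule M_eqI)
    show "onAr ?F (g \<cdot>\<^bsub>set_cat U\<^esub> f) \<in> Ar M"
      using mat_unit_cell_Ar[OF gf] by simp
    fix x x' assume x: "x \<in> m_dom (mc_src (onAr ?F g \<cdot>\<^bsub>M\<^esub> onAr ?F f))"
      "x' \<in> m_cod (mc_src (onAr ?F g \<cdot>\<^bsub>M\<^esub> onAr ?F f))"
    show "mc_entry (onAr ?F (g \<cdot>\<^bsub>set_cat U\<^esub> f)) (x, x') =
      mc_entry (onAr ?F g \<cdot>\<^bsub>M\<^esub> onAr ?F f) (x, x')"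
      by (rule unit_entry_unique[of _ "star V (bracket (x = x'))" "fn_cod g" "fn_app g (fn_app f x)" "fn_app g (fn_app f x')"])
        (use x fg mem mat_unit_cell_entry[OF gf] mat_unit_cell_entry[OF fg(1)] mat_unit_cell_entry[OF fg(2)]
          in \<open>simp_all add: compose_def\<close>)
  qed (use fg in \<open>simp_all add: compose_def\<close>)
qed (simp_all del: set_cat_Ar)

lemma hComp_Mat_functor: "cfunctor (composables (Mat U V)) M (hComp (Mat U V))" (is "cfunctor ?P _ ?F")
proof (rule cfunctorI)
  show "category ?P"
    unfolding composables_def
    by (rule category_fibre_product[where C = "set_cat U"])
      (simp_all add: hDom_Mat_functor hCod_Mat_functor)
  show "category M" by (rule category_matrix_cells)
next
  fix x assume "x \<in> Ob ?P"
  then show "onOb ?F x \<in> Ob M" by (cases x) simp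
next
  fix f assume "f \<in> Ar ?P"
  then show "onAr ?F f \<in> Ar M \<and>
      Dom M (onAr ?F f) = onOb ?F (Dom ?P f) \<and>
      Cod M (onAr ?F f) = onOb ?F (Cod ?P f)"
    by (cases f) simp
next
  fix x assume x: "x \<in> Ob ?P"
  obtain q p where qp: "x = (q, p)" by (cases x)
  have [simp]: "q \<in> Ob M" "p \<in> Ob M" "m_dom q = m_cod p" using x qp by simp_all
  have "mat_comp_cell V (Ident M q) (Ident M p) = Ident M (mat_comp V q p)"
  proof (rule M_eqI)
    fix x z assume "x \<in> m_dom (mc_src (Ident M (mat_comp V q p)))" "z \<in> m_cod (mc_src (Ident M (mat_comp V q p)))"
    then have [simp]: "x \<in> m_dom p" "z \<in> m_cod q" by simp_all
    show "mc_entry (mat_comp_cell V (Ident M q) (Ident M p)) (x, z) = mc_entry (Ident M (mat_comp V q p)) (x, z)"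
      by (rule comp_ext[of q p x z _ "entry (mat_comp V q p) (x, z)"]) simp_all
  qed simp_all
  then show "onAr ?F (Ident ?P x) = Ident M (onOb ?F x)"
    by (simp add: qp)
next
  fix f g
  assume fg: "f \<in> Ar ?P" "g \<in> Ar ?P"
    "Dom ?P g = Cod ?P f"
  obtain f1 f2 g1 g2 where f: "f = (f1, f2)" and g: "g = (g1, g2)" by (cases f; cases g)
  have [simp]: "f1 \<in> Ar M" "f2 \<in> Ar M" "mc_left f1 = mc_right f2"
    "g1 \<in> Ar M" "g2 \<in> Ar M" "mc_left g1 = mc_right g2"
    "mc_src g1 = mc_tgt f1" "mc_src g2 = mc_tgt f2"
    "m_dom (mc_src f1) = m_cod (mc_src f2)" "m_dom (mc_tgt f1) = m_cod (mc_tgt f2)"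
    "m_dom (mc_tgt g1) = m_cod (mc_tgt g2)"
    using fg by (simp_all add: f g)
  have "mat_comp_cell V (g1 \<cdot>\<^bsub>M\<^esub> f1) (g2 \<cdot>\<^bsub>M\<^esub> f2) = mat_comp_cell V g1 g2 \<cdot>\<^bsub>M\<^esub> mat_comp_cell V f1 f2"
  proof (rule M_eqI)
    fix x z assume "x \<in> m_dom (mc_src (mat_comp_cell V g1 g2 \<cdot>\<^bsub>M\<^esub> mat_comp_cell V f1 f2))"
      "z \<in> m_cod (mc_src (mat_comp_cell V g1 g2 \<cdot>\<^bsub>M\<^esub> mat_comp_cell V f1 f2))"
    then have [simp]: "x \<in> m_dom (mc_src f2)" "z \<in> m_cod (mc_src f1)" by simp_all
    note [simp] = matrix_cells_ArD(4)[of f1 U V] matrix_cells_ArD(3,4)[of f2 U V]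
    show "mc_entry (mat_comp_cell V (g1 \<cdot>\<^bsub>M\<^esub> f1) (g2 \<cdot>\<^bsub>M\<^esub> f2)) (x, z) =
        mc_entry (mat_comp_cell V g1 g2 \<cdot>\<^bsub>M\<^esub> mat_comp_cell V f1 f2) (x, z)"
      by (rule comp_ext[of "mc_src f1" "mc_src f2" x z])
        (simp_all add: compose_def)
  qed (simp_all add: compose_def)
  then show "onAr ?F (g \<cdot>\<^bsub>?P\<^esub> f) =
      onAr ?F g \<cdot>\<^bsub>M\<^esub> onAr ?F f"
    by (simp add: f g)
qed


text \<open>A cell whose boundary functions are identities is a \<open>mat_globular\<close> by
  extensionality, which reduces the invertibility of the constraints to their entries.\<close>

lemma iso_globular_cell:
  assumes \<phi>: "\<phi> \<in> Ar M" and src: "mc_src \<phi> = p" "mc_tgt \<phi> = q"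
    and dom: "m_dom q = m_dom p" "m_cod q = m_cod p"
    and id: "mc_left \<phi> = (\<lambda>x\<in>m_dom p. x)" "mc_right \<phi> = (\<lambda>y\<in>m_cod p. y)"
    and inv: "\<And>x y. \<lbrakk>x \<in> m_dom p; y \<in> m_cod p\<rbrakk> \<Longrightarrow> \<exists>l \<in> hom V (entry q (x, y)) (entry p (x, y)).
        l \<cdot> mc_entry \<phi> (x, y) = Ident V (entry p (x, y)) \<and> mc_entry \<phi> (x, y) \<cdot> l = Ident V (entry q (x, y))"
  shows "iso M \<phi>"
proof -
  have pq: "p \<in> Ob M" "q \<in> Ob M" using matrix_cells_ArD(1,2)[OF \<phi>] src by simp_all
  have k: "mc_entry \<phi> (x, y) \<in> hom V (entry p (x, y)) (entry q (x, y))"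
    if "x \<in> m_dom p" "y \<in> m_cod p" for x y
    using matrix_cells_ArD(5-7)[OF \<phi>, of x y] that by (simp add: src id)
  have "\<phi> = mat_globular p q (mc_entry \<phi>)"
    by (rule M_eqI) (use \<phi> src id k pq dom in \<open>simp_all add: mat_globular_Ar\<close>)
  also have "iso M \<dots>" by (rule mat_globular_iso) (use pq dom k inv in auto)
  finally show ?thesis .
qed

lemma mat_lam_iso:
  assumes [simp]: "p \<in> Ob M"
  shows "iso M (mat_lam V p)"
proof (rule iso_globular_cell)
  fix x y assume "x \<in> m_dom (mat_comp V (mat_unit V (m_cod p)) p)"
    "y \<in> m_cod (mat_comp V (mat_unit V (m_cod p)) p)"
  then have [simp]: "x \<in> m_dom p" "y \<in> m_cod p" by simp_all
  let ?i = "mat_unit V (m_cod p)"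
  \<comment> \<open>The unique point of the diagonal entry: the inverse unitor sends
    \<open>a\<close> to \<open>[?u,a]\<close>, with \<open>?u\<close> precomposed by
    \<open>a\<close>.\<close>
  let ?u = "star_inj V (bracket True) () \<cdot> to_one V (entry p (x, y))"
  let ?l = "elt V ?i p x y y ?u (Ident V (entry p (x, y)))"
  note [simp] = mat_lam_entry(1)[of p x y, simplified]
  have "?l \<cdot> mc_entry (mat_lam V p) (x, y) = Ident V (entry (mat_comp V ?i p) (x, y))"
  proof (rule unit_left_ext[of p x y ?i _ "entry (mat_comp V ?i p) (x, y)"])
    fix u a assume [simp]: "u \<in> Ar V" "a \<in> Ar V" "Cod V u = star V (bracket True)"
      "Cod V a = entry p (x, y)" "Dom V u = Dom V a"
    have "star_inj V (bracket True) () \<cdot> to_one V (Dom V u) = u"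
      by (rule bracket_True_element) simp_all
    then show "(?l \<cdot> mc_entry (mat_lam V p) (x, y)) \<cdot> elt V ?i p x y y u a =
        Ident V (entry (mat_comp V ?i p) (x, y)) \<cdot> elt V ?i p x y y u a"
      by simp
  qed simp_all
  then show "\<exists>l \<in> hom V (entry p (x, y)) (entry (mat_comp V ?i p) (x, y)).
      l \<cdot> mc_entry (mat_lam V p) (x, y) = Ident V (entry (mat_comp V ?i p) (x, y)) \<and>
      mc_entry (mat_lam V p) (x, y) \<cdot> l = Ident V (entry p (x, y))"
    by (intro bexI[of _ ?l]) simp_all
qed simp_all

lemma mat_rho_iso:
  assumes [simp]: "p \<in> Ob M"
  shows "iso M (mat_rho V p)"
proof (rule iso_globular_cell)
  fix x y assume "x \<in> m_dom (mat_comp V p (mat_unit V (m_dom p)))"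
    "y \<in> m_cod (mat_comp V p (mat_unit V (m_dom p)))"
  then have [simp]: "x \<in> m_dom p" "y \<in> m_cod p" by simp_all
  let ?i = "mat_unit V (m_dom p)"
  let ?u = "star_inj V (bracket True) () \<cdot> to_one V (entry p (x, y))"
  let ?l = "elt V p ?i x x y (Ident V (entry p (x, y))) ?u"
  note [simp] = mat_rho_entry(1)[of p x y, simplified]
  have "?l \<cdot> mc_entry (mat_rho V p) (x, y) = Ident V (entry (mat_comp V p ?i) (x, y))"
  proof (rule unit_right_ext[of p x y ?i _ "entry (mat_comp V p ?i) (x, y)"])
    fix u a assume [simp]: "u \<in> Ar V" "a \<in> Ar V" "Cod V u = star V (bracket True)"
      "Cod V a = entry p (x, y)" "Dom V a = Dom V u"
    have "star_inj V (bracket True) () \<cdot> to_one V (Dom V u) = u"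
      by (rule bracket_True_element) simp_all
    then show "(?l \<cdot> mc_entry (mat_rho V p) (x, y)) \<cdot> elt V p ?i x x y a u =
        Ident V (entry (mat_comp V p ?i) (x, y)) \<cdot> elt V p ?i x x y a u"
      by simp
  qed simp_all
  then show "\<exists>l \<in> hom V (entry p (x, y)) (entry (mat_comp V p ?i) (x, y)).
      l \<cdot> mc_entry (mat_rho V p) (x, y) = Ident V (entry (mat_comp V p ?i) (x, y)) \<and>
      mc_entry (mat_rho V p) (x, y) \<cdot> l = Ident V (entry p (x, y))"
    by (intro bexI[of _ ?l]) simp_all
qed simp_all

lemma mat_alpha_iso:
  assumes [simp]: "t \<in> Ob M" "s \<in> Ob M" "r \<in> Ob M" "m_dom t = m_cod s" "m_dom s = m_cod r"
  shows "iso M (mat_alpha V t s r)"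
proof (rule iso_globular_cell)
  let ?src = "mat_comp V (mat_comp V t s) r" and ?tgt = "mat_comp V t (mat_comp V s r)"
  fix w z assume "w \<in> m_dom ?src" "z \<in> m_cod ?src"
  then have [simp]: "w \<in> m_dom r" "z \<in> m_cod t" by simp_all
  note [simp] = mat_alpha_entry(1)[OF assms, of w z, simplified]
  obtain l where [simp]: "l \<in> Ar V" "Dom V l = entry ?tgt (w, z)" "Cod V l = entry ?src (w, z)"
    and l: "\<And>x y c b a. \<lbrakk>x \<in> m_cod r; y \<in> m_cod s; c \<in> hom V (Dom V a) (entry t (y, z));
      b \<in> hom V (Dom V a) (entry s (x, y)); a \<in> hom V (Dom V a) (entry r (w, x))\<rbrakk> \<Longrightarrow>
      l \<cdot> elt V t (mat_comp V s r) w y z c (elt V s r w x y b a) =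
        elt V (mat_comp V t s) r w x z (elt V t s x y z c b) a"
    using ex_assoc_inverse[OF assms, of w z] by auto
  have "l \<cdot> mc_entry (mat_alpha V t s r) (w, z) = Ident V (entry ?src (w, z))"
    by (rule comp3_ext[OF assms, of w z _ "entry ?src (w, z)"]) (simp_all add: l)
  moreover have "mc_entry (mat_alpha V t s r) (w, z) \<cdot> l = Ident V (entry ?tgt (w, z))"
    by (rule comp3_ext'[OF assms, of w z _ "entry ?tgt (w, z)"]) (simp_all add: l)
  ultimately show "\<exists>l \<in> hom V (entry ?tgt (w, z)) (entry ?src (w, z)).
      l \<cdot> mc_entry (mat_alpha V t s r) (w, z) = Ident V (entry ?src (w, z)) \<and>
      mc_entry (mat_alpha V t s r) (w, z) \<cdot> l = Ident V (entry ?tgt (w, z))"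
    by (intro bexI[of _ l]) simp_all
qed simp_all

lemma mat_lam_natural:
  assumes \<phi> [simp]: "\<phi> \<in> Ar M"
  shows "mat_lam V (mc_tgt \<phi>) \<cdot>\<^bsub>M\<^esub>
      mat_comp_cell V (mat_unit_cell V (Fn (m_cod (mc_src \<phi>)) (m_cod (mc_tgt \<phi>)) (mc_right \<phi>))) \<phi> =
    \<phi> \<cdot>\<^bsub>M\<^esub> mat_lam V (mc_src \<phi>)" (is "?lhs = ?rhs")
proof -
  let ?h = "Fn (m_cod (mc_src \<phi>)) (m_cod (mc_tgt \<phi>)) (mc_right \<phi>)"
  have h: "?h \<in> Ar (set_cat U)" using matrix_cells_Ar_funcset[OF \<phi>] by simp
  note [simp] = mat_unit_cell_Ar[OF h] mat_unit_cell_entry[OF h, simplified]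
  show ?thesis
  proof (rule M_eqI)
    fix x y assume "x \<in> m_dom (mc_src ?rhs)" "y \<in> m_cod (mc_src ?rhs)"
    then have [simp]: "x \<in> m_dom (mc_src \<phi>)" "y \<in> m_cod (mc_src \<phi>)" by simp_all
    show "mc_entry ?lhs (x, y) = mc_entry ?rhs (x, y)"
      by (rule unit_left_ext[of "mc_src \<phi>" x y "mat_unit V (m_cod (mc_src \<phi>))" _
          "entry (mc_tgt \<phi>) (mc_left \<phi> x, mc_right \<phi> y)"]) simp_all
  qed (simp_all add: compose_def)
qed

lemma mat_rho_natural:
  assumes \<phi> [simp]: "\<phi> \<in> Ar M"
  shows "mat_rho V (mc_tgt \<phi>) \<cdot>\<^bsub>M\<^esub>
      mat_comp_cell V \<phi> (mat_unit_cell V (Fn (m_dom (mc_src \<phi>)) (m_dom (mc_tgt \<phi>)) (mc_left \<phi>))) =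
    \<phi> \<cdot>\<^bsub>M\<^esub> mat_rho V (mc_src \<phi>)" (is "?lhs = ?rhs")
proof -
  let ?h = "Fn (m_dom (mc_src \<phi>)) (m_dom (mc_tgt \<phi>)) (mc_left \<phi>)"
  have h: "?h \<in> Ar (set_cat U)" using matrix_cells_Ar_funcset[OF \<phi>] by simp
  note [simp] = mat_unit_cell_Ar[OF h] mat_unit_cell_entry[OF h, simplified]
  show ?thesis
  proof (rule M_eqI)
    fix x y assume "x \<in> m_dom (mc_src ?rhs)" "y \<in> m_cod (mc_src ?rhs)"
    then have [simp]: "x \<in> m_dom (mc_src \<phi>)" "y \<in> m_cod (mc_src \<phi>)" by simp_all
    show "mc_entry ?lhs (x, y) = mc_entry ?rhs (x, y)"
      by (rule unit_right_ext[of "mc_src \<phi>" x y "mat_unit V (m_dom (mc_src \<phi>))" _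
          "entry (mc_tgt \<phi>) (mc_left \<phi> x, mc_right \<phi> y)"]) simp_all
  qed (simp_all add: compose_def)
qed

lemma mat_alpha_natural:
  assumes [simp]: "\<tau> \<in> Ar M" "\<sigma> \<in> Ar M" "\<phi> \<in> Ar M" "mc_left \<tau> = mc_right \<sigma>" "mc_left \<sigma> = mc_right \<phi>"
    "m_dom (mc_src \<tau>) = m_cod (mc_src \<sigma>)" "m_dom (mc_tgt \<tau>) = m_cod (mc_tgt \<sigma>)"
    "m_dom (mc_src \<sigma>) = m_cod (mc_src \<phi>)" "m_dom (mc_tgt \<sigma>) = m_cod (mc_tgt \<phi>)"
  shows "mat_alpha V (mc_tgt \<tau>) (mc_tgt \<sigma>) (mc_tgt \<phi>) \<cdot>\<^bsub>M\<^esub> mat_comp_cell V (mat_comp_cell V \<tau> \<sigma>) \<phi> =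
    mat_comp_cell V \<tau> (mat_comp_cell V \<sigma> \<phi>) \<cdot>\<^bsub>M\<^esub> mat_alpha V (mc_src \<tau>) (mc_src \<sigma>) (mc_src \<phi>)"
    (is "?lhs = ?rhs")
proof (rule M_eqI)
  note [simp] = matrix_cells_ArD(3)[of \<phi> U V] matrix_cells_ArD(4)[of \<tau> U V]
  fix w z assume "w \<in> m_dom (mc_src ?rhs)" "z \<in> m_cod (mc_src ?rhs)"
  then have [simp]: "w \<in> m_dom (mc_src \<phi>)" "z \<in> m_cod (mc_src \<tau>)" by simp_all
  show "mc_entry ?lhs (w, z) = mc_entry ?rhs (w, z)"
    by (rule comp3_ext[of "mc_src \<tau>" "mc_src \<sigma>" "mc_src \<phi>" w z]) simp_all
qed (simp_all add: compose_def)

text \<open>An element \<open>[[c,u],a]\<close> has its unit component \<open>u\<close> in the entry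
  at \<open>x\<close>, \<open>y\<close>. On the diagonal both sides drop \<open>u\<close> and give
  \<open>[c,a]\<close>; elsewhere \<open>u\<close> itself forces the two sides to agree.\<close>

lemma mat_triangle:
  assumes [simp]: "s \<in> Ob M" "r \<in> Ob M" "m_dom s = m_cod r"
  shows "mat_comp_cell V (Ident M s) (mat_lam V r) \<cdot>\<^bsub>M\<^esub> mat_alpha V s (mat_unit V (m_cod r)) r =
    mat_comp_cell V (mat_rho V s) (Ident M r)" (is "?lhs = ?rhs")
proof (rule M_eqI)
  let ?i = "mat_unit V (m_cod r)"
  fix w z assume "w \<in> m_dom (mc_src ?rhs)" "z \<in> m_cod (mc_src ?rhs)"
  then have [simp]: "w \<in> m_dom r" "z \<in> m_cod s" by simp_all
  have [simp]: "mc_entry ?lhs (w, z) \<in> hom V (entry (mat_comp V (mat_comp V s ?i) r) (w, z)) (entry (mat_comp V s r) (w, z))"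
      "mc_entry ?rhs (w, z) \<in> hom V (entry (mat_comp V (mat_comp V s ?i) r) (w, z)) (entry (mat_comp V s r) (w, z))"
    by simp_all
  show "mc_entry ?lhs (w, z) = mc_entry ?rhs (w, z)"
  proof (rule comp3_ext[of s ?i r w z])
    fix x y c u a
    assume *[simp]: "x \<in> m_cod r" "y \<in> m_cod ?i" "c \<in> Ar V" "u \<in> Ar V" "a \<in> Ar V"
      "Cod V c = entry s (y, z)" "Cod V u = entry ?i (x, y)" "Cod V a = entry r (w, x)"
      "Dom V c = Dom V a" "Dom V u = Dom V a"
    show "mc_entry ?lhs (w, z) \<cdot> elt V (mat_comp V s ?i) r w x z (elt V s ?i x y z c u) a =
        mc_entry ?rhs (w, z) \<cdot> elt V (mat_comp V s ?i) r w x z (elt V s ?i x y z c u) a"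
    proof (cases "x = y")
      case True
      then show ?thesis using * by simp
    next
      case False
      show ?thesis
        by (rule unit_entry_strict[of u "Dom V a" "m_cod r" x y _ "entry (mat_comp V s r) (w, z)"])
          (use False * in simp_all)
    qed
  qed simp_all
qed (simp_all add: compose_def)

text \<open>Both routes rebracket \<open>[[[d,c],b],a]\<close> to
  \<open>[d,[c,[b,a]]]\<close>.\<close>

lemma mat_pentagon:
  assumes [simp]: "u \<in> Ob M" "t \<in> Ob M" "s \<in> Ob M" "r \<in> Ob M"
    "m_dom u = m_cod t" "m_dom t = m_cod s" "m_dom s = m_cod r"
  shows "mat_alpha V u t (mat_comp V s r) \<cdot>\<^bsub>M\<^esub> mat_alpha V (mat_comp V u t) s r =
    mat_comp_cell V (Ident M u) (mat_alpha V t s r) \<cdot>\<^bsub>M\<^esub>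
      mat_alpha V u (mat_comp V t s) r \<cdot>\<^bsub>M\<^esub> mat_comp_cell V (mat_alpha V u t s) (Ident M r)"
    (is "?lhs = ?rhs")
proof (rule M_eqI)
  fix v z assume "v \<in> m_dom (mc_src ?rhs)" "z \<in> m_cod (mc_src ?rhs)"
  then have [simp]: "v \<in> m_dom r" "z \<in> m_cod u" by simp_all
  show "mc_entry ?lhs (v, z) = mc_entry ?rhs (v, z)"
    by (rule comp4_ext[of u t s r v z]) (simp_all add: compose_def)
qed (simp_all add: compose_def)

theorem pseudodouble_Mat: "pseudodouble_category (Mat U V)" (is "pseudodouble_category ?D")
proof (rule pseudodouble_category.intro)
  show "cfunctor (D1 ?D) (D0 ?D) (hDom ?D)"
    "cfunctor (D1 ?D) (D0 ?D) (hCod ?D)"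
    "cfunctor (D0 ?D) (D1 ?D) (hUnit ?D)"
    "cfunctor (composables ?D) (D1 ?D) (hComp ?D)"
    by (simp_all add: hDom_Mat_functor hCod_Mat_functor hUnit_Mat_functor hComp_Mat_functor)
next
  fix f assume "f \<in> Ar (D0 ?D)"
  show "onAr (hDom ?D) (onAr (hUnit ?D) f) = f" "onAr (hCod ?D) (onAr (hUnit ?D) f) = f"
    by simp_all
next
  fix r assume "r \<in> Ob (D1 ?D)"
  then show "lam ?D r \<in> hom (D1 ?D) (onOb (hUnit ?D) (onOb (hCod ?D) r) \<bullet>\<^sub>0\<^bsub>?D\<^esub> r) r \<and>
      iso (D1 ?D) (lam ?D r) \<and> globular ?D (lam ?D r)"
    "rho ?D r \<in> hom (D1 ?D) (r \<bullet>\<^sub>0\<^bsub>?D\<^esub> onOb (hUnit ?D) (onOb (hDom ?D) r)) r \<and>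
      iso (D1 ?D) (rho ?D r) \<and> globular ?D (rho ?D r)"
    by (simp_all add: globular_def mat_lam_iso mat_rho_iso)
next
  fix t s r assume "(t, s) \<in> Ob (composables ?D)" "(s, r) \<in> Ob (composables ?D)"
  then show "alpha ?D t s r
       \<in> hom (D1 ?D) ((t \<bullet>\<^sub>0\<^bsub>?D\<^esub> s) \<bullet>\<^sub>0\<^bsub>?D\<^esub> r) (t \<bullet>\<^sub>0\<^bsub>?D\<^esub> s \<bullet>\<^sub>0\<^bsub>?D\<^esub> r) \<and>
       iso (D1 ?D) (alpha ?D t s r) \<and> globular ?D (alpha ?D t s r)"
    by (simp add: globular_def mat_alpha_iso)
qed (auto simp: mat_lam_natural mat_rho_natural mat_alpha_natural mat_triangle mat_pentagon)

end

section \<open>From matrices to spans\<close>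

context distributive_category
begin

lemma total_simps [simp]:
  assumes "p \<in> Ob M"
  shows "total V p \<in> Ob V"
    "\<lbrakk>x \<in> m_dom p; y \<in> m_cod p\<rbrakk> \<Longrightarrow> total_inj V p (x, y) \<in> Ar V"
    "\<lbrakk>x \<in> m_dom p; y \<in> m_cod p\<rbrakk> \<Longrightarrow> Dom V (total_inj V p (x, y)) = entry p (x, y)"
    "\<lbrakk>x \<in> m_dom p; y \<in> m_cod p\<rbrakk> \<Longrightarrow> Cod V (total_inj V p (x, y)) = total V p"
  using coprod_Ob[of "m_dom p \<times> m_cod p" "entry p"]
    inj_at_simps[of "m_dom p \<times> m_cod p" "entry p" "(x, y)"] assms
  by (auto simp: total_def total_inj_def)

text \<open>The evaluation rule keeps a trailing arrow \<open>a\<close>, since in a right-nested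
  composite an injection is followed by an element.\<close>

lemma total_copair_simps:
  assumes p: "p \<in> Ob M" and d: "d \<in> Ob V"
    and f: "\<And>x y. \<lbrakk>x \<in> m_dom p; y \<in> m_cod p\<rbrakk> \<Longrightarrow> f (x, y) \<in> hom V (entry p (x, y)) d"
  shows "total_copair V p d f \<in> Ar V" "Dom V (total_copair V p d f) = total V p" (is ?T1)
    "Cod V (total_copair V p d f) = d"
    "\<lbrakk>x \<in> m_dom p; y \<in> m_cod p; a \<in> Ar V; Cod V a = entry p (x, y)\<rbrakk>
      \<Longrightarrow> total_copair V p d f \<cdot> total_inj V p (x, y) \<cdot> a = f (x, y) \<cdot> a"
proof -
  have small: "small (m_dom p \<times> m_cod p)" and F: "\<And>i. i \<in> m_dom p \<times> m_cod p \<Longrightarrow> entry p i \<in> Ob V"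
    using p by auto
  have f': "\<And>i. i \<in> m_dom p \<times> m_cod p \<Longrightarrow> f i \<in> hom V (entry p i) d"
    using f by blast
  have ty: "total_copair V p d f \<in> Ar V \<and> Dom V (total_copair V p d f) = total V p \<and>
      Cod V (total_copair V p d f) = d"
    unfolding total_copair_def total_def by (intro conjI copair_simps small F d f')
  then show "total_copair V p d f \<in> Ar V" ?T1
    "Cod V (total_copair V p d f) = d"
    by simp_all
  have "total_copair V p d f \<cdot> total_inj V p (x, y) = f (x, y)" if "x \<in> m_dom p" "y \<in> m_cod p"
    unfolding total_copair_def total_inj_def using that by (intro copair_simps small F d f') simp_all
  then show "total_copair V p d f \<cdot> total_inj V p (x, y) \<cdot> a = f (x, y) \<cdot> a"
    if "x \<in> m_dom p" "y \<in> m_cod p" "a \<in> Ar V" "Cod V a = entry p (x, y)"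
    using that ty p by (intro Comp_reassoc) simp_all
qed

lemma total_ext:
  assumes "p \<in> Ob M" "g \<in> hom V (total V p) d" "h \<in> hom V (total V p) d"
    and "\<And>x y. \<lbrakk>x \<in> m_dom p; y \<in> m_cod p\<rbrakk> \<Longrightarrow> g \<cdot> total_inj V p (x, y) = h \<cdot> total_inj V p (x, y)"
  shows "g = h"
  by (rule coprod_ext[of "m_dom p \<times> m_cod p" "entry p" _ d])
    (use assms in \<open>auto simp: total_inj_def total_def\<close>)

lemma total_elt_ext:
  assumes "p \<in> Ob M" "g \<in> hom V (total V p) d" "h \<in> hom V (total V p) d"
    and "\<And>x y a. \<lbrakk>x \<in> m_dom p; y \<in> m_cod p; a \<in> Ar V; Cod V a = entry p (x, y)\<rbrakk>
      \<Longrightarrow> g \<cdot> total_inj V p (x, y) \<cdot> a = h \<cdot> total_inj V p (x, y) \<cdot> a"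
  shows "g = h"
proof (rule total_ext[OF assms(1-3)])
  fix x y assume "x \<in> m_dom p" "y \<in> m_cod p"
  then show "g \<cdot> total_inj V p (x, y) = h \<cdot> total_inj V p (x, y)"
    using assms(4)[of x y "Ident V (entry p (x, y))"] assms(1) by simp
qed

text \<open>The total object of a unit matrix is tested on its diagonal alone: an element at
  \<open>x\<close>, \<open>y\<close> with distinct indices has a domain out of which parallel arrows
  agree.\<close>

lemma total_unit_ext:
  assumes X: "X \<in> U" and g: "g \<in> hom V (total V (mat_unit V X)) d" and h: "h \<in> hom V (total V (mat_unit V X)) d"
    and eq: "\<And>x u. \<lbrakk>x \<in> X; u \<in> Ar V; Cod V u = star V (bracket True)\<rbrakk>
      \<Longrightarrow> g \<cdot> total_inj V (mat_unit V X) (x, x) \<cdot> u = h \<cdot> total_inj V (mat_unit V X) (x, x) \<cdot> u"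
  shows "g = h"
proof (rule total_elt_ext[of "mat_unit V X" _ d])
  fix x y u
  assume *: "x \<in> m_dom (mat_unit V X)" "y \<in> m_cod (mat_unit V X)" "u \<in> Ar V"
    "Cod V u = entry (mat_unit V X) (x, y)"
  show "g \<cdot> total_inj V (mat_unit V X) (x, y) \<cdot> u = h \<cdot> total_inj V (mat_unit V X) (x, y) \<cdot> u"
  proof (cases "x = y")
    case True
    then show ?thesis using * eq[of x u] by simp
  next
    case False
    show ?thesis
      by (rule unit_entry_strict[of u "Dom V u" X x y _ d]) (use False * X g h in simp_all)
  qed
qed (use assms in simp_all)

lemma total_comp_ext:
  assumes [simp]: "q \<in> Ob M" "p \<in> Ob M" "m_dom q = m_cod p"
    and gh: "g \<in> hom V (total V (mat_comp V q p)) d" "h \<in> hom V (total V (mat_comp V q p)) d"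
    and eq: "\<And>x y z b a. \<lbrakk>x \<in> m_dom p; y \<in> m_cod p; z \<in> m_cod q; b \<in> Ar V; a \<in> Ar V; Cod V b = entry q (y, z);
      Cod V a = entry p (x, y); Dom V b = Dom V a\<rbrakk> \<Longrightarrow>
        g \<cdot> total_inj V (mat_comp V q p) (x, z) \<cdot> elt V q p x y z b a =
        h \<cdot> total_inj V (mat_comp V q p) (x, z) \<cdot> elt V q p x y z b a"
  shows "g = h"
proof (rule total_ext[of "mat_comp V q p" _ d])
  note [simp] = gh[simplified]
  fix x z assume "x \<in> m_dom (mat_comp V q p)" "z \<in> m_cod (mat_comp V q p)"
  then have [simp]: "x \<in> m_dom p" "z \<in> m_cod q" by simp_all
  show "g \<cdot> total_inj V (mat_comp V q p) (x, z) = h \<cdot> total_inj V (mat_comp V q p) (x, z)"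
    by (rule comp_ext[of q p x z _ d]) (simp_all add: eq)
qed (use gh in simp_all)

lemma total_unit_left_ext:
  assumes [simp]: "p \<in> Ob M" and i: "i = mat_unit V (m_cod p)"
    and gh: "g \<in> hom V (total V (mat_comp V i p)) d" "h \<in> hom V (total V (mat_comp V i p)) d"
    and eq: "\<And>x y u a. \<lbrakk>x \<in> m_dom p; y \<in> m_cod p; u \<in> Ar V; a \<in> Ar V; Cod V u = star V (bracket True);
      Cod V a = entry p (x, y); Dom V u = Dom V a\<rbrakk> \<Longrightarrow>
        g \<cdot> total_inj V (mat_comp V i p) (x, y) \<cdot> elt V i p x y y u a =
        h \<cdot> total_inj V (mat_comp V i p) (x, y) \<cdot> elt V i p x y y u a"
  shows "g = h"
proof (rule total_ext[of "mat_comp V i p" _ d])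
  note [simp] = gh[simplified]
  fix x y assume "x \<in> m_dom (mat_comp V i p)" "y \<in> m_cod (mat_comp V i p)"
  then have [simp]: "x \<in> m_dom p" "y \<in> m_cod p" by (simp_all add: i)
  have [simp]: "mat_comp V i p \<in> Ob M" "m_cod i = m_cod p" by (simp_all add: i)
  have ty: "i \<in> Ob M" "m_dom i = m_cod p" "entry i (y, y) = star V (bracket True)" by (simp_all add: i)
  show "g \<cdot> total_inj V (mat_comp V i p) (x, y) = h \<cdot> total_inj V (mat_comp V i p) (x, y)"
    by (rule unit_left_ext[of p x y i _ d]) (simp_all add: eq ty, simp_all add: i)
qed (use gh in \<open>simp_all add: i\<close>)

lemma total_unit_right_ext:
  assumes [simp]: "p \<in> Ob M" and i: "i = mat_unit V (m_dom p)"
    and gh: "g \<in> hom V (total V (mat_comp V p i)) d" "h \<in> hom V (total V (mat_comp V p i)) d"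
    and eq: "\<And>x y u a. \<lbrakk>x \<in> m_dom p; y \<in> m_cod p; u \<in> Ar V; a \<in> Ar V; Cod V u = star V (bracket True);
      Cod V a = entry p (x, y); Dom V a = Dom V u\<rbrakk> \<Longrightarrow>
        g \<cdot> total_inj V (mat_comp V p i) (x, y) \<cdot> elt V p i x x y a u =
        h \<cdot> total_inj V (mat_comp V p i) (x, y) \<cdot> elt V p i x x y a u"
  shows "g = h"
proof (rule total_ext[of "mat_comp V p i" _ d])
  note [simp] = gh[simplified]
  fix x y assume "x \<in> m_dom (mat_comp V p i)" "y \<in> m_cod (mat_comp V p i)"
  then have [simp]: "x \<in> m_dom p" "y \<in> m_cod p" by (simp_all add: i)
  have [simp]: "mat_comp V p i \<in> Ob M" "m_dom i = m_dom p" by (simp_all add: i)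
  have ty: "i \<in> Ob M" "m_cod i = m_dom p" "entry i (x, x) = star V (bracket True)" by (simp_all add: i)
  show "g \<cdot> total_inj V (mat_comp V p i) (x, y) = h \<cdot> total_inj V (mat_comp V p i) (x, y)"
    by (rule unit_right_ext[of p x y i _ d]) (simp_all add: eq ty, simp_all add: i)
qed (use gh in \<open>simp_all add: i\<close>)

lemma total_comp3_ext:
  assumes [simp]: "t \<in> Ob M" "s \<in> Ob M" "r \<in> Ob M" "m_dom t = m_cod s" "m_dom s = m_cod r"
    and gh: "g \<in> hom V (total V (mat_comp V (mat_comp V t s) r)) d"
      "h \<in> hom V (total V (mat_comp V (mat_comp V t s) r)) d"
    and eq: "\<And>w x y z c b a. \<lbrakk>w \<in> m_dom r; x \<in> m_cod r; y \<in> m_cod s; z \<in> m_cod t; c \<in> Ar V; b \<in> Ar V; a \<in> Ar V;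
      Cod V c = entry t (y, z); Cod V b = entry s (x, y); Cod V a = entry r (w, x);
      Dom V c = Dom V a; Dom V b = Dom V a\<rbrakk> \<Longrightarrow>
      g \<cdot> total_inj V (mat_comp V (mat_comp V t s) r) (w, z) \<cdot> elt V (mat_comp V t s) r w x z (elt V t s x y z c b) a =
      h \<cdot> total_inj V (mat_comp V (mat_comp V t s) r) (w, z) \<cdot> elt V (mat_comp V t s) r w x z (elt V t s x y z c b) a"
  shows "g = h"
proof (rule total_ext[of "mat_comp V (mat_comp V t s) r" _ d])
  let ?tsr = "mat_comp V (mat_comp V t s) r"
  note [simp] = gh[simplified]
  fix w z assume "w \<in> m_dom ?tsr" "z \<in> m_cod ?tsr"
  then have [simp]: "w \<in> m_dom r" "z \<in> m_cod t" by simp_all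
  show "g \<cdot> total_inj V ?tsr (w, z) =
      h \<cdot> total_inj V ?tsr (w, z)"
    by (rule comp3_ext[of t s r w z _ d]) (simp_all add: eq)
qed (use gh in simp_all)

lemma star_span_simps [simp]:
  assumes [simp]: "p \<in> Ob M"
  shows "apex (star_span V p) = total V p"
    "Cod V (lleg (star_span V p)) = star V (m_dom p)" (is ?T1) "Cod V (rleg (star_span V p)) = star V (m_cod p)" (is ?T2)
    "star_span V p \<in> Ob spans"
    "\<lbrakk>x \<in> m_dom p; y \<in> m_cod p; a \<in> Ar V; Cod V a = entry p (x, y)\<rbrakk> \<Longrightarrow>
      lleg (star_span V p) \<cdot> total_inj V p (x, y) \<cdot> a = star_inj V (m_dom p) x \<cdot> to_one V (Dom V a)"
    "\<lbrakk>x \<in> m_dom p; y \<in> m_cod p; a \<in> Ar V; Cod V a = entry p (x, y)\<rbrakk> \<Longrightarrow>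
      rleg (star_span V p) \<cdot> total_inj V p (x, y) \<cdot> a = star_inj V (m_cod p) y \<cdot> to_one V (Dom V a)"
proof -
  let ?l = "\<lambda>(x, y). star_inj V (m_dom p) x \<cdot> to_one V (entry p (x, y))"
    and ?r = "\<lambda>(x, y). star_inj V (m_cod p) y \<cdot> to_one V (entry p (x, y))"
  have l: "?l (x, y) \<in> hom V (entry p (x, y)) (star V (m_dom p))"
    and r: "?r (x, y) \<in> hom V (entry p (x, y)) (star V (m_cod p))"
    if "x \<in> m_dom p" "y \<in> m_cod p" for x y
    using that by simp_all
  have dom: "star V (m_dom p) \<in> Ob V" "star V (m_cod p) \<in> Ob V" by simp_all
  note tc = total_copair_simps[OF assms]
  have legs: "lleg (star_span V p) = total_copair V p (star V (m_dom p)) ?l"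
    "rleg (star_span V p) = total_copair V p (star V (m_cod p)) ?r"
    by (simp_all add: star_span_def)
  show "apex (star_span V p) = total V p" by (simp add: star_span_def)
  then show "star_span V p \<in> Ob spans" ?T1 ?T2
    unfolding span_cells_Ob_iff legs by (auto intro!: tc dom l r)
  fix x y a
  assume *: "x \<in> m_dom p" "y \<in> m_cod p" "a \<in> Ar V" "Cod V a = entry p (x, y)"
  then show "lleg (star_span V p) \<cdot> total_inj V p (x, y) \<cdot> a = star_inj V (m_dom p) x \<cdot> to_one V (Dom V a)"
    "rleg (star_span V p) \<cdot> total_inj V p (x, y) \<cdot> a = star_inj V (m_cod p) y \<cdot> to_one V (Dom V a)"
    unfolding legs by (subst tc(4)[OF dom(1) l], simp_all) (subst tc(4)[OF dom(2) r], simp_all)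
qed

lemma star_span_cell_simps [simp]:
  "sc_src (star_span_cell V \<phi>) = star_span V (mc_src \<phi>)" "sc_tgt (star_span_cell V \<phi>) = star_span V (mc_tgt \<phi>)"
  "sc_left (star_span_cell V \<phi>) = star_map V (m_dom (mc_src \<phi>)) (m_dom (mc_tgt \<phi>)) (mc_left \<phi>)"
  "sc_right (star_span_cell V \<phi>) = star_map V (m_cod (mc_src \<phi>)) (m_cod (mc_tgt \<phi>)) (mc_right \<phi>)"
  by (simp_all add: star_span_cell_def Let_def)

lemma star_span_cell_mid:
  assumes [simp]: "\<phi> \<in> Ar M"
  shows "sc_mid (star_span_cell V \<phi>) \<in> hom V (total V (mc_src \<phi>)) (total V (mc_tgt \<phi>))" (is ?T1)
    "\<lbrakk>p = mc_src \<phi>; x \<in> m_dom p; y \<in> m_cod p; a \<in> Ar V; Cod V a = entry p (x, y)\<rbrakk> \<Longrightarrow>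
      sc_mid (star_span_cell V \<phi>) \<cdot> total_inj V p (x, y) \<cdot> a =
        total_inj V (mc_tgt \<phi>) (mc_left \<phi> x, mc_right \<phi> y) \<cdot> mc_entry \<phi> (x, y) \<cdot> a"
proof -
  let ?f = "\<lambda>(x, y). total_inj V (mc_tgt \<phi>) (mc_left \<phi> x, mc_right \<phi> y) \<cdot> mc_entry \<phi> (x, y)"
  have f: "?f (x, y) \<in> hom V (entry (mc_src \<phi>) (x, y)) (total V (mc_tgt \<phi>))"
    if "x \<in> m_dom (mc_src \<phi>)" "y \<in> m_cod (mc_src \<phi>)" for x y
    using that by simp
  have "mc_src \<phi> \<in> Ob M" "total V (mc_tgt \<phi>) \<in> Ob V" by simp_all
  note f = total_copair_simps[OF this f]
  have mid: "sc_mid (star_span_cell V \<phi>) = total_copair V (mc_src \<phi>) (total V (mc_tgt \<phi>)) ?f"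
    by (simp add: star_span_cell_def Let_def)
  show ?T1
    unfolding mid mem_hom by (intro conjI f)
  show "sc_mid (star_span_cell V \<phi>) \<cdot> total_inj V p (x, y) \<cdot> a =
        total_inj V (mc_tgt \<phi>) (mc_left \<phi> x, mc_right \<phi> y) \<cdot> mc_entry \<phi> (x, y) \<cdot> a"
    if "p = mc_src \<phi>" "x \<in> m_dom p" "y \<in> m_cod p" "a \<in> Ar V" "Cod V a = entry p (x, y)"
    unfolding mid that(1) by (subst f(4)) (use that in simp_all)
qed

lemmas star_span_cell_elt [simp] = star_span_cell_mid(2)

text \<open>A leg remembers only one index of an element, and the cell moves that index by
  \<open>mc_left\<close> or \<open>mc_right\<close>. What happens to the element itself is absorbed
  by the terminal object.\<close>

lemma star_span_cell_Ar [simp]: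
  assumes [simp]: "\<phi> \<in> Ar M"
  shows "star_span_cell V \<phi> \<in> Ar spans"
proof -
  note [simp] = star_span_cell_mid(1)[OF assms, simplified]
  have "lleg (star_span V (mc_tgt \<phi>)) \<cdot> sc_mid (star_span_cell V \<phi>) =
      star_map V (m_dom (mc_src \<phi>)) (m_dom (mc_tgt \<phi>)) (mc_left \<phi>) \<cdot> lleg (star_span V (mc_src \<phi>))"
    by (rule total_elt_ext[of "mc_src \<phi>" _ "star V (m_dom (mc_tgt \<phi>))"]) simp_all
  moreover have "rleg (star_span V (mc_tgt \<phi>)) \<cdot> sc_mid (star_span_cell V \<phi>) =
      star_map V (m_cod (mc_src \<phi>)) (m_cod (mc_tgt \<phi>)) (mc_right \<phi>) \<cdot> rleg (star_span V (mc_src \<phi>))"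
    by (rule total_elt_ext[of "mc_src \<phi>" _ "star V (m_cod (mc_tgt \<phi>))"]) simp_all
  ultimately show ?thesis
    by (subst span_cells_Ar_iff) simp
qed

lemma star_map_id [simp]: "small X \<Longrightarrow> star_map V X X (\<lambda>x\<in>X. x) = Ident V (star V X)"
  by (rule star_ext[of X _ "star V X"]) simp_all

lemma star_map_Comp:
  assumes [simp]: "small X" "small Y" "small Z" "\<And>x. x \<in> X \<Longrightarrow> f x \<in> Y" "\<And>y. y \<in> Y \<Longrightarrow> g y \<in> Z"
  shows "star_map V X Z (compose X g f) = star_map V Y Z g \<cdot> star_map V X Y f"
  by (rule star_ext[of X _ "star V Z"]) (simp_all add: compose_def)

end

section \<open>The unit and composition comparisons\<close>

locale distributive_category_with_pullbacks = distributive_category V U + category_with_pullbacks V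
  for V :: "('o, 'a, 'z) cartesian_category_scheme" (structure) and U :: "'u set set"
begin

lemma star_unit_cmp_simps [simp]:
  assumes "X \<in> U"
  shows "sc_src (star_unit_cmp V X) = star_span V (mat_unit V X)"
    "sc_tgt (star_unit_cmp V X) = span_unit V (star V X)"
    "sc_left (star_unit_cmp V X) = Ident V (star V X)" "sc_right (star_unit_cmp V X) = Ident V (star V X)"
  using assms by (simp_all add: star_unit_cmp_def)

lemma star_unit_cmp_mid:
  assumes X [simp]: "X \<in> U"
  shows "sc_mid (star_unit_cmp V X) \<in> hom V (total V (mat_unit V X)) (star V X)" (is ?T1)
    "\<lbrakk>x \<in> X; u \<in> Ar V; Cod V u = star V (bracket True)\<rbrakk> \<Longrightarrow>
      sc_mid (star_unit_cmp V X) \<cdot> total_inj V (mat_unit V X) (x, x) \<cdot> u = star_inj V X x \<cdot> to_one V (Dom V u)"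
proof -
  let ?f = "\<lambda>(x, x'). star_copair V (bracket (x = x')) (star V X) (\<lambda>_. star_inj V X x)"
  have f: "?f (x, x') \<in> hom V (entry (mat_unit V X) (x, x')) (star V X)" if "x \<in> X" "x' \<in> X" for x x'
    using that by simp
  have pd: "mat_unit V X \<in> Ob M" "star V X \<in> Ob V" by simp_all
  have f': "?f (x, x') \<in> hom V (entry (mat_unit V X) (x, x')) (star V X)"
    if "x \<in> m_dom (mat_unit V X)" "x' \<in> m_cod (mat_unit V X)" for x x'
    using f that by simp
  have mid: "sc_mid (star_unit_cmp V X) = total_copair V (mat_unit V X) (star V X) ?f"
    by (simp add: star_unit_cmp_def)
  show ?T1
    unfolding mid mem_hom by (intro conjI total_copair_simps pd f')
  show "sc_mid (star_unit_cmp V X) \<cdot> total_inj V (mat_unit V X) (x, x) \<cdot> u = star_inj V X x \<cdot> to_one V (Dom V u)"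
    if *: "x \<in> X" "u \<in> Ar V" "Cod V u = star V (bracket True)"
  proof -
    \<comment> \<open>An element of a diagonal entry factors through the injection of its only
      point, and there the copairing \<open>?f (x, x)\<close> can be evaluated.\<close>
    have u: "star_inj V (bracket True) () \<cdot> to_one V (Dom V u) = u"
      by (rule bracket_True_element) (use * in simp_all)
    have e: "?f (x, x) \<cdot> star_inj V (bracket True) () \<cdot> to_one V (Dom V u) =
        star_inj V X x \<cdot> to_one V (Dom V u)"
      using * by (intro Comp_reassoc) simp_all
    have "sc_mid (star_unit_cmp V X) \<cdot> total_inj V (mat_unit V X) (x, x) \<cdot> u = ?f (x, x) \<cdot> u"
      unfolding mid by (rule total_copair_simps(4)[OF pd f']) (use * in simp_all)
    also have "\<dots> = star_inj V X x \<cdot> to_one V (Dom V u)"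
      by (rule e[unfolded u])
    finally show ?thesis .
  qed
qed

lemmas star_unit_cmp_elt [simp] = star_unit_cmp_mid(2)

text \<open>The legs of \<open>span_unit\<close> are identities, so the comparison has to coincide
  with both legs of the source span; over the diagonal the two indices read off by these legs are
  the same.\<close>

lemma star_unit_cmp_Ar [simp]:
  assumes [simp]: "X \<in> U"
  shows "star_unit_cmp V X \<in> Ar spans"
proof -
  note [simp] = star_unit_cmp_mid(1)[OF assms, simplified]
  have "sc_mid (star_unit_cmp V X) = lleg (star_span V (mat_unit V X))"
    by (rule total_unit_ext[of X _ "star V X"]) simp_all
  moreover have "sc_mid (star_unit_cmp V X) = rleg (star_span V (mat_unit V X))"
    by (rule total_unit_ext[of X _ "star V X"]) simp_all
  ultimately show ?thesis
    by (subst span_cells_Ar_iff) simp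
qed

text \<open>This is normality. The inverse sends the index \<open>x\<close> to the point in the
  summand \<open>(x, x)\<close>: each diagonal summand is a copy of the terminal object, and the
  remaining summands are strictly initial.\<close>

lemma star_unit_cmp_iso:
  assumes [simp]: "X \<in> U"
  shows "iso spans (star_unit_cmp V X)"
proof -
  note [simp] = star_unit_cmp_mid(1)[OF assms, simplified]
  let ?i = "mat_unit V X"
  let ?l = "star_copair V X (total V ?i) (\<lambda>x. total_inj V ?i (x, x) \<cdot> star_inj V (bracket True) ())"
  have glob: "star_unit_cmp V X = span_globular V (star_span V ?i) (span_unit V (star V X)) (sc_mid (star_unit_cmp V X))"
    by (simp add: star_unit_cmp_def)
  have l_inj: "?l \<cdot> star_inj V X x \<cdot> k = total_inj V ?i (x, x) \<cdot> star_inj V (bracket True) () \<cdot> k"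
    if "x \<in> X" "k \<in> Ar V" "Cod V k = One V" for x k
    using that Comp_reassoc[of ?l "star_inj V X x" "total_inj V ?i (x, x) \<cdot> star_inj V (bracket True) ()" k]
    by simp
  show ?thesis
  proof (subst glob, rule span_globular_iso[where k' = ?l])
    show "?l \<cdot> sc_mid (star_unit_cmp V X) = Ident V (apex (star_span V ?i))"
    proof (rule total_unit_ext[of X _ "total V ?i"])
      fix x u assume *: "x \<in> X" "u \<in> Ar V" "Cod V u = star V (bracket True)"
      have "star_inj V (bracket True) () \<cdot> to_one V (Dom V u) = u"
        by (rule bracket_True_element) (use * in simp_all)
      then show "(?l \<cdot> sc_mid (star_unit_cmp V X)) \<cdot> total_inj V ?i (x, x) \<cdot> u =
          Ident V (apex (star_span V ?i)) \<cdot> total_inj V ?i (x, x) \<cdot> u"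
        using * by (simp add: l_inj)
    qed simp_all
    show "sc_mid (star_unit_cmp V X) \<cdot> ?l = Ident V (apex (span_unit V (star V X)))"
      by (rule star_ext[of X _ "star V X"]) simp_all
    show "span_globular V (star_span V ?i) (span_unit V (star V X)) (sc_mid (star_unit_cmp V X)) \<in> Ar spans"
      by (subst glob[symmetric]) simp
  qed simp_all
qed

lemma star_comp_cmp_simps [simp]:
  assumes "q \<in> Ob M" "p \<in> Ob M" "m_dom q = m_cod p"
  shows "sc_src (star_comp_cmp V q p) = star_span V (mat_comp V q p)"
    "sc_tgt (star_comp_cmp V q p) = span_comp V (star_span V q) (star_span V p)"
    "sc_left (star_comp_cmp V q p) = Ident V (star V (m_dom p))"
    "sc_right (star_comp_cmp V q p) = Ident V (star V (m_cod q))"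
  using assms by (simp_all add: star_comp_cmp_def)

text \<open>Both components of the composition comparison are of this shape: a copairing over the
  middle index nested in one over the outer indices. The two evaluations are done here at
  once.\<close>

lemma total_comp_copair_simps:
  assumes [simp]: "q \<in> Ob M" "p \<in> Ob M" "m_dom q = m_cod p" and d: "d \<in> Ob V"
    and f: "\<And>x y z. \<lbrakk>x \<in> m_dom p; y \<in> m_cod p; z \<in> m_cod q\<rbrakk> \<Longrightarrow>
      f x y z \<in> hom V (Prod V (entry q (y, z)) (entry p (x, y))) d"
  defines "h \<equiv> total_copair V (mat_comp V q p) d (\<lambda>(x, z). comp_copair V q p x z d (\<lambda>y. f x y z))"
  shows "h \<in> hom V (total V (mat_comp V q p)) d" (is ?T1)
    "\<lbrakk>x \<in> m_dom p; y \<in> m_cod p; z \<in> m_cod q; b \<in> Ar V; a \<in> Ar V; Cod V b = entry q (y, z);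
      Cod V a = entry p (x, y); Dom V b = Dom V a\<rbrakk> \<Longrightarrow>
      h \<cdot> total_inj V (mat_comp V q p) (x, z) \<cdot> elt V q p x y z b a = f x y z \<cdot> pair V b a"
proof -
  let ?g = "\<lambda>(x, z). comp_copair V q p x z d (\<lambda>y. f x y z)"
  have g: "?g (x, z) \<in> hom V (entry (mat_comp V q p) (x, z)) d"
    if "x \<in> m_dom (mat_comp V q p)" "z \<in> m_cod (mat_comp V q p)" for x z
    unfolding mem_hom prod.case using that d by (intro conjI comp_copair_simps f) simp_all
  have qp: "mat_comp V q p \<in> Ob M" by simp
  show ?T1
    unfolding h_def mem_hom by (intro conjI total_copair_simps qp d g)
  assume *: "x \<in> m_dom p" "y \<in> m_cod p" "z \<in> m_cod q" "b \<in> Ar V" "a \<in> Ar V" "Cod V b = entry q (y, z)"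
    "Cod V a = entry p (x, y)" "Dom V b = Dom V a"
  have "h \<cdot> total_inj V (mat_comp V q p) (x, z) \<cdot> elt V q p x y z b a = ?g (x, z) \<cdot> elt V q p x y z b a"
    unfolding h_def by (rule total_copair_simps(4)[OF qp d g]) (use * in simp_all)
  also have "\<dots> = f x y z \<cdot> pair V b a"
    unfolding prod.case by (rule comp_copair_simps) (use * d f in simp_all)
  finally show "h \<cdot> total_inj V (mat_comp V q p) (x, z) \<cdot> elt V q p x y z b a = f x y z \<cdot> pair V b a" .
qed

text \<open>The product in a composite entry lists the component of \<open>q\<close> first, the
  pullback that of \<open>p\<close>. Hence the first component \<open>k\<close> of the comparison is
  built from \<open>Pr2\<close> and the second, \<open>l\<close>, from \<open>Pr1\<close>.\<close>

lemma star_comp_cmp_mid: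
  assumes qp [simp]: "q \<in> Ob M" "p \<in> Ob M" "m_dom q = m_cod p"
  shows "star_comp_cmp V q p \<in> Ar spans" (is ?T1)
    "\<lbrakk>q' = mat_comp V q p; x \<in> m_dom p; y \<in> m_cod p; z \<in> m_cod q; b \<in> Ar V; a \<in> Ar V; Cod V b = entry q (y, z);
      Cod V a = entry p (x, y); Dom V b = Dom V a\<rbrakk> \<Longrightarrow>
      sc_mid (star_comp_cmp V q p) \<cdot> total_inj V q' (x, z) \<cdot> elt V q p x y z b a =
        pb_pair V (rleg (star_span V p)) (lleg (star_span V q)) (total_inj V p (x, y) \<cdot> a) (total_inj V q (y, z) \<cdot> b)"
proof -
  let ?qp = "mat_comp V q p"
  let ?f = "rleg (star_span V p)" and ?g = "lleg (star_span V q)"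
  define k where "k = total_copair V ?qp (total V p)
             (\<lambda>(x, z). comp_copair V q p x z (total V p)
                (\<lambda>y. total_inj V p (x, y) \<cdot> Pr2 V (entry q (y, z)) (entry p (x, y))))"
  define l where "l = total_copair V ?qp (total V q)
             (\<lambda>(x, z). comp_copair V q p x z (total V q)
                (\<lambda>y. total_inj V q (y, z) \<cdot> Pr1 V (entry q (y, z)) (entry p (x, y))))"
  have d: "total V p \<in> Ob V" "total V q \<in> Ob V" by simp_all
  have k: "k \<in> Ar V" "Dom V k = total V ?qp" "Cod V k = total V p"
    unfolding k_def by (use total_comp_copair_simps(1)[OF qp d(1), of "\<lambda>x y z. total_inj V p (x, y) \<cdot> Pr2 V (entry q (y, z)) (entry p (x, y))"] in simp_all)
  have l: "l \<in> Ar V" "Dom V l = total V ?qp" "Cod V l = total V q"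
    unfolding l_def by (use total_comp_copair_simps(1)[OF qp d(2), of "\<lambda>x y z. total_inj V q (y, z) \<cdot> Pr1 V (entry q (y, z)) (entry p (x, y))"] in simp_all)
  have kl: "k \<cdot> total_inj V ?qp (x, z) \<cdot> elt V q p x y z b a = total_inj V p (x, y) \<cdot> a"
      "l \<cdot> total_inj V ?qp (x, z) \<cdot> elt V q p x y z b a = total_inj V q (y, z) \<cdot> b"
    if "x \<in> m_dom p" "y \<in> m_cod p" "z \<in> m_cod q" "b \<in> Ar V" "a \<in> Ar V" "Cod V b = entry q (y, z)"
      "Cod V a = entry p (x, y)" "Dom V b = Dom V a" for x y z b a
    unfolding k_def l_def using that
    by (subst total_comp_copair_simps(2)[OF qp], simp_all)+
  note [simp] = k l
  \<comment> \<open>On \<open>[b,a]\<close> both composites record only the middle index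
    \<open>y\<close>, as the target index of \<open>a\<close> and the source index of
    \<open>b\<close>. So the pair does land in the pullback.\<close>
  have eq: "?f \<cdot> k = ?g \<cdot> l"
    by (rule total_comp_ext[OF qp, of _ "star V (m_cod p)"]) (simp_all add: kl)
  have mid: "sc_mid (star_comp_cmp V q p) = pb_pair V ?f ?g k l"
    by (simp add: star_comp_cmp_def k_def l_def)
  show "sc_mid (star_comp_cmp V q p) \<cdot> total_inj V q' (x, z) \<cdot> elt V q p x y z b a =
        pb_pair V ?f ?g (total_inj V p (x, y) \<cdot> a) (total_inj V q (y, z) \<cdot> b)"
    if "q' = ?qp" "x \<in> m_dom p" "y \<in> m_cod p" "z \<in> m_cod q" "b \<in> Ar V" "a \<in> Ar V" "Cod V b = entry q (y, z)"
      "Cod V a = entry p (x, y)" "Dom V b = Dom V a"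
    using that by (simp add: mid eq kl)
  have "lleg (star_span V p) \<cdot> k = lleg (star_span V ?qp)"
    by (rule total_comp_ext[OF qp, of _ "star V (m_dom p)"]) (simp_all add: kl)
  moreover have "rleg (star_span V q) \<cdot> l = rleg (star_span V ?qp)"
    by (rule total_comp_ext[OF qp, of _ "star V (m_cod q)"]) (simp_all add: kl)
  ultimately show ?T1
    by (subst span_cells_Ar_iff) (simp add: mid eq)
qed

lemmas star_comp_cmp_Ar [simp] = star_comp_cmp_mid(1)
  and star_comp_cmp_elt [simp] = star_comp_cmp_mid(2)

section \<open>Functoriality, naturality and coherence\<close>

lemma star_functor_simps [simp]:
  "onOb (F0 (star_functor V)) = star V"
  "onAr (F0 (star_functor V)) h = star_map V (fn_dom h) (fn_cod h) (fn_app h)"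
  "onOb (F1 (star_functor V)) = star_span V" "onAr (F1 (star_functor V)) = star_span_cell V"
  "unit_cmp (star_functor V) = star_unit_cmp V" "comp_cmp (star_functor V) = star_comp_cmp V"
  by (simp_all add: star_functor_def)

lemma F0_star_functor: "cfunctor (set_cat U) (category.truncate V) (F0 (star_functor V))" (is "cfunctor _ ?V ?F")
proof (rule cfunctorI[OF category_set_cat category_truncate])
  fix f assume "f \<in> Ar (set_cat U)"
  then have "fn_dom f \<in> U" "fn_cod f \<in> U" "\<And>x. x \<in> fn_dom f \<Longrightarrow> fn_app f x \<in> fn_cod f" by auto
  then show "onAr ?F f \<in> Ar ?V \<and>
      Dom ?V (onAr ?F f) = onOb ?F (Dom (set_cat U) f) \<and>
      Cod ?V (onAr ?F f) = onOb ?F (Cod (set_cat U) f)"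
    by simp
next
  fix f g assume fg: "f \<in> Ar (set_cat U)" "g \<in> Ar (set_cat U)" "Dom (set_cat U) g = Cod (set_cat U) f"
  then have "\<And>x. x \<in> fn_dom f \<Longrightarrow> fn_app f x \<in> fn_cod f" "\<And>x. x \<in> fn_cod f \<Longrightarrow> fn_app g x \<in> fn_cod g"
    by auto
  then show "onAr ?F (g \<cdot>\<^bsub>set_cat U\<^esub> f) =
      onAr ?F g \<cdot>\<^bsub>?V\<^esub> onAr ?F f"
    using fg star_map_Comp[of "fn_dom f" "fn_cod f" "fn_cod g" "fn_app f" "fn_app g"] by simp
qed simp_all

lemma F1_star_functor: "cfunctor M spans (F1 (star_functor V))" (is "cfunctor _ _ ?F")
proof (rule cfunctorI[OF category_matrix_cells category_span_cells])
  fix p assume "p \<in> Ob M"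
  then have [simp]: "p \<in> Ob M" .
  note [simp] = star_span_cell_mid(1)[of "Ident M p", simplified]
  have "sc_mid (star_span_cell V (Ident M p)) = Ident V (total V p)"
    by (rule total_elt_ext[of p _ "total V p"]) simp_all
  then show "onAr ?F (Ident M p) = Ident spans (onOb ?F p)"
    by (intro span_cell_eqI) simp_all
next
  fix f g assume "f \<in> Ar M" "g \<in> Ar M" "Dom M g = Cod M f"
  then have [simp]: "f \<in> Ar M" "g \<in> Ar M" "mc_src g = mc_tgt f" by simp_all
  note [simp] = matrix_cells_ArD(3,4)[of f U V] matrix_cells_ArD(3,4)[of g U V, simplified]
    star_span_cell_mid(1)[of "g \<cdot>\<^bsub>M\<^esub> f", simplified]
  have "sc_mid (star_span_cell V (g \<cdot>\<^bsub>M\<^esub> f)) = sc_mid (star_span_cell V g) \<cdot> sc_mid (star_span_cell V f)"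
    by (rule total_elt_ext[of "mc_src f" _ "total V (mc_tgt g)"]) (simp_all add: compose_def)
  then show "onAr ?F (g \<cdot>\<^bsub>M\<^esub> f) =
      onAr ?F g \<cdot>\<^bsub>spans\<^esub> onAr ?F f"
    by (intro span_cell_eqI) (simp_all add: star_map_Comp)
qed simp_all


lemma star_unit_cmp_natural:
  assumes "h \<in> Ar (set_cat U)"
  shows "star_unit_cmp V (fn_cod h) \<cdot>\<^bsub>spans\<^esub> star_span_cell V (mat_unit_cell V h) =
    SpanCell (span_unit V (star V (fn_dom h))) (span_unit V (star V (fn_cod h)))
      (star_map V (fn_dom h) (fn_cod h) (fn_app h)) (star_map V (fn_dom h) (fn_cod h) (fn_app h))
      (star_map V (fn_dom h) (fn_cod h) (fn_app h)) \<cdot>\<^bsub>spans\<^esub> star_unit_cmp V (fn_dom h)"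
proof -
  let ?X = "fn_dom h" and ?Y = "fn_cod h" and ?f = "fn_app h"
  have [simp]: "?X \<in> U" "?Y \<in> U" "\<And>x. x \<in> ?X \<Longrightarrow> ?f x \<in> ?Y" using assms by auto
  note [simp] = mat_unit_cell_Ar[OF assms] mat_unit_cell_entry[OF assms]
    star_unit_cmp_mid(1)[of ?X, simplified] star_unit_cmp_mid(1)[of ?Y, simplified]
    star_span_cell_mid(1)[OF mat_unit_cell_Ar[OF assms], simplified]
  have "sc_mid (star_unit_cmp V ?Y) \<cdot> sc_mid (star_span_cell V (mat_unit_cell V h)) =
      star_map V ?X ?Y ?f \<cdot> sc_mid (star_unit_cmp V ?X)"
    by (rule total_unit_ext[of ?X _ "star V ?Y"]) simp_all
  then show ?thesis by (intro span_cell_eqI) simp_all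
qed

text \<open>Horizontal composites act componentwise on elements of matrices and on pairs in
  pullbacks alike, and the comparison merely swaps the order of the components.\<close>

lemma star_comp_cmp_natural:
  assumes [simp]: "\<psi> \<in> Ar M" "\<phi> \<in> Ar M" "mc_left \<psi> = mc_right \<phi>"
    "m_dom (mc_src \<psi>) = m_cod (mc_src \<phi>)" "m_dom (mc_tgt \<psi>) = m_cod (mc_tgt \<phi>)"
  shows "star_comp_cmp V (mc_tgt \<psi>) (mc_tgt \<phi>) \<cdot>\<^bsub>spans\<^esub> star_span_cell V (mat_comp_cell V \<psi> \<phi>) =
    span_comp_cell V (star_span_cell V \<psi>) (star_span_cell V \<phi>) \<cdot>\<^bsub>spans\<^esub>
      star_comp_cmp V (mc_src \<psi>) (mc_src \<phi>)"
proof -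
  note [simp] = span_comp_cell_mid matrix_cells_ArD(3,4)[of \<phi> U V] matrix_cells_ArD(4)[of \<psi> U V]
  let ?t = "span_comp V (star_span V (mc_tgt \<psi>)) (star_span V (mc_tgt \<phi>))"
  have "sc_mid (star_comp_cmp V (mc_tgt \<psi>) (mc_tgt \<phi>)) \<cdot> sc_mid (star_span_cell V (mat_comp_cell V \<psi> \<phi>)) =
    sc_mid (span_comp_cell V (star_span_cell V \<psi>) (star_span_cell V \<phi>)) \<cdot>
      sc_mid (star_comp_cmp V (mc_src \<psi>) (mc_src \<phi>))"
    by (rule total_comp_ext[of "mc_src \<psi>" "mc_src \<phi>" _ "apex ?t"]) simp_all
  then show ?thesis by (intro span_cell_eqI) simp_all
qed

text \<open>By strictness only elements \<open>[u,a]\<close> on the diagonal count. The comparison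
  turns such an element into the pair of \<open>a\<close> and \<open>u\<close>, the unit comparison
  replaces \<open>u\<close> by its index, and the projection leaves \<open>a\<close>, as
  \<open>mat_lam\<close> does.\<close>

lemma star_lam_coherence:
  assumes [simp]: "p \<in> Ob M"
  shows "lam (Span V) (star_span V p) \<cdot>\<^bsub>spans\<^esub>
      span_comp_cell V (star_unit_cmp V (m_cod p)) (Ident spans (star_span V p)) \<cdot>\<^bsub>spans\<^esub>
      star_comp_cmp V (mat_unit V (m_cod p)) p = star_span_cell V (mat_lam V p)"
proof -
  note [simp] = span_comp_cell_mid star_span_cell_mid(1)[of "mat_lam V p", simplified]
  have "sc_mid (lam (Span V) (star_span V p)) \<cdot>
      sc_mid (span_comp_cell V (star_unit_cmp V (m_cod p)) (Ident spans (star_span V p))) \<cdot>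
      sc_mid (star_comp_cmp V (mat_unit V (m_cod p)) p) = sc_mid (star_span_cell V (mat_lam V p))"
    by (rule total_unit_left_ext[of p "mat_unit V (m_cod p)" _ "total V p"]) simp_all
  then show ?thesis by (intro span_cell_eqI) simp_all
qed

lemma star_rho_coherence:
  assumes [simp]: "p \<in> Ob M"
  shows "rho (Span V) (star_span V p) \<cdot>\<^bsub>spans\<^esub>
      span_comp_cell V (Ident spans (star_span V p)) (star_unit_cmp V (m_dom p)) \<cdot>\<^bsub>spans\<^esub>
      star_comp_cmp V p (mat_unit V (m_dom p)) = star_span_cell V (mat_rho V p)"
proof -
  note [simp] = span_comp_cell_mid star_span_cell_mid(1)[of "mat_rho V p", simplified]
  have "sc_mid (rho (Span V) (star_span V p)) \<cdot>
      sc_mid (span_comp_cell V (Ident spans (star_span V p)) (star_unit_cmp V (m_dom p))) \<cdot>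
      sc_mid (star_comp_cmp V p (mat_unit V (m_dom p))) = sc_mid (star_span_cell V (mat_rho V p))"
    by (rule total_unit_right_ext[of p "mat_unit V (m_dom p)" _ "total V p"]) simp_all
  then show ?thesis by (intro span_cell_eqI) simp_all
qed

text \<open>Both sides send \<open>[[c,b],a]\<close> to \<open>((a,b),c)\<close>: the left
  rebrackets the triple \<open>(a,(b,c))\<close> in the pullback, the right rebrackets to
  \<open>[c,[b,a]]\<close> before comparing.\<close>

lemma star_alpha_coherence:
  assumes [simp]: "t \<in> Ob M" "s \<in> Ob M" "r \<in> Ob M" "m_dom t = m_cod s" "m_dom s = m_cod r"
  shows "alpha (Span V) (star_span V t) (star_span V s) (star_span V r) \<cdot>\<^bsub>spans\<^esub>
      span_comp_cell V (star_comp_cmp V t s) (Ident spans (star_span V r)) \<cdot>\<^bsub>spans\<^esub>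
      star_comp_cmp V (mat_comp V t s) r =
    span_comp_cell V (Ident spans (star_span V t)) (star_comp_cmp V s r) \<cdot>\<^bsub>spans\<^esub>
      star_comp_cmp V t (mat_comp V s r) \<cdot>\<^bsub>spans\<^esub> star_span_cell V (mat_alpha V t s r)"
proof -
  note [simp] = span_comp_cell_mid span_assoc_simps star_span_cell_mid(1)[of "mat_alpha V t s r", simplified]
  have "sc_mid (alpha (Span V) (star_span V t) (star_span V s) (star_span V r)) \<cdot>
      sc_mid (span_comp_cell V (star_comp_cmp V t s) (Ident spans (star_span V r))) \<cdot>
      sc_mid (star_comp_cmp V (mat_comp V t s) r) =
    sc_mid (span_comp_cell V (Ident spans (star_span V t)) (star_comp_cmp V s r)) \<cdot>
      sc_mid (star_comp_cmp V t (mat_comp V s r)) \<cdot> sc_mid (star_span_cell V (mat_alpha V t s r))"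
    by (rule total_comp3_ext[of t s r _
        "apex (span_comp V (star_span V t) (span_comp V (star_span V s) (star_span V r)))"]) simp_all
  then show ?thesis by (intro span_cell_eqI) simp_all
qed

theorem normal_oplax_star_functor: "normal_oplax_functor (Mat U V) (Span V) (star_functor V)"
  (is "normal_oplax_functor ?D ?E ?F")
proof (intro normal_oplax_functor.intro oplax_functor.intro pseudodouble_Mat pseudodouble_Span
    oplax_functor_axioms.intro normal_oplax_functor_axioms.intro)
  show "cfunctor (D0 ?D) (D0 ?E) (F0 ?F)"
    "cfunctor (D1 ?D) (D1 ?E) (F1 ?F)"
    by (simp_all add: F0_star_functor F1_star_functor)
next
  fix f X Y assume f: "f \<in> hom (D0 ?D) X Y"
  then have "f \<in> Ar (set_cat U)" "X = fn_dom f" "Y = fn_cod f" "X \<in> U" "Y \<in> U"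
    "\<And>x. x \<in> fn_dom f \<Longrightarrow> fn_app f x \<in> fn_cod f" by auto
  then show "unit_cmp ?F Y \<cdot>\<^bsub>D1 ?E\<^esub> onAr (F1 ?F) (onAr (hUnit ?D) f) =
      onAr (hUnit ?E) (onAr (F0 ?F) f) \<cdot>\<^bsub>D1 ?E\<^esub> unit_cmp ?F X"
    using star_unit_cmp_natural[of f] by simp
next
  fix \<psi> \<phi> s s' r r'
  assume "(\<psi>, \<phi>) \<in> Ar (composables ?D)" "\<psi> \<in> hom (D1 ?D) s s'" "\<phi> \<in> hom (D1 ?D) r r'"
  then show "comp_cmp ?F s' r' \<cdot>\<^bsub>D1 ?E\<^esub> onAr (F1 ?F) (\<psi> \<bullet>\<^sub>1\<^bsub>?D\<^esub> \<phi>) =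
      (onAr (F1 ?F) \<psi> \<bullet>\<^sub>1\<^bsub>?E\<^esub> onAr (F1 ?F) \<phi>) \<cdot>\<^bsub>D1 ?E\<^esub>
        comp_cmp ?F s r"
    using star_comp_cmp_natural[of \<psi> \<phi>] by auto
next
  fix p assume "p \<in> Ob (D1 ?D)"
  then have p: "p \<in> Ob M" by simp
  show "lam ?E (onOb (F1 ?F) p) \<cdot>\<^bsub>D1 ?E\<^esub>
        (unit_cmp ?F (onOb (hCod ?D) p) \<bullet>\<^sub>1\<^bsub>?E\<^esub>
          Ident (D1 ?E) (onOb (F1 ?F) p)) \<cdot>\<^bsub>D1 ?E\<^esub>
        comp_cmp ?F (onOb (hUnit ?D) (onOb (hCod ?D) p)) p =
      onAr (F1 ?F) (lam ?D p)"
    \<comment> \<open>Vertical composites and constraints of spans stay folded, so that the goal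
      meets the instantiated lemma before either is expanded into components.\<close>
    using star_lam_coherence[OF p] by (simp del: span_cells_simps Span_constraints)
  show "rho ?E (onOb (F1 ?F) p) \<cdot>\<^bsub>D1 ?E\<^esub>
        (Ident (D1 ?E) (onOb (F1 ?F) p) \<bullet>\<^sub>1\<^bsub>?E\<^esub>
          unit_cmp ?F (onOb (hDom ?D) p)) \<cdot>\<^bsub>D1 ?E\<^esub>
        comp_cmp ?F p (onOb (hUnit ?D) (onOb (hDom ?D) p)) =
      onAr (F1 ?F) (rho ?D p)"
    using star_rho_coherence[OF p] by (simp del: span_cells_simps Span_constraints)
next
  fix t s r assume "(t, s) \<in> Ob (composables ?D)" "(s, r) \<in> Ob (composables ?D)"
  then show "alpha ?E (onOb (F1 ?F) t) (onOb (F1 ?F) s)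
        (onOb (F1 ?F) r) \<cdot>\<^bsub>D1 ?E\<^esub>
        (comp_cmp ?F t s \<bullet>\<^sub>1\<^bsub>?E\<^esub> Ident (D1 ?E) (onOb (F1 ?F) r)) \<cdot>\<^bsub>D1 ?E\<^esub>
        comp_cmp ?F (t \<bullet>\<^sub>0\<^bsub>?D\<^esub> s) r =
      (Ident (D1 ?E) (onOb (F1 ?F) t) \<bullet>\<^sub>1\<^bsub>?E\<^esub> comp_cmp ?F s r) \<cdot>\<^bsub>D1 ?E\<^esub>
        comp_cmp ?F t (s \<bullet>\<^sub>0\<^bsub>?D\<^esub> r) \<cdot>\<^bsub>D1 ?E\<^esub>
        onAr (F1 ?F) (alpha ?D t s r)"
    using star_alpha_coherence[of t s r] by (simp del: span_cells_simps Span_constraints)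
qed (simp_all add: globular_def star_unit_cmp_iso)

end

theorem proposition2p2:
  fixes U :: "'u set set"
    and V :: "('o, 'a) cartesian_category"
  assumes "small_universe U"
    and "cartesian_monoidal_category V"
    and "distributive U V"
    and "has_finite_limits V"
  shows "normal_oplax_functor (Mat U V) (Span V) (star_functor V)"
proof -
  interpret cartesian_monoidal_category V by fact
  \<comment> \<open>Finite limits enter through the pullbacks by which spans are composed.\<close>
  interpret category_with_pullbacks V
    using assms(4) by (rule has_finite_limits_imp_pullbacks)
  interpret distributive_category_with_pullbacks V U
    by unfold_locales (use assms in simp_all)
  show ?thesis by (rule normal_oplax_star_functor)
qed

end
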